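(* Assume that, for some $T<\infty$, the following hold. (1) $|q|_\infty<\infty$, and for all $0\le t\le T$, $g_t$ is positive and $|g_t|_\infty<\infty$. (2) $|\omega_t|_\infty<\infty$ for all $0\le t\le T$, and $|\vartheta_t|_\infty<\infty$, $|p_t|_\infty<\infty$ for all $1\le t\le T$. (3) For all $0\le t\le T-1$, $|\vartheta_{t|T}/\gamma_{t+1}|_\infty<\infty$ and $|r_{t|T}|_\infty<\infty$; for all $0\le t\le T$, $|\check\omega_{t|T}|_\infty<\infty$; and for all $1\le t\le T-1$, $|\tilde\vartheta_{t|T}\odot\gamma_{t+1}^{-1}|_\infty<\infty$, $|q\odot\gamma_{t+1}^{-1}|_\infty<\infty$, $|\tilde\omega_{t|T}|_\infty<\infty$ and $|\tilde r_{t|T}|_\infty<\infty$. Then, for all $1\le s\le T-1$, there exist constants $0<B_{s|T},C_{s|T}<\infty$ such that for all $N\ge1$, all $\epsilon>0$ and all bounded measurable $h:\mathsf X\to\mathbb R$, the weighted sample $\{(\tilde\omega_{s|T}^\ell,\tilde\xi_{s|T}^\ell)\}_{\ell=1}^N$ produced by the two-filter algorithm of Fearnhead, Wyncoll and Tawn satisfies $$\mathbb P\left(\left|\sum_{i=1}^N\frac{\tilde\omega_{s|T}^i}{\tilde\Omega_{s|T}}h(\tilde\xi_{s|T}^i)-\phi_{\chi,s|T}[h]\right|>\epsilon\right)\le B_{s|T}\,e^{-C_{s|T}N\epsilon^2/\mathrm{osc}^2(h)}.$$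
   Context: **Model.** $(\mathsf X,\mathcal X)$ is a measurable space with countably generated $\sigma$-field, $\lambda$ a ($\sigma$-finite) measure on it; $dx$ stands for $\lambda(dx)$. $Q$ is a Markov kernel on $\mathsf X$ with $Q(x,dx')=q(x,x')\,dx'$. $g_0,\dots,g_T$ are positive measurable functions on $\mathsf X$, $\chi$ a probability on $\mathsf X$. $|\cdot|_\infty$ is the supremum norm, $\mathrm{osc}(h)=\sup_{z,z'}|h(z)-h(z')|$ (when $\mathrm{osc}(h)=0$ the exponential bound is read as $0$), and $(f\odot g)(x,x')=f(x,x')g(x')$ for $f:\mathsf X^2\to\mathbb R$, $g:\mathsf X\to\mathbb R$. The marginal smoothing distribution is $$\phi_{\chi,s|T}[h]=\frac{\int\chi(dx_0)g_0(x_0)\prod_{u=1}^TQ(x_{u-1},dx_u)g_u(x_u)\,h(x_s)}{\int\chi(dx_0)g_0(x_0)\prod_{u=1}^TQ(x_{u-1},dx_u)g_u(x_u)}.$$ $\gamma_0,\dots,\gamma_T$ are positive measurable functions with $\int\gamma_t(x_t)dx_t\left[\prod_{u=t+1}^Tg_{u-1}(x_{u-1})Q(x_{u-1},dx_u)\right]g_T(x_T)<\infty$ for all $0\le t\le T$. **Forward filter.** $\rho_0$ is a probability with $\chi\ll\rho_0$; for $1\le t\le T$, $\vartheta_t\ge0$ is a measurable function on $\mathsf X$ and $p_t(x,\cdot)$ a Markov transition density w.r.t. $\lambda$. Set $$\omega_0(x)=\frac{d\chi}{d\rho_0}(x)g_0(x),\qquad \omega_t(x,x')=\frac{q(x,x')g_t(x')}{\vartheta_t(x)p_t(x,x')}\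 (t\ge1).$$ $\xi_0^1,\dots,\xi_0^N$ are i.i.d. from $\rho_0$, $\omega_0^\ell=\omega_0(\xi_0^\ell)$. For $s\ge1$, conditionally on the past, the pairs $(I_s^\ell,\xi_s^\ell)$, $1\le \ell\le N$, are i.i.d. on $\{1,\dots,N\}\times\mathsf X$ with density proportional to $(i,x)\mapsto\omega_{s-1}^i\vartheta_s(\xi_{s-1}^i)p_s(\xi_{s-1}^i,x)$, and $\omega_s^\ell=\omega_s(\xi_{s-1}^{I_s^\ell},\xi_s^\ell)$. **Backward filter.** $\check\rho_T$ is a probability density on $\mathsf X$; for $0\le t\le T-1$, $\vartheta_{t|T}\ge0$ is a measurable function on $\mathsf X$ and $r_{t|T}(x',\cdot)$ a Markov transition density. Set $$\check\omega_{T|T}(x)=\frac{g_T(x)\gamma_T(x)}{\check\rho_T(x)},\qquad\check\omega_{t|T}(x,x')=\frac{\gamma_t(x)g_t(x)q(x,x')}{\vartheta_{t|T}(x')r_{t|T}(x',x)}\ (t<T).$$ $\check\xi_{T|T}^1,\dots,\check\xi_{T|T}^N$ are i.i.d. from $\check\rho_T$, $\check\omega_{T|T}^i=\check\omega_{T|T}(\check\xi_{T|T}^i)$. For $t=T-1,\dots,0$, conditionally on the previously generated backward particles, the pairs $(\check I_t^i,\check\xi_{t|T}^i)$, $1\le i\le N$, are i.i.d. with density proportional to $(j,x)\mapsto\check\omega_{t+1|T}^j\,\vartheta_{t|T}(\check\xi_{t+1|T}^j)\,\gamma_{t+1}^{-1}(\check\xi_{t+1|T}^j)\,r_{t|T}(\check\xi_{t+1|T}^j,x)$,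 and $\check\omega_{t|T}^i=\check\omega_{t|T}(\check\xi_{t|T}^i,\check\xi_{t+1|T}^{\check I_t^i})$. The forward and backward particle systems are independent. **Two-filter algorithm of Fearnhead, Wyncoll and Tawn.** For $1\le t\le T-1$, $\tilde\vartheta_{t|T}\ge0$ is a measurable function on $\mathsf X^2$, $\tilde r_{t|T}(x,x';\cdot)$ is a probability density w.r.t. $\lambda$ for each $(x,x')$, and $$\tilde\omega_{t|T}(x,x';x'')=\frac{q(x,x'')q(x'',x')g_t(x'')}{\tilde\vartheta_{t|T}(x,x')\tilde r_{t|T}(x,x';x'')}.$$ For $1\le s\le T-1$, conditionally on the forward particles and weights up to time $s-1$ and the backward particles and weights from time $T$ down to $s+1$, the triples $(I_s^\ell,\check I_s^\ell,\tilde\xi_{s|T}^\ell)$, $1\le\ell\le N$ (fresh indices, not those of the filters), are i.i.d. on $\{1,\dots,N\}^2\times\mathsf X$ with density proportional to $$(i,j,x)\mapsto\frac{\omega_{s-1}^i\,\tilde\vartheta_{s|T}(\xi_{s-1}^i,\check\xi_{s+1|T}^j)\,\check\omega_{s+1|T}^j}{\gamma_{s+1}(\check\xi_{s+1|T}^j)}\,\tilde r_{s|T}(\xi_{s-1}^i,\check\xi_{s+1|T}^j;x),$$ and $\tilde\omega_{s|T}^\ell=\tilde\omega_{s|T}(\xi_{s-1}^{I_s^\ell},\check\xi_{s+1|T}^{\check I_s^\ell};\tilde\xi_{s|T}^\ell)$, $\tilde\Omega_{s|T}=\sum_{\ell=1}^N\tilde\omega_{s|T}^\ell$. **Conventions.**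 In weight functions, $0/0=0$ and $c/0=\infty$ for $c>0$. All sums of weights and normalizing constants appearing in denominators are assumed almost surely positive, so that all estimators and sampling distributions are well defined. *)

theory Defs
  imports "HOL-Probability.Probability"
begin

text \<open>
  All functions whose supremum norm is taken are nonnegative, so the norm is formed in
  \<^typ>\<open>ennreal\<close>; being finite means being bounded on the set \<^term>\<open>A\<close>.
\<close>

definition sup_norm :: "'b set \<Rightarrow> ('b \<Rightarrow> ennreal) \<Rightarrow> ennreal" where
  "sup_norm A f = (SUP x\<in>A. f x)"

definition osc :: "'a set \<Rightarrow> ('a \<Rightarrow> real) \<Rightarrow> real" where
  "osc A h = (SUP (z, z')\<in>A \<times> A. \<bar>h z - h z'\<bar>)"

definition countably_generated :: "'a measure \<Rightarrow> bool" where
  "countably_generated L \<longleftrightarrow>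
     (\<exists>E. countable E \<and> E \<subseteq> Pow (space L) \<and> sets L = sigma_sets (space L) E)"

definition probability_density :: "'a measure \<Rightarrow> ('a \<Rightarrow> real) \<Rightarrow> bool" where
  "probability_density L f \<longleftrightarrow>
     f \<in> borel_measurable L \<and> (\<forall>x\<in>space L. 0 \<le> f x) \<and> (\<integral>\<^sup>+x. ennreal (f x) \<partial>L) = 1"

definition transition_density :: "'b measure \<Rightarrow> 'a measure \<Rightarrow> ('b \<Rightarrow> 'a \<Rightarrow> real) \<Rightarrow> bool" where
  "transition_density K L k \<longleftrightarrow>
     (\<lambda>(x, y). k x y) \<in> borel_measurable (K \<Otimes>\<^sub>M L) \<and>
     (\<forall>x\<in>space K. probability_density L (k x))"

definition positive_function :: "'a measure \<Rightarrow> ('a \<Rightarrow> real) \<Rightarrow> bool" where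
  "positive_function L f \<longleftrightarrow> f \<in> borel_measurable L \<and> (\<forall>x\<in>space L. 0 < f x)"

definition nonneg_function :: "'a measure \<Rightarrow> ('a \<Rightarrow> real) \<Rightarrow> bool" where
  "nonneg_function L f \<longleftrightarrow> f \<in> borel_measurable L \<and> (\<forall>x\<in>space L. 0 \<le> f x)"

text \<open>
  Since \<open>Q(x,dx') = q(x,x') \<lambda>(dx')\<close>, the integrals over trajectories are integrals against the
  product measures \<open>\<chi> \<otimes> \<lambda>\<^sup>T\<close> (smoothing) and \<open>\<lambda>\<^bsup>T-t+1\<^esup>\<close> (condition on the artificial
  densities) on functions \<^term>\<open>x\<close> of the time index.
\<close>

definition path_integral ::
  "'a measure \<Rightarrow> ('a \<Rightarrow> 'a \<Rightarrow> real) \<Rightarrow> (nat \<Rightarrow> 'a \<Rightarrow> real) \<Rightarrow> 'a measure \<Rightarrow> nat \<Rightarrow>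
    ((nat \<Rightarrow> 'a) \<Rightarrow> real) \<Rightarrow> real" where
  "path_integral lam q g chi T F =
     (\<integral>x. g 0 (x 0) * (\<Prod>u=1..T. q (x (u - 1)) (x u) * g u (x u)) * F x
        \<partial>(\<Pi>\<^sub>M u\<in>{0..T}. if u = 0 then chi else lam))"

definition marginal_smoothing ::
  "'a measure \<Rightarrow> ('a \<Rightarrow> 'a \<Rightarrow> real) \<Rightarrow> (nat \<Rightarrow> 'a \<Rightarrow> real) \<Rightarrow> 'a measure \<Rightarrow> nat \<Rightarrow> nat \<Rightarrow>
    ('a \<Rightarrow> real) \<Rightarrow> real" where
  "marginal_smoothing lam q g chi T s h =
     path_integral lam q g chi T (\<lambda>x. h (x s)) / path_integral lam q g chi T (\<lambda>x. 1)"

definition artificial_mass ::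
  "'a measure \<Rightarrow> ('a \<Rightarrow> 'a \<Rightarrow> real) \<Rightarrow> (nat \<Rightarrow> 'a \<Rightarrow> real) \<Rightarrow> (nat \<Rightarrow> 'a \<Rightarrow> real) \<Rightarrow> nat \<Rightarrow> nat \<Rightarrow>
    ennreal" where
  "artificial_mass lam q g gamma T t =
     (\<integral>\<^sup>+x. ennreal (gamma t (x t) * (\<Prod>u=t+1..T. g (u - 1) (x (u - 1)) * q (x (u - 1)) (x u))
              * g T (x T))
        \<partial>(\<Pi>\<^sub>M u\<in>{t..T}. lam))"

text \<open>
  The weights are \<^typ>\<open>ennreal\<close>-valued because division there obeys the conventions
  \<open>0 / 0 = 0\<close> and \<open>c / 0 = \<infinity>\<close> for \<open>c > 0\<close>; with real division a bound on the weights would say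
  nothing about the points where the proposal vanishes.  In \<open>fwd_weight_init\<close>, the
  argument \<open>D\<close> is a version of the density \<open>d\<chi>/d\<rho>\<^sub>0\<close>.
\<close>

definition fwd_weight_init :: "('a \<Rightarrow> ennreal) \<Rightarrow> (nat \<Rightarrow> 'a \<Rightarrow> real) \<Rightarrow> 'a \<Rightarrow> ennreal" where
  "fwd_weight_init D g x = D x * ennreal (g 0 x)"

definition fwd_weight ::
  "('a \<Rightarrow> 'a \<Rightarrow> real) \<Rightarrow> (nat \<Rightarrow> 'a \<Rightarrow> real) \<Rightarrow> (nat \<Rightarrow> 'a \<Rightarrow> real) \<Rightarrow> (nat \<Rightarrow> 'a \<Rightarrow> 'a \<Rightarrow> real) \<Rightarrow>
    nat \<Rightarrow> 'a \<Rightarrow> 'a \<Rightarrow> ennreal" where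
  "fwd_weight q g th p t x x' = ennreal (q x x' * g t x') / ennreal (th t x * p t x x')"

definition bwd_weight_init ::
  "(nat \<Rightarrow> 'a \<Rightarrow> real) \<Rightarrow> (nat \<Rightarrow> 'a \<Rightarrow> real) \<Rightarrow> ('a \<Rightarrow> real) \<Rightarrow> nat \<Rightarrow> 'a \<Rightarrow> ennreal" where
  "bwd_weight_init g gamma rhoT T x = ennreal (g T x * gamma T x) / ennreal (rhoT x)"

definition bwd_weight ::
  "('a \<Rightarrow> 'a \<Rightarrow> real) \<Rightarrow> (nat \<Rightarrow> 'a \<Rightarrow> real) \<Rightarrow> (nat \<Rightarrow> 'a \<Rightarrow> real) \<Rightarrow> (nat \<Rightarrow> 'a \<Rightarrow> real) \<Rightarrow>
    (nat \<Rightarrow> 'a \<Rightarrow> 'a \<Rightarrow> real) \<Rightarrow> nat \<Rightarrow> 'a \<Rightarrow> 'a \<Rightarrow> ennreal" where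
  "bwd_weight q g gamma thb r t x x' =
     ennreal (gamma t x * g t x * q x x') / ennreal (thb t x' * r t x' x)"

definition two_filter_weight ::
  "('a \<Rightarrow> 'a \<Rightarrow> real) \<Rightarrow> (nat \<Rightarrow> 'a \<Rightarrow> real) \<Rightarrow> (nat \<Rightarrow> 'a \<Rightarrow> 'a \<Rightarrow> real) \<Rightarrow>
    (nat \<Rightarrow> 'a \<times> 'a \<Rightarrow> 'a \<Rightarrow> real) \<Rightarrow> nat \<Rightarrow> 'a \<Rightarrow> 'a \<Rightarrow> 'a \<Rightarrow> ennreal" where
  "two_filter_weight q g tht rt t x x' x'' =
     ennreal (q x x'' * q x'' x' * g t x'') / ennreal (tht t x x' * rt t (x, x') x'')"

definition normalized_density :: "'b measure \<Rightarrow> ('b \<Rightarrow> ennreal) \<Rightarrow> 'b measure" where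
  "normalized_density S f = density S (\<lambda>y. f y / (\<integral>\<^sup>+z. f z \<partial>S))"

text \<open>
  Conditionally on the sub-\<open>\<sigma>\<close>-field \<open>F\<close>, the variables \<open>Y 1, \<dots>, Y N\<close> are i.i.d. with
  \<open>F\<close>-measurable random density proportional to \<open>f w\<close> with respect to \<open>S\<close>: the conditional
  probability of a product event given \<open>F\<close> is the product of the probabilities under the
  normalized density.
\<close>

definition cond_iid ::
  "'w measure \<Rightarrow> 'w set set \<Rightarrow> nat \<Rightarrow> 'b measure \<Rightarrow> ('w \<Rightarrow> 'b \<Rightarrow> ennreal) \<Rightarrow> (nat \<Rightarrow> 'w \<Rightarrow> 'b) \<Rightarrow>
    bool" where
  "cond_iid M F N S f Y \<longleftrightarrow>
     (AE w in M. 0 < (\<integral>\<^sup>+y. f w y \<partial>S) \<and> (\<integral>\<^sup>+y. f w y \<partial>S) < \<infinity>) \<and>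
     (\<forall>l\<in>{1..N}. Y l \<in> M \<rightarrow>\<^sub>M S) \<and>
     (\<forall>A\<in>F. \<forall>B\<in>{1..N} \<rightarrow> sets S.
        emeasure M {w\<in>A. \<forall>l\<in>{1..N}. Y l w \<in> B l} =
        (\<integral>\<^sup>+w\<in>A. (\<Prod>l=1..N. emeasure (normalized_density S (f w)) (B l)) \<partial>M))"

definition iid_sample :: "'w measure \<Rightarrow> nat \<Rightarrow> 'a measure \<Rightarrow> (nat \<Rightarrow> 'w \<Rightarrow> 'a) \<Rightarrow> bool" where
  "iid_sample M N rho Y \<longleftrightarrow>
     prob_space.indep_vars M (\<lambda>_. rho) Y {1..N} \<and> (\<forall>l\<in>{1..N}. distr M rho (Y l) = rho)"

text \<open>
  Particles \<open>xi t l\<close> and ancestor indices \<open>I t l\<close> are random variables on \<open>M\<close>;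
  \<open>particle_events\<close> generates the \<open>\<sigma>\<close>-field of the particles at the times in \<open>U\<close> and the
  indices at the times in \<open>V\<close>.  The weights are functions of these.
\<close>

definition particle_events ::
  "'w measure \<Rightarrow> 'a measure \<Rightarrow> nat \<Rightarrow> (nat \<Rightarrow> nat \<Rightarrow> 'w \<Rightarrow> 'a) \<Rightarrow> (nat \<Rightarrow> nat \<Rightarrow> 'w \<Rightarrow> nat) \<Rightarrow>
    nat set \<Rightarrow> nat set \<Rightarrow> 'w set set" where
  "particle_events M lam N xi I U V =
     {{w\<in>space M. xi u l w \<in> B} | u l B. u \<in> U \<and> l \<in> {1..N} \<and> B \<in> sets lam} \<union>
     {{w\<in>space M. I u l w = i} | u l i. u \<in> V \<and> l \<in> {1..N}}"

definition forward_filter ::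
  "'a measure \<Rightarrow> ('a \<Rightarrow> 'a \<Rightarrow> real) \<Rightarrow> (nat \<Rightarrow> 'a \<Rightarrow> real) \<Rightarrow> 'a measure \<Rightarrow> ('a \<Rightarrow> ennreal) \<Rightarrow>
    (nat \<Rightarrow> 'a \<Rightarrow> real) \<Rightarrow> (nat \<Rightarrow> 'a \<Rightarrow> 'a \<Rightarrow> real) \<Rightarrow> nat \<Rightarrow> nat \<Rightarrow> 'w measure \<Rightarrow>
    (nat \<Rightarrow> nat \<Rightarrow> 'w \<Rightarrow> 'a) \<Rightarrow> (nat \<Rightarrow> nat \<Rightarrow> 'w \<Rightarrow> nat) \<Rightarrow> (nat \<Rightarrow> nat \<Rightarrow> 'w \<Rightarrow> ennreal) \<Rightarrow> bool" where
  "forward_filter lam q g rho0 D th p T N M xi I wt \<longleftrightarrow>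
     iid_sample M N rho0 (xi 0) \<and>
     (\<forall>l\<in>{1..N}. \<forall>w\<in>space M. wt 0 l w = fwd_weight_init D g (xi 0 l w)) \<and>
     (\<forall>s\<in>{1..T}.
        cond_iid M (sigma_sets (space M) (particle_events M lam N xi I {0..<s} {1..<s})) N
          (count_space {1..N} \<Otimes>\<^sub>M lam)
          (\<lambda>w (i, x). wt (s - 1) i w *
             ennreal (th s (xi (s - 1) i w) * p s (xi (s - 1) i w) x))
          (\<lambda>l w. (I s l w, xi s l w)) \<and>
        (\<forall>l\<in>{1..N}. \<forall>w\<in>space M.
           wt s l w = fwd_weight q g th p s (xi (s - 1) (I s l w) w) (xi s l w)))"

definition backward_filter ::
  "'a measure \<Rightarrow> ('a \<Rightarrow> 'a \<Rightarrow> real) \<Rightarrow> (nat \<Rightarrow> 'a \<Rightarrow> real) \<Rightarrow> (nat \<Rightarrow> 'a \<Rightarrow> real) \<Rightarrow> ('a \<Rightarrow> real) \<Rightarrow>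
    (nat \<Rightarrow> 'a \<Rightarrow> real) \<Rightarrow> (nat \<Rightarrow> 'a \<Rightarrow> 'a \<Rightarrow> real) \<Rightarrow> nat \<Rightarrow> nat \<Rightarrow> 'w measure \<Rightarrow>
    (nat \<Rightarrow> nat \<Rightarrow> 'w \<Rightarrow> 'a) \<Rightarrow> (nat \<Rightarrow> nat \<Rightarrow> 'w \<Rightarrow> nat) \<Rightarrow> (nat \<Rightarrow> nat \<Rightarrow> 'w \<Rightarrow> ennreal) \<Rightarrow> bool" where
  "backward_filter lam q g gamma rhoT thb r T N M xib Ib wtb \<longleftrightarrow>
     iid_sample M N (density lam (\<lambda>x. ennreal (rhoT x))) (xib T) \<and>
     (\<forall>i\<in>{1..N}. \<forall>w\<in>space M. wtb T i w = bwd_weight_init g gamma rhoT T (xib T i w)) \<and>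
     (\<forall>t\<in>{0..<T}.
        cond_iid M (sigma_sets (space M) (particle_events M lam N xib Ib {t<..T} {t<..<T})) N
          (count_space {1..N} \<Otimes>\<^sub>M lam)
          (\<lambda>w (j, x). wtb (t + 1) j w *
             ennreal (thb t (xib (t + 1) j w) / gamma (t + 1) (xib (t + 1) j w)
                        * r t (xib (t + 1) j w) x))
          (\<lambda>i w. (Ib t i w, xib t i w)) \<and>
        (\<forall>i\<in>{1..N}. \<forall>w\<in>space M.
           wtb t i w = bwd_weight q g gamma thb r t (xib t i w) (xib (t + 1) (Ib t i w) w)))"

definition independent_filters ::
  "'a measure \<Rightarrow> nat \<Rightarrow> nat \<Rightarrow> 'w measure \<Rightarrow>
    (nat \<Rightarrow> nat \<Rightarrow> 'w \<Rightarrow> 'a) \<Rightarrow> (nat \<Rightarrow> nat \<Rightarrow> 'w \<Rightarrow> nat) \<Rightarrow>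
    (nat \<Rightarrow> nat \<Rightarrow> 'w \<Rightarrow> 'a) \<Rightarrow> (nat \<Rightarrow> nat \<Rightarrow> 'w \<Rightarrow> nat) \<Rightarrow> bool" where
  "independent_filters lam T N M xi I xib Ib \<longleftrightarrow>
     prob_space.indep_set M
       (sigma_sets (space M) (particle_events M lam N xi I {0..T} {1..T}))
       (sigma_sets (space M) (particle_events M lam N xib Ib {0..T} {0..<T}))"

definition two_filter_sample ::
  "'a measure \<Rightarrow> ('a \<Rightarrow> 'a \<Rightarrow> real) \<Rightarrow> (nat \<Rightarrow> 'a \<Rightarrow> real) \<Rightarrow> (nat \<Rightarrow> 'a \<Rightarrow> real) \<Rightarrow>
    (nat \<Rightarrow> 'a \<Rightarrow> 'a \<Rightarrow> real) \<Rightarrow> (nat \<Rightarrow> 'a \<times> 'a \<Rightarrow> 'a \<Rightarrow> real) \<Rightarrow> nat \<Rightarrow> nat \<Rightarrow> nat \<Rightarrow> 'w measure \<Rightarrow>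
    (nat \<Rightarrow> nat \<Rightarrow> 'w \<Rightarrow> 'a) \<Rightarrow> (nat \<Rightarrow> nat \<Rightarrow> 'w \<Rightarrow> nat) \<Rightarrow> (nat \<Rightarrow> nat \<Rightarrow> 'w \<Rightarrow> ennreal) \<Rightarrow>
    (nat \<Rightarrow> nat \<Rightarrow> 'w \<Rightarrow> 'a) \<Rightarrow> (nat \<Rightarrow> nat \<Rightarrow> 'w \<Rightarrow> nat) \<Rightarrow> (nat \<Rightarrow> nat \<Rightarrow> 'w \<Rightarrow> ennreal) \<Rightarrow>
    (nat \<Rightarrow> 'w \<Rightarrow> 'a) \<Rightarrow> (nat \<Rightarrow> 'w \<Rightarrow> nat) \<Rightarrow> (nat \<Rightarrow> 'w \<Rightarrow> nat) \<Rightarrow> (nat \<Rightarrow> 'w \<Rightarrow> ennreal) \<Rightarrow> bool" where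
  "two_filter_sample lam q g gamma tht rt T s N M xi I wt xib Ib wtb xit It Jt wtt \<longleftrightarrow>
     cond_iid M
       (sigma_sets (space M)
          (particle_events M lam N xi I {0..<s} {1..<s} \<union>
           particle_events M lam N xib Ib {s<..T} {s<..<T})) N
       (count_space {1..N} \<Otimes>\<^sub>M (count_space {1..N} \<Otimes>\<^sub>M lam))
       (\<lambda>w (i, j, x). wt (s - 1) i w * wtb (s + 1) j w *
          ennreal (tht s (xi (s - 1) i w) (xib (s + 1) j w) / gamma (s + 1) (xib (s + 1) j w)
                     * rt s (xi (s - 1) i w, xib (s + 1) j w) x))
       (\<lambda>l w. (It l w, Jt l w, xit l w)) \<and>
     (\<forall>l\<in>{1..N}. \<forall>w\<in>space M.
        wtt l w = two_filter_weight q g tht rt s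
                    (xi (s - 1) (It l w) w) (xib (s + 1) (Jt l w) w) (xit l w)) \<and>
     (AE w in M. 0 < (\<Sum>l=1..N. wtt l w))"

definition weighted_mean ::
  "nat \<Rightarrow> (nat \<Rightarrow> 'w \<Rightarrow> ennreal) \<Rightarrow> (nat \<Rightarrow> 'w \<Rightarrow> 'a) \<Rightarrow> ('a \<Rightarrow> real) \<Rightarrow> 'w \<Rightarrow> real" where
  "weighted_mean N wt xi h w =
     (\<Sum>i=1..N. enn2real (wt i w / (\<Sum>l=1..N. wt l w)) * h (xi i w))"

end

theory Submission
  imports Defs
begin

text \<open>
  The particles of one stage are, given the past, i.i.d. draws from a mixture over the parents, so
  averages of their weights obey a conditional Hoeffding bound around a ratio of weighted averages
  over the parents. A deviation bound for the parents, uniform over test functions with values in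
  \<open>[0, 1]\<close>, is therefore inherited by the children, with constants depending only on the sup norms
  of the weights and the adjustment multipliers and on the limiting masses. For the two-filter
  step the parents are the pairs of a forward and a backward particle; freezing the backward
  system, which is independent of the forward one, reduces these double averages to the two
  single-filter bounds.
\<close>

subsection \<open>Conditionally i.i.d. samples\<close>

text \<open>Every estimator is a ratio whose random denominator has no lower bound. The obstacle is
  avoided by comparing \<open>A / B\<close> with \<open>a / b\<close> only when
  \<open>0 \<le> A \<le> K * B\<close>: the random quotient is then at most \<open>K\<close>, and
  only the deterministic limit \<open>b\<close> must be positive. This is why test functions have
  values in \<open>[0, 1]\<close>, general bounded \<open>h\<close> being reached at the end by an
  affine change, and why the limits are kept as unnormalised finite measures whose masses are
  tracked together with the deviation bounds. In a step with proposal \<open>k\<close> (adjustment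
  multiplier included) and weight \<open>v\<close>, only the product \<open>v * k\<close> enters the
  limit. Bounded weights make it the model transition, up to the artificial densities, so the
  proposals cancel. The limits are then the filter, the backward information measure and, after the
  pair step, the smoothing measure; the division by \<open>gamma\<close> in the pair step removes
  the artificial density again. All constants are fixed before the probability space and
  \<open>N\<close>.\<close>

lemma measurable_ident_subalgebra:
  assumes "space R = space M" "sets R \<subseteq> sets M"
  shows "(\<lambda>w. w) \<in> M \<rightarrow>\<^sub>M R"
  using assms by (auto simp: measurable_def)

text \<open>Rectangles with a full product box as second factor are the events on which
  \<open>cond_iid\<close> prescribes probabilities, so uniqueness of the joint law needs a generator
  of exactly this shape. The whole product space is itself a box, which supplies the countable
  covers demanded by the pair rule.\<close>

lemma sets_pair_PiM_rectangles:
  assumes "finite I"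
  shows "sets (R \<Otimes>\<^sub>M (\<Pi>\<^sub>M i\<in>I. S i)) =
    sigma_sets (space R \<times> space (\<Pi>\<^sub>M i\<in>I. S i))
      {A \<times> Pi\<^sub>E I B | A B. A \<in> sets R \<and> B \<in> (\<Pi> i\<in>I. sets (S i))}"
proof -
  let ?Eb = "{Pi\<^sub>E I B | B. B \<in> (\<Pi> i\<in>I. sets (S i))}"
  have sp: "space (\<Pi>\<^sub>M i\<in>I. S i) \<in> ?Eb"
    unfolding space_PiM by (intro CollectI exI[of _ "\<lambda>i. space (S i)"]) simp
  have sub: "?Eb \<subseteq> Pow (space (\<Pi>\<^sub>M i\<in>I. S i))"
    using prod_algebra_sets_into_space[of I S] by (simp add: prod_algebra_eq_finite[OF assms] space_PiM)
  have "sets (R \<Otimes>\<^sub>M (\<Pi>\<^sub>M i\<in>I. S i)) =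
      sets (sigma (space R \<times> space (\<Pi>\<^sub>M i\<in>I. S i)) {a \<times> b | a b. a \<in> sets R \<and> b \<in> ?Eb})"
  proof (rule sets_pair_eq)
    show "sets R \<subseteq> Pow (space R)" by (rule sets.space_closed)
    show "sets R = sigma_sets (space R) (sets R)" by (rule sets.sigma_sets_eq[symmetric])
    show "countable {space R}" "{space R} \<subseteq> sets R" "\<Union>{space R} = space R" by auto
    show "?Eb \<subseteq> Pow (space (\<Pi>\<^sub>M i\<in>I. S i))" by (rule sub)
    show "sets (\<Pi>\<^sub>M i\<in>I. S i) = sigma_sets (space (\<Pi>\<^sub>M i\<in>I. S i)) ?Eb"
      unfolding space_PiM sets_PiM prod_algebra_eq_finite[OF assms] ..
    show "countable {space (\<Pi>\<^sub>M i\<in>I. S i)}" "{space (\<Pi>\<^sub>M i\<in>I. S i)} \<subseteq> ?Eb"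
      "\<Union>{space (\<Pi>\<^sub>M i\<in>I. S i)} = space (\<Pi>\<^sub>M i\<in>I. S i)"
      using sp by auto
  qed
  also have "{a \<times> b | a b. a \<in> sets R \<and> b \<in> ?Eb} = {A \<times> Pi\<^sub>E I B | A B. A \<in> sets R \<and> B \<in> (\<Pi> i\<in>I. sets (S i))}"
    by blast
  finally have "sets (R \<Otimes>\<^sub>M (\<Pi>\<^sub>M i\<in>I. S i)) = sets (sigma (space R \<times> space (\<Pi>\<^sub>M i\<in>I. S i))
      {A \<times> Pi\<^sub>E I B | A B. A \<in> sets R \<and> B \<in> (\<Pi> i\<in>I. sets (S i))})" .
  also have "\<dots> = sigma_sets (space R \<times> space (\<Pi>\<^sub>M i\<in>I. S i))
      {A \<times> Pi\<^sub>E I B | A B. A \<in> sets R \<and> B \<in> (\<Pi> i\<in>I. sets (S i))}"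
  proof (rule sets_measure_of, safe)
    fix A B x y assume A: "A \<in> sets R" and B: "B \<in> (\<Pi> i\<in>I. sets (S i))" and xy: "x \<in> A" "y \<in> Pi\<^sub>E I B"
    show "x \<in> space R" using A xy(1) by (rule sets.sets_into_space[THEN subsetD])
    show "y \<in> space (\<Pi>\<^sub>M i\<in>I. S i)" using sub B xy(2) by blast
  qed
  finally show ?thesis .
qed

text \<open>
  Writing the joint law as a density against a fixed product measure avoids constructing the
  kernel \<open>w \<mapsto> \<nu>\<^sub>w\<^sup>N\<close> as a measurable map into a space of measures.
\<close>

lemma cond_iid_joint_law:
  fixes S :: "'b measure" and M :: "'w measure"
  assumes M: "prob_space M"
    and R: "space R = space M" "sets R \<subseteq> sets M"
    and S: "sigma_finite_measure S"
    and f[measurable]: "(\<lambda>(w, y). f w y) \<in> borel_measurable (R \<Otimes>\<^sub>M S)"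
    and Y: "cond_iid M (sets R) N S f Y"
  shows "distr M (R \<Otimes>\<^sub>M (\<Pi>\<^sub>M l\<in>{1..N}. S)) (\<lambda>w. (w, \<lambda>l\<in>{1..N}. Y l w)) =
    density (distr M R (\<lambda>w. w) \<Otimes>\<^sub>M (\<Pi>\<^sub>M l\<in>{1..N}. S))
      (\<lambda>(w, y). \<Prod>l=1..N. f w (y l) / (\<integral>\<^sup>+z. f w z \<partial>S))"
    (is "?L = density (?P \<Otimes>\<^sub>M ?PS) ?d")
proof -
  interpret M: prob_space M by fact
  interpret S: sigma_finite_measure S by fact
  interpret PS: product_sigma_finite "\<lambda>l. S" ..
  interpret FP: finite_product_sigma_finite "\<lambda>l. S" "{1..N}" by standard simp
  have idm: "(\<lambda>w. w) \<in> M \<rightarrow>\<^sub>M R"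
    by (rule measurable_ident_subalgebra[OF R])
  have Ym[measurable]: "Y l \<in> M \<rightarrow>\<^sub>M S" if "l \<in> {1..N}" for l
    using Y that by (auto simp: cond_iid_def)
  \<comment> \<open>\<open>?P\<close> is the restriction of \<open>M\<close> to the conditioning
    sub-sigma-field \<open>R\<close>.\<close>
  interpret P: prob_space ?P by (rule M.prob_space_distr[OF idm])
  have setsP[measurable_cong]: "sets ?P = sets R" by simp
  define Z where "Z w = (\<integral>\<^sup>+z. f w z \<partial>S)" for w
  have Zm[measurable]: "Z \<in> borel_measurable R"
    unfolding Z_def by (rule S.borel_measurable_nn_integral) simp
  have fZ: "(\<lambda>(w, y). f w y / Z w) \<in> borel_measurable (R \<Otimes>\<^sub>M S)" by measurable
  have setsPP: "sets (?P \<Otimes>\<^sub>M ?PS) = sets (R \<Otimes>\<^sub>M ?PS)"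
    by (rule sets_pair_measure_cong) simp_all
  have dm[measurable]: "?d \<in> borel_measurable (?P \<Otimes>\<^sub>M ?PS)"
    unfolding Z_def[symmetric] by measurable
  have Lm: "(\<lambda>w. (w, \<lambda>l\<in>{1..N}. Y l w)) \<in> M \<rightarrow>\<^sub>M R \<Otimes>\<^sub>M ?PS"
    by (intro measurable_Pair measurable_restrict idm Ym)
  let ?E = "{A \<times> Pi\<^sub>E {1..N} B | A B. A \<in> sets R \<and> B \<in> (\<Pi> i\<in>{1..N}. sets S)}"
  have sub: "?E \<subseteq> Pow (space (R \<Otimes>\<^sub>M ?PS))"
  proof
    fix X assume "X \<in> ?E"
    then obtain A B where X: "X = A \<times> Pi\<^sub>E {1..N} B" and A: "A \<in> sets R" and B: "B \<in> (\<Pi> i\<in>{1..N}. sets S)"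
      by blast
    then have "X \<in> sets (R \<Otimes>\<^sub>M ?PS)"
      unfolding X by (intro pair_measureI A sets_PiM_I_finite) auto
    then show "X \<in> Pow (space (R \<Otimes>\<^sub>M ?PS))" using sets.sets_into_space by auto
  qed
  \<comment> \<open>On rectangles the claim is the product formula of \<open>cond_iid\<close>,
    rewritten as an iterated integral; the rest is uniqueness on an intersection-stable
    generator.\<close>
  have rect: "emeasure ?L X = emeasure (density (?P \<Otimes>\<^sub>M ?PS) ?d) X" if "X \<in> ?E" for X
  proof -
    from that obtain A B where X: "X = A \<times> Pi\<^sub>E {1..N} B" and A[measurable]: "A \<in> sets R"
      and B: "B \<in> (\<Pi> i\<in>{1..N}. sets S)" by blast
    have B'[measurable]: "B l \<in> sets S" if "l \<in> {1..N}" for l using B that by auto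
    have BP[measurable]: "Pi\<^sub>E {1..N} B \<in> sets ?PS" by (intro sets_PiM_I_finite) auto
    have X'[measurable]: "X \<in> sets (R \<Otimes>\<^sub>M ?PS)" unfolding X by simp
    let ?pr = "\<lambda>w y. \<Prod>l=1..N. f w (y l) / Z w * indicator (B l) (y l)"
    let ?ip = "\<lambda>w. \<integral>\<^sup>+y. ?pr w y \<partial>?PS" and ?i = "\<lambda>w l. \<integral>\<^sup>+y. f w y / Z w * indicator (B l) y \<partial>S"
    have "emeasure ?L X = emeasure M ((\<lambda>w. (w, \<lambda>l\<in>{1..N}. Y l w)) -` X \<inter> space M)"
      by (rule emeasure_distr[OF Lm X'])
    also have "(\<lambda>w. (w, \<lambda>l\<in>{1..N}. Y l w)) -` X \<inter> space M = {w\<in>A. \<forall>l\<in>{1..N}. Y l w \<in> B l}"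
      using sets.sets_into_space[OF A] R(1) by (auto simp: X PiE_iff)
    also have "emeasure M \<dots> = (\<integral>\<^sup>+w\<in>A. (\<Prod>l=1..N. emeasure (normalized_density S (f w)) (B l)) \<partial>M)"
      using Y A B by (simp add: cond_iid_def)
    also have "\<dots> = (\<integral>\<^sup>+w. (\<Prod>l=1..N. ?i w l) * indicator A w \<partial>M)"
    proof (intro nn_integral_cong)
      fix w assume w: "w \<in> space M"
      have fw: "(\<lambda>y. f w y / Z w) \<in> borel_measurable S"
        using measurable_Pair2[OF fZ, of w] w R by simp
      show "(\<Prod>l=1..N. emeasure (normalized_density S (f w)) (B l)) * indicator A w =
        (\<Prod>l=1..N. ?i w l) * indicator A w"
        unfolding normalized_density_def Z_def[symmetric]
        by (intro arg_cong2[where f = times] prod.cong refl emeasure_density fw B')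
    qed
    also have "\<dots> = (\<integral>\<^sup>+w. (\<Prod>l=1..N. ?i w l) * indicator A w \<partial>?P)"
      by (rule nn_integral_distr[OF idm, symmetric]) measurable
    \<comment> \<open>For fixed \<open>w\<close>, a product of \<open>N\<close> one-dimensional
      integrals is a single integral over the product measure.\<close>
    also have "\<dots> = (\<integral>\<^sup>+w. ?ip w * indicator A w \<partial>?P)"
    proof (intro nn_integral_cong arg_cong2[where f = times] refl)
      fix w assume w: "w \<in> space ?P"
      have fw: "(\<lambda>y. f w y / Z w) \<in> borel_measurable S"
        using measurable_Pair2[OF fZ, of w] w R by simp
      show "(\<Prod>l=1..N. ?i w l) =
        ?ip w"
        by (rule PS.product_nn_integral_prod[symmetric])
           (auto intro!: borel_measurable_times_ennreal fw borel_measurable_indicator)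
    qed
    also have "\<dots> = (\<integral>\<^sup>+w. (\<integral>\<^sup>+y. ?d (w, y) * indicator X (w, y) \<partial>?PS) \<partial>?P)"
    proof (intro nn_integral_cong)
      fix w assume w: "w \<in> space ?P"
      have fw: "(\<lambda>y. f w y / Z w) \<in> borel_measurable S"
        using measurable_Pair2[OF fZ, of w] w R by simp
      have pm: "(\<lambda>y. \<Prod>l=1..N. f w (y l) / Z w * indicator (B l) (y l)) \<in> borel_measurable ?PS"
      proof -
        note fw[measurable]
        show ?thesis by measurable
      qed
      have "?ip w * indicator A w
        = (\<integral>\<^sup>+y. ?pr w y * indicator A w \<partial>?PS)"
        by (rule nn_integral_multc[symmetric, OF pm])
      also have "\<dots> = (\<integral>\<^sup>+y. ?d (w, y) * indicator X (w, y) \<partial>?PS)"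
      proof (intro nn_integral_cong)
        fix y assume y: "y \<in> space ?PS"
        have "(\<Prod>l=1..N. indicator (B l) (y l)) * indicator A w = (indicator X (w, y) :: ennreal)"
        proof (cases "\<forall>l\<in>{1..N}. y l \<in> B l")
          case True
          then have "y \<in> Pi\<^sub>E {1..N} B" using y by (auto simp: space_PiM PiE_def)
          with True show ?thesis by (auto simp: X indicator_def)
        next
          case False
          then obtain l where l: "l \<in> {1..N}" "y l \<notin> B l" by auto
          then have "(\<Prod>l=1..N. indicator (B l) (y l) :: ennreal) = 0"
            by (intro prod_zero) (auto intro!: bexI[of _ l])
          moreover have "(w, y) \<notin> X" using l by (auto simp: X)
          ultimately show ?thesis by simp
        qed
        then show "?pr w y * indicator A w
          = ?d (w, y) * indicator X (w, y)"
          by (simp add: prod.distrib Z_def mult.assoc)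
      qed
      finally show "?ip w * indicator A w
        = (\<integral>\<^sup>+y. ?d (w, y) * indicator X (w, y) \<partial>?PS)" .
    qed
    also have "\<dots> = (\<integral>\<^sup>+x. ?d x * indicator X x \<partial>(?P \<Otimes>\<^sub>M ?PS))"
    proof (rule FP.nn_integral_fst)
      have "X \<in> sets (?P \<Otimes>\<^sub>M ?PS)" using X' by (simp only: setsPP)
      then show "(\<lambda>x. ?d x * indicator X x) \<in> borel_measurable (?P \<Otimes>\<^sub>M ?PS)"
        by (intro borel_measurable_times_ennreal dm borel_measurable_indicator)
    qed
    also have "\<dots> = emeasure (density (?P \<Otimes>\<^sub>M ?PS) ?d) X"
      by (rule emeasure_density[symmetric, OF dm]) (use X' in \<open>simp only: setsPP\<close>)
    finally show ?thesis .
  qed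
  show ?thesis
  proof (rule measure_eqI_generator_eq[where E = ?E and \<Omega> = "space (R \<Otimes>\<^sub>M ?PS)" and A = "\<lambda>_. space (R \<Otimes>\<^sub>M ?PS)"])
    show "Int_stable ?E"
    proof (rule Int_stableI)
      fix a b assume "a \<in> ?E" "b \<in> ?E"
      then obtain A B A' B' where *: "a = A \<times> Pi\<^sub>E {1..N} B" "b = A' \<times> Pi\<^sub>E {1..N} B'"
        "A \<in> sets R" "A' \<in> sets R" "B \<in> (\<Pi> i\<in>{1..N}. sets S)" "B' \<in> (\<Pi> i\<in>{1..N}. sets S)" by blast
      then have "a \<inter> b = (A \<inter> A') \<times> Pi\<^sub>E {1..N} (\<lambda>i. B i \<inter> B' i)"
        by (simp add: Times_Int_Times PiE_Int)
      moreover have "(\<lambda>i. B i \<inter> B' i) \<in> (\<Pi> i\<in>{1..N}. sets S)" using * by auto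
      ultimately show "a \<inter> b \<in> ?E" using * by blast
    qed
    show "?E \<subseteq> Pow (space (R \<Otimes>\<^sub>M ?PS))" by (rule sub)
    show sL: "sets ?L = sigma_sets (space (R \<Otimes>\<^sub>M ?PS)) ?E"
      unfolding sets_distr space_pair_measure by (rule sets_pair_PiM_rectangles) simp
    show "sets (density (?P \<Otimes>\<^sub>M ?PS) ?d) = sigma_sets (space (R \<Otimes>\<^sub>M ?PS)) ?E"
      unfolding sets_density setsPP sL[symmetric] by simp
    have "space (R \<Otimes>\<^sub>M ?PS) = space R \<times> Pi\<^sub>E {1..N} (\<lambda>_. space S)"
      by (simp only: space_pair_measure space_PiM)
    then have "space (R \<Otimes>\<^sub>M ?PS) \<in> ?E" by blast
    then show "range (\<lambda>_::nat. space (R \<Otimes>\<^sub>M ?PS)) \<subseteq> ?E" by blast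
    show "(\<Union>i::nat. space (R \<Otimes>\<^sub>M ?PS)) = space (R \<Otimes>\<^sub>M ?PS)" by simp
    fix i :: nat
    show "emeasure ?L (space (R \<Otimes>\<^sub>M ?PS)) \<noteq> \<infinity>"
      using emeasure_distr[OF Lm, of "space (R \<Otimes>\<^sub>M ?PS)"] M.emeasure_finite by simp
  qed (use rect in blast)
qed

text \<open>Given the past, the factors are independent with a common law, so the conditional
  expectation of their product is an \<open>N\<close>-th power. With an exponential
  \<open>\<Phi>\<close> this is the moment generating function behind the Chernoff bound.\<close>

lemma cond_iid_nn_integral_prod:
  fixes S :: "'b measure" and M :: "'w measure"
  assumes M: "prob_space M"
    and R: "space R = space M" "sets R \<subseteq> sets M"
    and S: "sigma_finite_measure S"
    and f[measurable]: "(\<lambda>(w, y). f w y) \<in> borel_measurable (R \<Otimes>\<^sub>M S)"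
    and Y: "cond_iid M (sets R) N S f Y"
    and \<Phi>[measurable]: "(\<lambda>(w, y). \<Phi> w y :: ennreal) \<in> borel_measurable (R \<Otimes>\<^sub>M S)"
  shows "(\<integral>\<^sup>+w. (\<Prod>l=1..N. \<Phi> w (Y l w)) \<partial>M) =
    (\<integral>\<^sup>+w. (\<integral>\<^sup>+y. \<Phi> w y \<partial>normalized_density S (f w)) ^ N \<partial>M)"
proof -
  interpret M: prob_space M by fact
  interpret S: sigma_finite_measure S by fact
  interpret PS: product_sigma_finite "\<lambda>l. S" ..
  interpret FP: finite_product_sigma_finite "\<lambda>l. S" "{1..N}" by standard simp
  let ?PS = "\<Pi>\<^sub>M l\<in>{1..N}. S" and ?P = "distr M R (\<lambda>w. w)"
  let ?d = "\<lambda>(w, y). \<Prod>l=1..N. f w (y l) / (\<integral>\<^sup>+z. f w z \<partial>S)"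
  have idm: "(\<lambda>w. w) \<in> M \<rightarrow>\<^sub>M R"
    by (rule measurable_ident_subalgebra[OF R])
  have Ym[measurable]: "Y l \<in> M \<rightarrow>\<^sub>M S" if "l \<in> {1..N}" for l
    using Y that by (auto simp: cond_iid_def)
  have Lm: "(\<lambda>w. (w, \<lambda>l\<in>{1..N}. Y l w)) \<in> M \<rightarrow>\<^sub>M R \<Otimes>\<^sub>M ?PS"
    by (intro measurable_Pair measurable_restrict idm Ym)
  define Z where "Z w = (\<integral>\<^sup>+z. f w z \<partial>S)" for w
  have Zm[measurable]: "Z \<in> borel_measurable R"
    unfolding Z_def by (rule S.borel_measurable_nn_integral) simp
  have fZ: "(\<lambda>(w, y). f w y / Z w) \<in> borel_measurable (R \<Otimes>\<^sub>M S)" by measurable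
  have dm[measurable]: "?d \<in> borel_measurable (?P \<Otimes>\<^sub>M ?PS)"
    unfolding Z_def[symmetric] by measurable
  have \<Psi>m[measurable]: "(\<lambda>(w, y). \<Prod>l=1..N. \<Phi> w (y l)) \<in> borel_measurable (R \<Otimes>\<^sub>M ?PS)"
    by measurable
  have "(\<integral>\<^sup>+w. (\<Prod>l=1..N. \<Phi> w (Y l w)) \<partial>M) =
    (\<integral>\<^sup>+x. (case x of (w, y) \<Rightarrow> \<Prod>l=1..N. \<Phi> w (y l)) \<partial>distr M (R \<Otimes>\<^sub>M ?PS) (\<lambda>w. (w, \<lambda>l\<in>{1..N}. Y l w)))"
    by (subst nn_integral_distr[OF Lm]) auto
  also have "\<dots> = (\<integral>\<^sup>+x. (case x of (w, y) \<Rightarrow> \<Prod>l=1..N. \<Phi> w (y l)) \<partial>density (?P \<Otimes>\<^sub>M ?PS) ?d)"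
    by (subst cond_iid_joint_law[OF M R S f Y]) simp
  also have "\<dots> = (\<integral>\<^sup>+x. ?d x * (case x of (w, y) \<Rightarrow> \<Prod>l=1..N. \<Phi> w (y l)) \<partial>(?P \<Otimes>\<^sub>M ?PS))"
    by (rule nn_integral_density) auto
  also have "\<dots> = (\<integral>\<^sup>+w. (\<integral>\<^sup>+y. (\<Prod>l=1..N. f w (y l) / Z w * \<Phi> w (y l)) \<partial>?PS) \<partial>?P)"
    by (subst FP.nn_integral_fst[symmetric]) (measurable, simp add: prod.distrib Z_def)
  also have "\<dots> = (\<integral>\<^sup>+w. (\<integral>\<^sup>+y. f w y / Z w * \<Phi> w y \<partial>S) ^ N \<partial>?P)"
  proof (intro nn_integral_cong)
    fix w assume w: "w \<in> space ?P"
    have fw: "(\<lambda>y. f w y / Z w) \<in> borel_measurable S" "\<Phi> w \<in> borel_measurable S"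
      using measurable_Pair2[OF fZ, of w] measurable_Pair2[OF \<Phi>, of w] w R by simp_all
    show "(\<integral>\<^sup>+y. (\<Prod>l=1..N. f w (y l) / Z w * \<Phi> w (y l)) \<partial>?PS) = (\<integral>\<^sup>+y. f w y / Z w * \<Phi> w y \<partial>S) ^ N"
      by (subst PS.product_nn_integral_prod) (auto intro!: borel_measurable_times_ennreal fw)
  qed
  also have "\<dots> = (\<integral>\<^sup>+w. (\<integral>\<^sup>+y. f w y / Z w * \<Phi> w y \<partial>S) ^ N \<partial>M)"
    by (rule nn_integral_distr[OF idm]) measurable
  also have "\<dots> = (\<integral>\<^sup>+w. (\<integral>\<^sup>+y. \<Phi> w y \<partial>normalized_density S (f w)) ^ N \<partial>M)"
  proof (intro nn_integral_cong arg_cong[where f="\<lambda>x. x ^ N"])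
    fix w assume w: "w \<in> space M"
    have fw: "(\<lambda>y. f w y / Z w) \<in> borel_measurable S" "\<Phi> w \<in> borel_measurable S"
      using measurable_Pair2[OF fZ, of w] measurable_Pair2[OF \<Phi>, of w] w R by simp_all
    show "(\<integral>\<^sup>+y. f w y / Z w * \<Phi> w y \<partial>S) = (\<integral>\<^sup>+y. \<Phi> w y \<partial>normalized_density S (f w))"
      unfolding normalized_density_def Z_def[symmetric] by (rule nn_integral_density[symmetric, OF fw])
  qed
  finally show ?thesis .
qed

lemma prob_space_normalized_density:
  assumes f: "f \<in> borel_measurable S" and Z: "0 < (\<integral>\<^sup>+y. f y \<partial>S)" "(\<integral>\<^sup>+y. f y \<partial>S) < \<infinity>"
  shows "prob_space (normalized_density S f)"
proof (rule prob_spaceI)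
  have "emeasure (normalized_density S f) (space (normalized_density S f)) = (\<integral>\<^sup>+y. f y / (\<integral>\<^sup>+z. f z \<partial>S) \<partial>S)"
    unfolding normalized_density_def using f by (simp add: emeasure_density cong: nn_integral_cong)
  also have "\<dots> = (\<integral>\<^sup>+y. f y \<partial>S) / (\<integral>\<^sup>+z. f z \<partial>S)"
    by (rule nn_integral_divide[OF f])
  also have "\<dots> = 1"
    using Z by (intro ennreal_divide_self) auto
  finally show "emeasure (normalized_density S f) (space (normalized_density S f)) = 1" .
qed

lemma cond_iid_Chernoff:
  fixes S :: "'b measure" and M :: "'w measure" and \<phi> :: "'w \<Rightarrow> 'b \<Rightarrow> real"
  assumes M: "prob_space M"
    and R: "space R = space M" "sets R \<subseteq> sets M"
    and S: "sigma_finite_measure S"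
    and f[measurable]: "(\<lambda>(w, y). f w y) \<in> borel_measurable (R \<Otimes>\<^sub>M S)"
    and Y: "cond_iid M (sets R) N S f Y"
    and \<phi>[measurable]: "(\<lambda>(w, y). \<phi> w y) \<in> borel_measurable (R \<Otimes>\<^sub>M S)"
    and m[measurable]: "m \<in> borel_measurable R"
    and \<phi>_range: "\<And>w y. w \<in> space M \<Longrightarrow> y \<in> space S \<Longrightarrow> \<phi> w y \<in> {a..b}"
    and mean: "AE w in M. m w = (\<integral>y. \<phi> w y \<partial>normalized_density S (f w))"
    and e: "e > 0" and ab: "a < b"
  shows "measure M {w\<in>space M. (\<Sum>l=1..N. \<phi> w (Y l w) - m w) \<ge> real N * e} \<le> exp (- (2 * real N * e\<^sup>2 / (b - a)\<^sup>2))"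
proof -
  interpret M: prob_space M by fact
  have idm: "(\<lambda>w. w) \<in> M \<rightarrow>\<^sub>M R"
    by (rule measurable_ident_subalgebra[OF R])
  have Ym[measurable]: "Y l \<in> M \<rightarrow>\<^sub>M S" if "l \<in> {1..N}" for l
    using Y that by (auto simp: cond_iid_def)
  have mM[measurable]: "m \<in> borel_measurable M"
    using measurable_compose[OF idm m] by simp
  have \<phi>Y[measurable]: "(\<lambda>w. \<phi> w (Y l w)) \<in> borel_measurable M" if "l \<in> {1..N}" for l
    using measurable_compose[OF measurable_Pair[OF idm Ym[OF that]] \<phi>] by simp
  \<comment> \<open>This \<open>t\<close> minimises \<open>- t * e + t^2 * (b - a)^2 / 8\<close>;
    the minimum is \<open>- 2 * e^2 / (b - a)^2\<close>.\<close>
  define t where "t = 4 * e / (b - a)\<^sup>2"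
  have t: "t > 0" using e ab by (simp add: t_def)
  define \<Phi> where "\<Phi> w y = ennreal (exp (t * (\<phi> w y - m w)))" for w y
  have \<Phi>m: "(\<lambda>(w, y). \<Phi> w y) \<in> borel_measurable (R \<Otimes>\<^sub>M S)"
    unfolding \<Phi>_def by measurable
  have Xm: "(\<lambda>w. \<Sum>l=1..N. \<phi> w (Y l w) - m w) \<in> borel_measurable M"
    by (intro borel_measurable_sum borel_measurable_diff \<phi>Y mM)
  have bound: "AE w in M. (\<integral>\<^sup>+y. \<Phi> w y \<partial>normalized_density S (f w)) \<le> ennreal (exp (t\<^sup>2 * (b - a)\<^sup>2 / 8))"
  proof -
    have "AE w in M. 0 < (\<integral>\<^sup>+y. f w y \<partial>S) \<and> (\<integral>\<^sup>+y. f w y \<partial>S) < \<infinity>"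
      using Y by (simp add: cond_iid_def)
    then show ?thesis using mean AE_space
    proof eventually_elim
      case (elim w)
      have fw: "f w \<in> borel_measurable S" "\<phi> w \<in> borel_measurable S"
        using measurable_Pair2[OF f, of w] measurable_Pair2[OF \<phi>, of w] elim R by simp_all
      interpret nu: prob_space "normalized_density S (f w)"
        using elim by (intro prob_space_normalized_density fw) auto
      interpret nu: interval_bounded_random_variable "normalized_density S (f w)" "\<phi> w" a b
      proof
        show "\<phi> w \<in> borel_measurable (normalized_density S (f w))"
          using fw by (simp add: normalized_density_def)
        show "AE x in normalized_density S (f w). \<phi> w x \<in> {a..b}"
          using \<phi>_range elim by (intro AE_I2) (auto simp: normalized_density_def)
      qed
      show ?case
        using nu.Hoeffdings_lemma_nn_integral[OF t] elim by (simp add: \<Phi>_def)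
    qed
  qed
  have "emeasure M {w\<in>space M. (\<Sum>l=1..N. \<phi> w (Y l w) - m w) \<ge> real N * e}
      \<le> ennreal (exp (- t * (real N * e))) * (\<integral>\<^sup>+w\<in>space M. ennreal (exp (t * (\<Sum>l=1..N. \<phi> w (Y l w) - m w))) \<partial>M)"
    by (rule Chernoff_ineq_nn_integral_ge[OF t]) (auto intro!: borel_measurable_times Xm)
  also have "(\<integral>\<^sup>+w\<in>space M. ennreal (exp (t * (\<Sum>l=1..N. \<phi> w (Y l w) - m w))) \<partial>M) = (\<integral>\<^sup>+w. (\<Prod>l=1..N. \<Phi> w (Y l w)) \<partial>M)"
    by (intro nn_integral_cong) (simp add: \<Phi>_def prod_ennreal exp_sum sum_distrib_left)
  also have "\<dots> = (\<integral>\<^sup>+w. (\<integral>\<^sup>+y. \<Phi> w y \<partial>normalized_density S (f w)) ^ N \<partial>M)"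
    by (rule cond_iid_nn_integral_prod[OF M R S f Y \<Phi>m])
  also have "\<dots> \<le> (\<integral>\<^sup>+w. ennreal (exp (t\<^sup>2 * (b - a)\<^sup>2 / 8)) ^ N \<partial>M)"
    using bound by (intro nn_integral_mono_AE) (auto elim!: eventually_mono intro: power_mono)
  also have "\<dots> = ennreal (exp (real N * (t\<^sup>2 * (b - a)\<^sup>2 / 8)))"
    by (simp only: nn_integral_const M.emeasure_space_1 ennreal_power exp_ge_zero exp_of_nat_mult mult_1_right)
  also have "ennreal (exp (- t * (real N * e))) * \<dots> = ennreal (exp (- t * (real N * e) + real N * (t\<^sup>2 * (b - a)\<^sup>2 / 8)))"
    by (simp only: ennreal_mult[symmetric] exp_add exp_ge_zero)
  also have "- t * (real N * e) + real N * (t\<^sup>2 * (b - a)\<^sup>2 / 8) = - (2 * real N * e\<^sup>2 / (b - a)\<^sup>2)"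
  proof -
    define d where "d = (b - a)\<^sup>2"
    have "d > 0" using ab by (simp add: d_def)
    then show ?thesis unfolding t_def d_def[symmetric] by (simp add: field_simps power2_eq_square)
  qed
  finally show ?thesis
    by (simp add: M.emeasure_eq_measure mult_left_mono)
qed

text \<open>The sample size \<open>n\<close> is kept apart from \<open>B\<close> and
  \<open>C\<close> so that the constants can be chosen independently of it. Measurability is
  included because \<open>measure\<close> is 0 on nonmeasurable sets, which would make the estimate
  empty.\<close>

definition tail_bound :: "'w measure \<Rightarrow> real \<Rightarrow> real \<Rightarrow> real \<Rightarrow> ('w \<Rightarrow> real) \<Rightarrow> bool" where
  "tail_bound M n B C Z \<longleftrightarrow>
     Z \<in> borel_measurable M \<and> (\<forall>e>0. measure M {w\<in>space M. \<bar>Z w\<bar> > e} \<le> B * exp (- (C * n * e\<^sup>2)))"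

lemma tail_boundD:
  "tail_bound M n B C Z \<Longrightarrow> e > 0 \<Longrightarrow> measure M {w\<in>space M. \<bar>Z w\<bar> > e} \<le> B * exp (- (C * n * e\<^sup>2))"
  by (simp add: tail_bound_def)

lemma tail_bound_mono:
  assumes "finite_measure M" "tail_bound M n B C Z" "X \<in> borel_measurable M"
    and le: "\<And>w. w \<in> space M \<Longrightarrow> \<bar>X w\<bar> \<le> \<bar>Z w\<bar>"
  shows "tail_bound M n B C X"
proof -
  interpret finite_measure M by fact
  note [measurable] = assms(3)
  have [measurable]: "Z \<in> borel_measurable M" using assms(2) by (simp add: tail_bound_def)
  have "measure M {w\<in>space M. \<bar>X w\<bar> > e} \<le> B * exp (- (C * n * e\<^sup>2))" if "e > 0" for e
  proof -
    have "measure M {w\<in>space M. \<bar>X w\<bar> > e} \<le> measure M {w\<in>space M. \<bar>Z w\<bar> > e}"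
      using le by (intro finite_measure_mono) (auto intro: less_le_trans)
    also have "\<dots> \<le> B * exp (- (C * n * e\<^sup>2))" using assms(2) that by (rule tail_boundD)
    finally show ?thesis .
  qed
  then show ?thesis using assms(3) by (simp add: tail_bound_def)
qed

lemma tail_bound_weaken:
  assumes "tail_bound M n B C Z" "B \<le> B'" "C' \<le> C" "0 \<le> B" "0 \<le> n"
  shows "tail_bound M n B' C' Z"
  unfolding tail_bound_def
proof (intro conjI allI impI)
  show "Z \<in> borel_measurable M" using assms(1) by (simp add: tail_bound_def)
  fix e :: real assume "e > 0"
  have "measure M {w\<in>space M. \<bar>Z w\<bar> > e} \<le> B * exp (- (C * n * e\<^sup>2))"
    using assms(1) \<open>e > 0\<close> by (rule tail_boundD)
  also have "\<dots> \<le> B' * exp (- (C' * n * e\<^sup>2))"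
    using assms by (intro mult_mono) (auto intro!: mult_right_mono)
  finally show "measure M {w\<in>space M. \<bar>Z w\<bar> > e} \<le> B' * exp (- (C' * n * e\<^sup>2))" .
qed

lemma tail_bound_cmult:
  assumes "tail_bound M n B C Z" "c > 0"
  shows "tail_bound M n B (C / c\<^sup>2) (\<lambda>w. c * Z w)"
  unfolding tail_bound_def
proof (intro conjI allI impI)
  have [measurable]: "Z \<in> borel_measurable M" using assms(1) by (simp add: tail_bound_def)
  show "(\<lambda>w. c * Z w) \<in> borel_measurable M" by measurable
  fix e :: real assume e: "e > 0"
  have "{w\<in>space M. \<bar>c * Z w\<bar> > e} = {w\<in>space M. \<bar>Z w\<bar> > e / c}"
    using assms(2) by (auto simp: abs_mult field_simps)
  also have "measure M \<dots> \<le> B * exp (- (C * n * (e / c)\<^sup>2))"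
    using e assms(2) by (intro tail_boundD[OF assms(1)]) simp
  finally show "measure M {w\<in>space M. \<bar>c * Z w\<bar> > e} \<le> B * exp (- (C / c\<^sup>2 * n * e\<^sup>2))"
    by (simp add: power_divide field_simps)
qed

text \<open>Union bound with \<open>e / 2\<close> allotted to each summand; squaring this half is
  the source of the factors \<open>4\<close> in all later rates. The absolute values stay in the sum
  so that anything dominated by it inherits the tail through \<open>tail_bound_mono\<close>.\<close>

lemma tail_bound_add:
  assumes "finite_measure M" "tail_bound M n B1 C Z1" "tail_bound M n B2 C Z2"
  shows "tail_bound M n (B1 + B2) (C / 4) (\<lambda>w. \<bar>Z1 w\<bar> + \<bar>Z2 w\<bar>)"
  unfolding tail_bound_def
proof (intro conjI allI impI)
  interpret finite_measure M by fact
  have [measurable]: "Z1 \<in> borel_measurable M" "Z2 \<in> borel_measurable M"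
    using assms by (auto simp: tail_bound_def)
  show "(\<lambda>w. \<bar>Z1 w\<bar> + \<bar>Z2 w\<bar>) \<in> borel_measurable M" by measurable
  fix e :: real assume e: "e > 0"
  have "measure M {w\<in>space M. \<bar>\<bar>Z1 w\<bar> + \<bar>Z2 w\<bar>\<bar> > e}
      \<le> measure M ({w\<in>space M. \<bar>Z1 w\<bar> > e / 2} \<union> {w\<in>space M. \<bar>Z2 w\<bar> > e / 2})"
    by (intro finite_measure_mono) auto
  also have "\<dots> \<le> measure M {w\<in>space M. \<bar>Z1 w\<bar> > e / 2} + measure M {w\<in>space M. \<bar>Z2 w\<bar> > e / 2}"
    by (intro measure_Un_le) auto
  also have "\<dots> \<le> B1 * exp (- (C * n * (e / 2)\<^sup>2)) + B2 * exp (- (C * n * (e / 2)\<^sup>2))"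
    using e by (intro add_mono tail_boundD[OF assms(2)] tail_boundD[OF assms(3)]) auto
  finally show "measure M {w\<in>space M. \<bar>\<bar>Z1 w\<bar> + \<bar>Z2 w\<bar>\<bar> > e} \<le> (B1 + B2) * exp (- (C / 4 * n * e\<^sup>2))"
    by (simp add: power_divide field_simps)
qed

text \<open>One Chernoff bound for \<open>\<phi>\<close> and one for \<open>- \<phi>\<close>, both
  on an interval of length \<open>K\<close>, produce the prefactor \<open>2\<close>.\<close>

lemma cond_iid_Hoeffding:
  fixes S :: "'b measure" and M :: "'w measure" and \<phi> :: "'w \<Rightarrow> 'b \<Rightarrow> real"
  assumes M: "prob_space M"
    and R: "space R = space M" "sets R \<subseteq> sets M"
    and S: "sigma_finite_measure S"
    and f: "(\<lambda>(w, y). f w y) \<in> borel_measurable (R \<Otimes>\<^sub>M S)"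
    and Y: "cond_iid M (sets R) N S f Y"
    and \<phi>: "(\<lambda>(w, y). \<phi> w y) \<in> borel_measurable (R \<Otimes>\<^sub>M S)"
    and m: "m \<in> borel_measurable R"
    and \<phi>_range: "\<And>w y. w \<in> space M \<Longrightarrow> y \<in> space S \<Longrightarrow> \<phi> w y \<in> {0..K}"
    and mean: "AE w in M. m w = (\<integral>y. \<phi> w y \<partial>normalized_density S (f w))"
    and N: "N \<ge> 1" and K: "K > 0"
  shows "tail_bound M (real N) 2 (2 / K\<^sup>2) (\<lambda>w. (\<Sum>l=1..N. \<phi> w (Y l w)) / real N - m w)"
  unfolding tail_bound_def
proof (intro conjI allI impI)
  interpret M: prob_space M by fact
  have idm: "(\<lambda>w. w) \<in> M \<rightarrow>\<^sub>M R"
    by (rule measurable_ident_subalgebra[OF R])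
  have Ym: "Y l \<in> M \<rightarrow>\<^sub>M S" if "l \<in> {1..N}" for l
    using Y that by (auto simp: cond_iid_def)
  have mM[measurable]: "m \<in> borel_measurable M"
    using measurable_compose[OF idm m] by simp
  have \<phi>Y[measurable]: "(\<lambda>w. \<phi> w (Y l w)) \<in> borel_measurable M" if "l \<in> {1..N}" for l
    using measurable_compose[OF measurable_Pair[OF idm Ym[OF that]] \<phi>] by simp
  show meas: "(\<lambda>w. (\<Sum>l=1..N. \<phi> w (Y l w)) / real N - m w) \<in> borel_measurable M"
    by (intro borel_measurable_diff borel_measurable_divide borel_measurable_sum \<phi>Y mM borel_measurable_const)
  fix e :: real assume e: "e > 0"
  let ?U = "{w\<in>space M. (\<Sum>l=1..N. \<phi> w (Y l w) - m w) \<ge> real N * e}"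
  let ?L = "{w\<in>space M. (\<Sum>l=1..N. - \<phi> w (Y l w) - - m w) \<ge> real N * e}"
  have Um: "?U \<in> sets M" "?L \<in> sets M"
    by (auto intro!: borel_measurable_le borel_measurable_sum borel_measurable_diff borel_measurable_uminus \<phi>Y mM)
  have "measure M {w\<in>space M. \<bar>(\<Sum>l=1..N. \<phi> w (Y l w)) / real N - m w\<bar> > e} \<le> measure M (?U \<union> ?L)"
  proof (rule M.finite_measure_mono)
    show "{w\<in>space M. \<bar>(\<Sum>l=1..N. \<phi> w (Y l w)) / real N - m w\<bar> > e} \<subseteq> ?U \<union> ?L"
    proof
      fix w assume w: "w \<in> {w\<in>space M. \<bar>(\<Sum>l=1..N. \<phi> w (Y l w)) / real N - m w\<bar> > e}"
      have "(\<Sum>l=1..N. \<phi> w (Y l w) - m w) = real N * ((\<Sum>l=1..N. \<phi> w (Y l w)) / real N - m w)"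
        "(\<Sum>l=1..N. - \<phi> w (Y l w) - - m w) = real N * - ((\<Sum>l=1..N. \<phi> w (Y l w)) / real N - m w)"
        using N by (simp_all add: sum_subtractf sum.distrib sum_negf field_simps)
      moreover have "e \<le> (\<Sum>l=1..N. \<phi> w (Y l w)) / real N - m w \<or> e \<le> - ((\<Sum>l=1..N. \<phi> w (Y l w)) / real N - m w)"
        using w by auto
      ultimately show "w \<in> ?U \<union> ?L" using w N by (auto intro!: mult_left_mono)
    qed
    show "?U \<union> ?L \<in> M.events" using Um by auto
  qed
  also have "\<dots> \<le> measure M ?U + measure M ?L"
    using Um by (rule measure_Un_le)
  also have "measure M ?U \<le> exp (- (2 * real N * e\<^sup>2 / (K - 0)\<^sup>2))"
    by (rule cond_iid_Chernoff[OF M R S f Y \<phi> m \<phi>_range mean e K]) auto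
  also have "measure M ?L \<le> exp (- (2 * real N * e\<^sup>2 / (0 - - K)\<^sup>2))"
  proof (rule cond_iid_Chernoff[OF M R S f Y _ _ _ _ e])
    show "(\<lambda>(w, y). - \<phi> w y) \<in> borel_measurable (R \<Otimes>\<^sub>M S)"
      using borel_measurable_uminus[OF \<phi>] by (simp add: case_prod_beta')
    show "(\<lambda>w. - m w) \<in> borel_measurable R" using m by simp
    show "- \<phi> w y \<in> {- K..0}" if "w \<in> space M" "y \<in> space S" for w y
      using \<phi>_range[OF that] by auto
    show "AE w in M. - m w = (\<integral>y. - \<phi> w y \<partial>normalized_density S (f w))"
      using mean by simp
  qed (use K in simp)
  finally show "measure M {w\<in>space M. \<bar>(\<Sum>l=1..N. \<phi> w (Y l w)) / real N - m w\<bar> > e} \<le> 2 * exp (- (2 / K\<^sup>2 * real N * e\<^sup>2))"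
    by simp
qed

text \<open>
  The case \<open>B = 0\<close>, where \<open>A / B = 0\<close>, occurs when all weights vanish.
\<close>

lemma abs_ratio_diff_le:
  fixes A B a b K :: real
  assumes "0 \<le> A" "A \<le> K * B" "0 \<le> B" "0 < b" "0 \<le> K"
  shows "\<bar>A / B - a / b\<bar> \<le> (\<bar>A - a\<bar> + K * \<bar>B - b\<bar>) / b"
proof (cases "B = 0")
  case True
  then have "A = 0" using assms by simp
  with True assms show ?thesis by (simp add: field_simps)
next
  case False
  then have B: "B > 0" using assms by simp
  \<comment> \<open>The factor multiplying \<open>b - B\<close> is \<open>A / B\<close>, which lies
    in \<open>[0, K]\<close>; hence no lower bound on the random \<open>B\<close> enters.\<close>
  have "A / B - a / b = ((A - a) + A / B * (b - B)) / b"
    using B assms by (simp add: field_simps)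
  then have "\<bar>A / B - a / b\<bar> = \<bar>(A - a) + A / B * (b - B)\<bar> / b"
    using assms by (simp add: abs_divide)
  also have "\<dots> \<le> (\<bar>A - a\<bar> + K * \<bar>B - b\<bar>) / b"
  proof (rule divide_right_mono)
    have "\<bar>A / B * (b - B)\<bar> \<le> K * \<bar>B - b\<bar>"
      unfolding abs_mult abs_minus_commute[of b B]
      using B assms by (intro mult_right_mono) (simp_all add: field_simps)
    then show "\<bar>(A - a) + A / B * (b - B)\<bar> \<le> \<bar>A - a\<bar> + K * \<bar>B - b\<bar>"
      by linarith
  qed (use assms in simp)
  finally show ?thesis .
qed

subsection \<open>Propagation of deviation bounds through importance sampling\<close>

text \<open>With vanishing total weight the value is 0 by real division; the ratio and product
  identities for averages rely on this.\<close>

definition weighted_average :: "'i set \<Rightarrow> ('i \<Rightarrow> real) \<Rightarrow> ('i \<Rightarrow> real) \<Rightarrow> real" where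
  "weighted_average J W X = (\<Sum>i\<in>J. W i * X i) / (\<Sum>i\<in>J. W i)"

text \<open>\<open>mu\<close> is left unnormalised; dividing by its mass absorbs the normalising
  constants of filters and smoothers.\<close>

definition target :: "'e measure \<Rightarrow> ('e \<Rightarrow> real) \<Rightarrow> real" where
  "target mu f = (\<integral>x. f x \<partial>mu) / measure mu (space mu)"

definition unit_function :: "'e measure \<Rightarrow> ('e \<Rightarrow> real) \<Rightarrow> bool" where
  "unit_function mu f \<longleftrightarrow> f \<in> borel_measurable mu \<and> (\<forall>x\<in>space mu. 0 \<le> f x \<and> f x \<le> 1)"

text \<open>The bound is for each \<open>f\<close> separately, with common \<open>B\<close> and
  \<open>C\<close>; no supremum over \<open>f\<close> stands inside the probability. Functions with
  values in \<open>[0, c]\<close> are covered by rescaling, as in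
  \<open>concentrates_scaled\<close>.\<close>

definition concentrates ::
  "'w measure \<Rightarrow> real \<Rightarrow> 'i set \<Rightarrow> ('i \<Rightarrow> 'w \<Rightarrow> real) \<Rightarrow> ('i \<Rightarrow> 'w \<Rightarrow> 'e) \<Rightarrow> 'e measure \<Rightarrow> real \<Rightarrow> real \<Rightarrow> bool" where
  "concentrates M n J W X mu B C \<longleftrightarrow>
     (\<forall>f. unit_function mu f \<longrightarrow>
        tail_bound M n B C (\<lambda>w. weighted_average J (\<lambda>i. W i w) (\<lambda>i. f (X i w)) - target mu f))"

lemma weighted_average_cmult: "weighted_average J W (\<lambda>i. c * X i) = c * weighted_average J W X"
  by (simp add: weighted_average_def sum_distrib_left mult.left_commute)

lemma target_cmult: "target mu (\<lambda>x. c * f x) = c * target mu f"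
  by (simp add: target_def)

lemma concentrates_scaled:
  assumes "concentrates M n J W X mu B C" "f \<in> borel_measurable mu"
    and "\<And>x. x \<in> space mu \<Longrightarrow> 0 \<le> f x \<and> f x \<le> c" and c: "c > 0"
  shows "tail_bound M n B (C / c\<^sup>2) (\<lambda>w. weighted_average J (\<lambda>i. W i w) (\<lambda>i. f (X i w)) - target mu f)"
proof -
  have "unit_function mu (\<lambda>x. 1 / c * f x)"
    using assms by (auto simp: unit_function_def)
  then have "tail_bound M n B C (\<lambda>w. 1 / c * (weighted_average J (\<lambda>i. W i w) (\<lambda>i. f (X i w)) - target mu f))"
    unfolding right_diff_distrib weighted_average_cmult[symmetric] target_cmult[symmetric]
    using assms(1) unfolding concentrates_def by blast
  from tail_bound_cmult[OF this c] show ?thesis using c by simp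
qed

lemma weighted_average_nonneg:
  "(\<And>i. i \<in> J \<Longrightarrow> 0 \<le> W i) \<Longrightarrow> (\<And>i. i \<in> J \<Longrightarrow> 0 \<le> X i) \<Longrightarrow> 0 \<le> weighted_average J W X"
  unfolding weighted_average_def by (intro divide_nonneg_nonneg sum_nonneg) auto

lemma weighted_average_mono:
  "(\<And>i. i \<in> J \<Longrightarrow> 0 \<le> W i) \<Longrightarrow> (\<And>i. i \<in> J \<Longrightarrow> X i \<le> Y i) \<Longrightarrow> weighted_average J W X \<le> weighted_average J W Y"
  unfolding weighted_average_def by (intro divide_right_mono sum_mono sum_nonneg mult_left_mono) auto

text \<open>The common normalisation cancels; if it is 0, the nonnegative weights all vanish and
  both sides are 0.\<close>

lemma weighted_average_ratio:
  assumes "finite J" "\<And>i. i \<in> J \<Longrightarrow> 0 \<le> W i"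
  shows "weighted_average J W X / weighted_average J W Y = (\<Sum>i\<in>J. W i * X i) / (\<Sum>i\<in>J. W i * Y i)"
proof (cases "(\<Sum>i\<in>J. W i) = 0")
  case True
  then have "\<And>i. i \<in> J \<Longrightarrow> W i = 0" using assms by (simp add: sum_nonneg_eq_0_iff)
  then show ?thesis by (simp add: weighted_average_def)
qed (simp add: weighted_average_def)

text \<open>One importance sampling step: \<open>e\<close> is a parent, \<open>x\<close> a child,
  \<open>mu\<close> the limit of the parents. \<open>k e\<close> is the proposal density times the
  adjustment multiplier, hence of mass at most \<open>Kt\<close> instead of 1, and \<open>v\<close>
  is the importance weight. Parents and children may live on different spaces, as happens when the
  parents are pairs of particles or one dummy point.\<close>

locale importance_kernel = L: sigma_finite_measure L + mu: finite_measure mu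
  for L :: "'x measure" and mu :: "'e measure" +
  fixes k v :: "'e \<Rightarrow> 'x \<Rightarrow> real" and Kv Kt :: real
  assumes k_measurable[measurable]: "(\<lambda>(e, x). k e x) \<in> borel_measurable (mu \<Otimes>\<^sub>M L)"
    and v_measurable[measurable]: "(\<lambda>(e, x). v e x) \<in> borel_measurable (mu \<Otimes>\<^sub>M L)"
    and k_nonneg: "\<And>e x. e \<in> space mu \<Longrightarrow> x \<in> space L \<Longrightarrow> 0 \<le> k e x"
    and v_range: "\<And>e x. e \<in> space mu \<Longrightarrow> x \<in> space L \<Longrightarrow> 0 \<le> v e x \<and> v e x \<le> Kv"
    and k_mass: "\<And>e. e \<in> space mu \<Longrightarrow> (\<integral>\<^sup>+x. ennreal (k e x) \<partial>L) \<le> ennreal Kt"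
    and Kv: "0 < Kv" and Kt: "0 < Kt"
    and mass_pos: "0 < (\<integral>\<^sup>+e. \<integral>\<^sup>+x. ennreal (v e x * k e x) \<partial>L \<partial>mu)"
begin

definition propagated :: "'x measure" where
  "propagated = density L (\<lambda>x. \<integral>\<^sup>+e. ennreal (v e x * k e x) \<partial>mu)"

text \<open>This recovers the adjustment multiplier, which governs the choice of the parent.\<close>

definition mass :: "'e \<Rightarrow> real" where
  "mass e = enn2real (\<integral>\<^sup>+x. ennreal (k e x) \<partial>L)"

text \<open>Adjoint of the step: the weighted expectation of \<open>f\<close> at the child of
  \<open>e\<close>. It turns integrals against \<open>propagated\<close> into integrals against
  \<open>mu\<close>, see \<open>integral_propagated\<close>.\<close>

definition lift :: "('x \<Rightarrow> real) \<Rightarrow> 'e \<Rightarrow> real" where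
  "lift f e = enn2real (\<integral>\<^sup>+x. ennreal (v e x * k e x * f x) \<partial>L)"

sublocale pair': pair_sigma_finite mu L ..

lemma sets_propagated[simp, measurable_cong]: "sets propagated = sets L"
  by (simp add: propagated_def)

lemma space_propagated[simp]: "space propagated = space L"
  by (simp add: propagated_def)

lemma mass_ennreal: "e \<in> space mu \<Longrightarrow> ennreal (mass e) = (\<integral>\<^sup>+x. ennreal (k e x) \<partial>L)"
  unfolding mass_def using k_mass[of e] by (intro ennreal_enn2real) (auto simp: le_less_trans)

lemma mass_range: "e \<in> space mu \<Longrightarrow> 0 \<le> mass e \<and> mass e \<le> Kt"
  using k_mass[of e] Kt by (auto simp: mass_def intro: enn2real_leI)

lemma mass_measurable[measurable]: "mass \<in> borel_measurable mu"
  unfolding mass_def by measurable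

lemma lift_measurable[measurable]:
  assumes [measurable]: "f \<in> borel_measurable L"
  shows "lift f \<in> borel_measurable mu"
  unfolding lift_def by measurable

lemma lift_le:
  assumes f: "unit_function L f" and e: "e \<in> space mu"
  shows "(\<integral>\<^sup>+x. ennreal (v e x * k e x * f x) \<partial>L) \<le> ennreal (Kv * mass e)"
proof -
  have [measurable]: "(\<lambda>x. ennreal (k e x)) \<in> borel_measurable L"
    using measurable_Pair2[OF k_measurable e] by simp
  have "(\<integral>\<^sup>+x. ennreal (v e x * k e x * f x) \<partial>L) \<le> (\<integral>\<^sup>+x. ennreal Kv * ennreal (k e x) \<partial>L)"
  proof (intro nn_integral_mono)
    fix x assume x: "x \<in> space L"
    have "v e x * k e x * f x \<le> Kv * k e x * 1"
      using f v_range[OF e x] k_nonneg[OF e x] Kv x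
      by (intro mult_mono mult_right_mono) (auto simp: unit_function_def)
    then show "ennreal (v e x * k e x * f x) \<le> ennreal Kv * ennreal (k e x)"
      using k_nonneg[OF e x] Kv by (simp add: ennreal_mult[symmetric] ennreal_leI)
  qed
  also have "\<dots> = ennreal (Kv * mass e)"
    using mass_range[OF e] Kv by (simp add: nn_integral_cmult mass_ennreal[OF e, symmetric] ennreal_mult)
  finally show ?thesis .
qed

lemma lift_ennreal:
  assumes f: "unit_function L f" and e: "e \<in> space mu"
  shows "ennreal (lift f e) = (\<integral>\<^sup>+x. ennreal (v e x * k e x * f x) \<partial>L)"
  unfolding lift_def using lift_le[OF assms] by (intro ennreal_enn2real) (auto simp: le_less_trans)

lemma lift_range:
  assumes f: "unit_function L f" and e: "e \<in> space mu"
  shows "0 \<le> lift f e" "lift f e \<le> Kv * mass e" "lift f e \<le> Kv * Kt"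
proof -
  show "0 \<le> lift f e" by (simp add: lift_def)
  show "lift f e \<le> Kv * mass e"
    unfolding lift_def using lift_le[OF assms] mass_range[OF e] Kv by (intro enn2real_leI) auto
  also have "\<dots> \<le> Kv * Kt" using mass_range[OF e] Kv by simp
  finally show "lift f e \<le> Kv * Kt" .
qed

lemma unit_function_const: "unit_function L (\<lambda>_. 1)"
  by (simp add: unit_function_def)

text \<open>Tonelli: children and parents may be integrated in either order.\<close>

lemma nn_integral_propagated:
  assumes f: "unit_function L f"
  shows "(\<integral>\<^sup>+x. ennreal (f x) \<partial>propagated) = (\<integral>\<^sup>+e. ennreal (lift f e) \<partial>mu)"
proof -
  have [measurable]: "f \<in> borel_measurable L" using f by (simp add: unit_function_def)
  have "(\<integral>\<^sup>+x. ennreal (f x) \<partial>propagated) = (\<integral>\<^sup>+x. (\<integral>\<^sup>+e. ennreal (v e x * k e x) \<partial>mu) * ennreal (f x) \<partial>L)"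
    unfolding propagated_def by (rule nn_integral_density) measurable
  also have "\<dots> = (\<integral>\<^sup>+x. (\<integral>\<^sup>+e. ennreal (v e x * k e x * f x) \<partial>mu) \<partial>L)"
  proof (intro nn_integral_cong)
    fix x assume x: "x \<in> space L"
    have "(\<lambda>e. ennreal (v e x * k e x)) \<in> borel_measurable mu"
      using measurable_Pair1[OF k_measurable x] measurable_Pair1[OF v_measurable x] by simp
    then have "(\<integral>\<^sup>+e. ennreal (v e x * k e x) \<partial>mu) * ennreal (f x) = (\<integral>\<^sup>+e. ennreal (v e x * k e x) * ennreal (f x) \<partial>mu)"
      by (rule nn_integral_multc[symmetric])
    also have "\<dots> = (\<integral>\<^sup>+e. ennreal (v e x * k e x * f x) \<partial>mu)"
      using x f v_range k_nonneg by (intro nn_integral_cong) (auto simp: ennreal_mult unit_function_def)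
    finally show "(\<integral>\<^sup>+e. ennreal (v e x * k e x) \<partial>mu) * ennreal (f x) = (\<integral>\<^sup>+e. ennreal (v e x * k e x * f x) \<partial>mu)" .
  qed
  also have "\<dots> = (\<integral>\<^sup>+e. (\<integral>\<^sup>+x. ennreal (v e x * k e x * f x) \<partial>L) \<partial>mu)"
    by (rule pair'.Fubini') measurable
  also have "\<dots> = (\<integral>\<^sup>+e. ennreal (lift f e) \<partial>mu)"
    using f by (intro nn_integral_cong) (simp add: lift_ennreal)
  finally show ?thesis .
qed

lemma integrable_lift: "unit_function L f \<Longrightarrow> integrable mu (lift f)"
  using lift_range by (intro mu.integrable_const_bound[where B = "Kv * Kt"]) (auto simp: unit_function_def)

lemma integrable_mass: "integrable mu mass"
  using mass_range by (intro mu.integrable_const_bound[where B = "Kt"]) auto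

lemma integral_propagated:
  assumes f: "unit_function L f"
  shows "(\<integral>x. f x \<partial>propagated) = (\<integral>e. lift f e \<partial>mu)"
proof -
  have [measurable]: "f \<in> borel_measurable L" using f by (simp add: unit_function_def)
  have "(\<integral>x. f x \<partial>propagated) = enn2real (\<integral>\<^sup>+x. ennreal (f x) \<partial>propagated)"
    using f by (intro integral_eq_nn_integral) (auto simp: unit_function_def)
  also have "\<dots> = enn2real (\<integral>\<^sup>+e. ennreal (lift f e) \<partial>mu)"
    by (simp add: nn_integral_propagated[OF f])
  also have "\<dots> = (\<integral>e. lift f e \<partial>mu)"
    using f lift_range by (intro integral_eq_nn_integral[symmetric]) (auto simp: unit_function_def)
  finally show ?thesis .
qed

lemma emeasure_propagated: "emeasure propagated (space propagated) = (\<integral>\<^sup>+e. ennreal (lift (\<lambda>_. 1) e) \<partial>mu)"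
  using nn_integral_propagated[OF unit_function_const] by simp

text \<open>The lift of 1 is bounded by \<open>Kv * Kt\<close> and \<open>mu\<close> is
  finite.\<close>

lemma finite_measure_propagated: "finite_measure propagated"
proof
  have "(\<integral>\<^sup>+e. ennreal (lift (\<lambda>_. 1) e) \<partial>mu) = ennreal (\<integral>e. lift (\<lambda>_. 1) e \<partial>mu)"
    using lift_range(1)[OF unit_function_const]
    by (intro nn_integral_eq_integral integrable_lift unit_function_const) auto
  then show "emeasure propagated (space propagated) \<noteq> \<infinity>"
    unfolding emeasure_propagated by simp
qed

lemma measure_propagated: "measure propagated (space propagated) = (\<integral>e. lift (\<lambda>_. 1) e \<partial>mu)"
  using integral_propagated[OF unit_function_const] by simp

lemma measure_propagated_pos: "0 < measure propagated (space propagated)"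
proof -
  interpret propagated: finite_measure propagated by (rule finite_measure_propagated)
  have "0 < emeasure propagated (space propagated)"
    unfolding emeasure_propagated using mass_pos
    by (simp add: lift_ennreal unit_function_const cong: nn_integral_cong)
  then show ?thesis by (simp add: propagated.emeasure_eq_measure)
qed

text \<open>The lift of 1 is at most \<open>Kv * mass\<close>, so a vanishing average multiplier
  would make \<open>propagated\<close> null.\<close>

lemma integral_mass_pos: "0 < (\<integral>e. mass e \<partial>mu)"
proof -
  have "0 < (\<integral>e. lift (\<lambda>_. 1) e \<partial>mu)"
    using measure_propagated_pos measure_propagated by simp
  also have "\<dots> \<le> (\<integral>e. Kv * mass e \<partial>mu)"
    using lift_range(2)[OF unit_function_const] integrable_mass
    by (intro integral_mono integrable_lift unit_function_const) auto
  finally show ?thesis using Kv by (simp add: zero_less_mult_iff)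
qed

lemma mu_pos: "0 < measure mu (space mu)"
proof (rule ccontr)
  assume "\<not> 0 < measure mu (space mu)"
  then have "measure mu (space mu) = 0" by (simp add: not_less measure_le_0_iff)
  then have "emeasure mu (space mu) = 0" by (simp add: mu.emeasure_eq_measure)
  then have "AE e in mu. mass e = 0"
    by (intro AE_I[where N = "space mu"]) auto
  then have "(\<integral>e. mass e \<partial>mu) = 0"
    by (subst integral_cong_AE[where g = "\<lambda>_. 0"]) auto
  then show False using integral_mass_pos by simp
qed

lemma target_mass_pos: "0 < target mu mass"
  unfolding target_def using integral_mass_pos mu_pos by simp

lemma target_lift_pos: "0 < target mu (lift (\<lambda>_. 1))"
  unfolding target_def using measure_propagated_pos measure_propagated mu_pos by simp

text \<open>The mass of \<open>mu\<close> cancels, so the limit of the children is a ratio of two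
  parental targets, the form in which the estimator also appears.\<close>

lemma target_propagated:
  assumes "unit_function L f"
  shows "target propagated f = target mu (lift f) / target mu (lift (\<lambda>_. 1))"
  unfolding target_def[of propagated] measure_propagated integral_propagated[OF assms] target_def[of mu]
  using mu_pos by simp

text \<open>The minimum is the common rate of the sampling error (\<open>2 / Kv^2\<close>, from
  Hoeffding) and of the error of the conditional mean: \<open>C / (Kv * Kt)^2\<close> after scaling,
  then divided by 4 for a union bound and by \<open>(1 / target mu mass)^2\<close> for a ratio
  estimate. The first \<open>/ 4\<close> after the minimum adds these two errors. The square and the
  last \<open>/ 4\<close> come from the final quotient of weighted numerator and weight average; the
  latter tends to \<open>target mu (lift (\<lambda>_. 1)) / target mu mass\<close>.\<close>

definition rate :: "real \<Rightarrow> real" where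
  "rate C = min (2 / Kv\<^sup>2) (C * (target mu mass)\<^sup>2 / (4 * Kv\<^sup>2 * Kt\<^sup>2)) / 4
     * (target mu (lift (\<lambda>_. 1)) / target mu mass)\<^sup>2 / 4"

lemma rate_pos: "0 < C \<Longrightarrow> 0 < rate C"
  unfolding rate_def using Kv Kt target_mass_pos target_lift_pos by simp

text \<open>The draw \<open>y\<close> stays abstract: \<open>pos w y\<close> is the chosen parent,
  \<open>c y\<close> the child, and \<open>disint\<close> says that \<open>f w\<close> is the
  unnormalised law of a parent picked from the weighted family \<open>X i w\<close> followed by a
  move with \<open>k\<close>. Single parents, pairs of particles and the initial sample are all of
  this form. Numerator and weight average stay near their conditional means by Hoeffding, and these
  means, ratios of averages over parents, stay near their limits by \<open>conc\<close>. Each of the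
  two averages costs \<open>2 + 2 * B\<close>, hence \<open>4 + 4 * B\<close>.\<close>

lemma concentrates_propagated:
  fixes S :: "'y measure" and M :: "'w measure" and J :: "'i set"
  assumes M: "prob_space M"
    and R: "space R = space M" "sets R \<subseteq> sets M"
    and S: "sigma_finite_measure S"
    and f[measurable]: "(\<lambda>(w, y). f w y) \<in> borel_measurable (R \<Otimes>\<^sub>M S)"
    and Y: "cond_iid M (sets R) N S f Y"
    and J: "finite J"
    and W: "\<And>i. i \<in> J \<Longrightarrow> W i \<in> borel_measurable R" "\<And>i w. i \<in> J \<Longrightarrow> w \<in> space M \<Longrightarrow> 0 \<le> W i w"
    and X: "\<And>i. i \<in> J \<Longrightarrow> X i \<in> R \<rightarrow>\<^sub>M mu"
    and pos: "(\<lambda>(w, y). pos w y) \<in> R \<Otimes>\<^sub>M S \<rightarrow>\<^sub>M mu"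
    and c: "c \<in> S \<rightarrow>\<^sub>M L"
    and disint: "\<And>w F. w \<in> space M \<Longrightarrow> (\<lambda>(e, x). F e x) \<in> borel_measurable (mu \<Otimes>\<^sub>M L) \<Longrightarrow>
      (\<integral>\<^sup>+y. f w y * F (pos w y) (c y) \<partial>S) =
      (\<Sum>i\<in>J. ennreal (W i w) * (\<integral>\<^sup>+x. ennreal (k (X i w) x) * F (X i w) x \<partial>L))"
    and N: "N \<ge> 1"
    and conc: "concentrates M (real N) J W X mu B C" and B: "B \<ge> 0"
  shows "concentrates M (real N) {1..N} (\<lambda>l w. v (pos w (Y l w)) (c (Y l w))) (\<lambda>l w. c (Y l w))
    propagated (4 + 4 * B) (rate C)"
proof -
  interpret M: prob_space M by fact
  define bt where "bt = target mu mass"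
  define bl where "bl = target mu (lift (\<lambda>_. 1))"
  have bt: "bt > 0" and bl: "bl > 0" by (simp_all add: bt_def bl_def target_mass_pos target_lift_pos)
  have Ym: "Y l \<in> M \<rightarrow>\<^sub>M S" if "l \<in> {1..N}" for l
    using Y that by (auto simp: cond_iid_def)
  have XM: "X i w \<in> space mu" if "i \<in> J" "w \<in> space M" for i w
    using measurable_space[OF X[OF that(1)], of w] that R by simp
  define C1 where "C1 = min (2 / Kv\<^sup>2) (C * bt\<^sup>2 / (4 * Kv\<^sup>2 * Kt\<^sup>2))"
  \<comment> \<open>Applied later to the test function and to the constant 1. The \<open>2\<close>
    is Hoeffding's; the \<open>2 * B\<close> comes from the two parental averages in the conditional
    mean.\<close>
  have one: "tail_bound M (real N) (2 + 2 * B) (C1 / 4)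
      (\<lambda>w. (\<Sum>l=1..N. v (pos w (Y l w)) (c (Y l w)) * h (c (Y l w))) / real N - target mu (lift h) / bt)"
    if h: "unit_function L h" for h
  proof -
    have hm: "h \<in> borel_measurable L" using h by (simp add: unit_function_def)
    define \<phi> where "\<phi> w y = v (pos w y) (c y) * h (c y)" for w y
    let ?al = "\<lambda>w. weighted_average J (\<lambda>i. W i w) (\<lambda>i. lift h (X i w))" and ?am = "\<lambda>w. weighted_average J (\<lambda>i. W i w) (\<lambda>i. mass (X i w))"
    let ?sl = "\<lambda>w. \<Sum>i\<in>J. W i w * lift h (X i w)" and ?sm = "\<lambda>w. \<Sum>i\<in>J. W i w * mass (X i w)"
    let ?av = "\<lambda>w. (\<Sum>l=1..N. \<phi> w (Y l w)) / real N"
    \<comment> \<open>The conditional expectation of one draw of \<open>\<phi>\<close> given the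
      past, written as a quotient of weighted averages so that \<open>conc\<close> applies to both
      parts.\<close>
    define m where "m w = ?al w / ?am w" for w
    have m_eq: "m w = ?sl w / ?sm w" if "w \<in> space M" for w
      unfolding m_def using J W(2) that by (intro weighted_average_ratio) auto
    have lX: "(\<lambda>w. lift h (X i w)) \<in> borel_measurable R" "(\<lambda>w. mass (X i w)) \<in> borel_measurable R" if "i \<in> J" for i
      using measurable_compose[OF X[OF that] lift_measurable[OF hm]]
        measurable_compose[OF X[OF that] mass_measurable] by auto
    have mm: "m \<in> borel_measurable R"
      unfolding m_def weighted_average_def
      by (intro borel_measurable_divide borel_measurable_sum borel_measurable_times W lX)
    have cm: "(\<lambda>(w, y). c y) \<in> R \<Otimes>\<^sub>M S \<rightarrow>\<^sub>M L"
      using measurable_compose[OF measurable_snd c] by (simp add: case_prod_beta')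
    have \<phi>m: "(\<lambda>(w, y). \<phi> w y) \<in> borel_measurable (R \<Otimes>\<^sub>M S)"
      unfolding \<phi>_def case_prod_beta'
      using measurable_compose[OF measurable_Pair[OF pos cm] v_measurable] measurable_compose[OF cm hm]
      by (intro borel_measurable_times) (simp_all add: case_prod_beta')
    have range: "\<phi> w y \<in> {0..Kv}" if "w \<in> space M" "y \<in> space S" for w y
    proof -
      have p: "pos w y \<in> space mu"
        using measurable_space[OF pos, of "(w, y)"] that R by (simp add: space_pair_measure)
      have x: "c y \<in> space L" using measurable_space[OF c] that by simp
      have "v (pos w y) (c y) * h (c y) \<le> Kv * 1"
        using v_range[OF p x] h x Kv by (intro mult_mono) (auto simp: unit_function_def)
      then show ?thesis
        using v_range[OF p x] h x by (auto simp: \<phi>_def unit_function_def)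
    qed
    have mean: "AE w in M. m w = (\<integral>y. \<phi> w y \<partial>normalized_density S (f w))"
    proof -
      have "AE w in M. 0 < (\<integral>\<^sup>+y. f w y \<partial>S) \<and> (\<integral>\<^sup>+y. f w y \<partial>S) < \<infinity>"
        using Y by (simp add: cond_iid_def)
      then show ?thesis using AE_space
      proof eventually_elim
        case (elim w)
        have fw: "f w \<in> borel_measurable S" "\<phi> w \<in> borel_measurable S"
          using measurable_Pair2[OF f, of w] measurable_Pair2[OF \<phi>m, of w] elim R by simp_all
        define Z where "Z = (\<integral>\<^sup>+y. f w y \<partial>S)"
        \<comment> \<open>\<open>disint\<close> with \<open>F = 1\<close> evaluates the normalising
          constant; with \<open>F = v * h\<close> it evaluates the numerator.\<close>
        have "Z = (\<integral>\<^sup>+y. f w y * 1 \<partial>S)" by (simp add: Z_def)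
        also have "\<dots> = (\<Sum>i\<in>J. ennreal (W i w) * (\<integral>\<^sup>+x. ennreal (k (X i w) x) * 1 \<partial>L))"
          using elim by (intro disint) auto
        also have "\<dots> = (\<Sum>i\<in>J. ennreal (W i w * mass (X i w)))"
          using XM W(2) elim mass_range by (intro sum.cong) (auto simp: mass_ennreal[symmetric] ennreal_mult)
        also have "\<dots> = ennreal (?sm w)"
          using XM W(2) elim mass_range by (intro sum_ennreal) auto
        finally have Z: "Z = ennreal (?sm w)" .
        have "(\<integral>\<^sup>+y. f w y * ennreal (\<phi> w y) \<partial>S) =
            (\<Sum>i\<in>J. ennreal (W i w) * (\<integral>\<^sup>+x. ennreal (k (X i w) x) * ennreal (v (X i w) x * h x) \<partial>L))"
          unfolding \<phi>_def using elim hm by (intro disint) auto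
        also have "\<dots> = (\<Sum>i\<in>J. ennreal (W i w * lift h (X i w)))"
        proof (intro sum.cong refl)
          fix i assume i: "i \<in> J"
          have "(\<integral>\<^sup>+x. ennreal (k (X i w) x) * ennreal (v (X i w) x * h x) \<partial>L) = ennreal (lift h (X i w))"
            unfolding lift_ennreal[OF h XM[OF i elim(2)]]
            using k_nonneg[OF XM[OF i elim(2)]] v_range[OF XM[OF i elim(2)]] h
            by (intro nn_integral_cong) (auto simp: ennreal_mult[symmetric] unit_function_def mult_ac)
          then show "ennreal (W i w) * (\<integral>\<^sup>+x. ennreal (k (X i w) x) * ennreal (v (X i w) x * h x) \<partial>L) = ennreal (W i w * lift h (X i w))"
            using W(2) i elim lift_range(1)[OF h XM[OF i elim(2)]] by (simp add: ennreal_mult)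
        qed
        also have "\<dots> = ennreal (?sl w)"
          using XM W(2) elim lift_range(1)[OF h] by (intro sum_ennreal) auto
        finally have num: "(\<integral>\<^sup>+y. f w y * ennreal (\<phi> w y) \<partial>S) = ennreal (?sl w)" .
        have "(\<integral>\<^sup>+y. ennreal (\<phi> w y) \<partial>normalized_density S (f w)) = (\<integral>\<^sup>+y. f w y / Z * ennreal (\<phi> w y) \<partial>S)"
          unfolding normalized_density_def Z_def using fw by (intro nn_integral_density) auto
        also have "\<dots> = (\<integral>\<^sup>+y. f w y * ennreal (\<phi> w y) / Z \<partial>S)"
          by (simp add: divide_ennreal_def mult_ac)
        also have "\<dots> = (\<integral>\<^sup>+y. f w y * ennreal (\<phi> w y) \<partial>S) / Z"
          using fw by (intro nn_integral_divide) auto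
        also have "\<dots> = ennreal (?sl w / ?sm w)"
          unfolding num Z using elim(1)[folded Z_def] lift_range(1)[OF h] XM W(2) elim(2)
          by (intro divide_ennreal sum_nonneg) (auto simp: Z)
        finally have "(\<integral>\<^sup>+y. ennreal (\<phi> w y) \<partial>normalized_density S (f w)) = ennreal (m w)"
          using m_eq elim by simp
        moreover have "0 \<le> m w"
          unfolding m_eq[OF elim(2)] using lift_range(1)[OF h] mass_range XM W(2) elim(2)
          by (intro divide_nonneg_nonneg sum_nonneg mult_nonneg_nonneg) auto
        moreover have "(\<integral>y. \<phi> w y \<partial>normalized_density S (f w)) = enn2real (\<integral>\<^sup>+y. ennreal (\<phi> w y) \<partial>normalized_density S (f w))"
          using range elim(2) fw by (intro integral_eq_nn_integral) (auto simp: normalized_density_def)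
        ultimately show ?case by simp
      qed
    qed
    have t1: "tail_bound M (real N) 2 (2 / Kv\<^sup>2) (\<lambda>w. ?av w - m w)"
      by (rule cond_iid_Hoeffding[OF M R S f Y \<phi>m mm range mean N Kv])
    have mM: "m \<in> borel_measurable M"
      using measurable_compose[OF measurable_ident_subalgebra[OF R] mm] by simp
    have "tail_bound M (real N) B (C / (Kv * Kt)\<^sup>2)
        (\<lambda>w. ?al w - target mu (lift h))"
      using lift_range[OF h] Kv Kt by (intro concentrates_scaled[OF conc lift_measurable[OF hm]]) auto
    \<comment> \<open>The factor \<open>Kv\<close> is the one that \<open>abs_ratio_diff_le\<close>
      puts on the denominator error; it also brings both rates to
      \<open>C / (Kv * Kt)^2\<close>.\<close>
    moreover have "tail_bound M (real N) B (C / Kt\<^sup>2 / Kv\<^sup>2)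
        (\<lambda>w. Kv * (?am w - bt))"
      unfolding bt_def using mass_range Kt
      by (intro tail_bound_cmult[OF _ Kv] concentrates_scaled[OF conc mass_measurable]) auto
    moreover have "C / Kt\<^sup>2 / Kv\<^sup>2 = C / (Kv * Kt)\<^sup>2" by (simp add: power_mult_distrib mult.commute)
    ultimately have "tail_bound M (real N) (B + B) (C / (Kv * Kt)\<^sup>2 / 4)
       (\<lambda>w. \<bar>?al w - target mu (lift h)\<bar> +
         \<bar>Kv * (?am w - bt)\<bar>)"
      using M.finite_measure_axioms by (intro tail_bound_add) auto
    from tail_bound_cmult[OF this, of "1 / bt"] bt
    have t2': "tail_bound M (real N) (B + B) (C / (Kv * Kt)\<^sup>2 / 4 / (1 / bt)\<^sup>2)
       (\<lambda>w. 1 / bt * (\<bar>?al w - target mu (lift h)\<bar> +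
         \<bar>Kv * (?am w - bt)\<bar>))" by simp
    have t2: "tail_bound M (real N) (B + B) (C / (Kv * Kt)\<^sup>2 / 4 / (1 / bt)\<^sup>2) (\<lambda>w. m w - target mu (lift h) / bt)"
    proof (rule tail_bound_mono[OF M.finite_measure_axioms t2'])
      fix w assume w: "w \<in> space M"
      have "\<bar>m w - target mu (lift h) / bt\<bar> \<le>
          (\<bar>?al w - target mu (lift h)\<bar> +
            Kv * \<bar>?am w - bt\<bar>) / bt"
        unfolding m_def
      \<comment> \<open>The pointwise bound \<open>lift h \<le> Kv * mass\<close> gives the
        domination with \<open>K = Kv\<close>.\<close>
      proof (rule abs_ratio_diff_le[OF _ _ _ bt])
        show "0 \<le> ?al w"
          using W(2) w XM lift_range(1)[OF h] by (intro weighted_average_nonneg) auto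
        show "0 \<le> ?am w"
          using W(2) w XM mass_range by (intro weighted_average_nonneg) auto
        show "?al w \<le> Kv * ?am w"
          unfolding weighted_average_cmult[symmetric]
          using W(2) w XM lift_range(2)[OF h] by (intro weighted_average_mono) auto
      qed (use Kv in simp)
      then show "\<bar>m w - target mu (lift h) / bt\<bar> \<le>
        \<bar>1 / bt * (\<bar>?al w - target mu (lift h)\<bar> +
         \<bar>Kv * (?am w - bt)\<bar>)\<bar>"
        using bt Kv by (simp add: abs_mult)
    qed (use mM in simp)
    have "tail_bound M (real N) 2 C1 (\<lambda>w. ?av w - m w)"
      by (rule tail_bound_weaken[OF t1]) (auto simp: C1_def)
    moreover have "tail_bound M (real N) (B + B) C1 (\<lambda>w. m w - target mu (lift h) / bt)"
      by (rule tail_bound_weaken[OF t2]) (use B in \<open>auto simp: C1_def power_mult_distrib power_divide field_simps\<close>)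
    ultimately have "tail_bound M (real N) (2 + (B + B)) (C1 / 4)
       (\<lambda>w. \<bar>?av w - m w\<bar> + \<bar>m w - target mu (lift h) / bt\<bar>)"
      by (rule tail_bound_add[OF M.finite_measure_axioms])
    then have "tail_bound M (real N) (2 + (B + B)) (C1 / 4)
       (\<lambda>w. ?av w - target mu (lift h) / bt)"
    proof (rule tail_bound_mono[OF M.finite_measure_axioms])
      have "(\<lambda>w. ?av w - m w) \<in> borel_measurable M"
        using t1 by (simp add: tail_bound_def)
      from borel_measurable_add[OF this borel_measurable_diff[OF mM borel_measurable_const[of "target mu (lift h) / bt"]]]
      show "(\<lambda>w. ?av w - target mu (lift h) / bt) \<in> borel_measurable M"
        by simp
    qed auto
    then show ?thesis by (simp add: \<phi>_def)
  qed
  show ?thesis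
    unfolding concentrates_def
  proof (intro allI impI)
    fix h assume "unit_function propagated h"
    then have h: "unit_function L h" by (simp add: unit_function_def cong: measurable_cong_sets)
    let ?a = "\<lambda>w. (\<Sum>l=1..N. v (pos w (Y l w)) (c (Y l w)) * h (c (Y l w))) / real N"
    let ?b = "\<lambda>w. (\<Sum>l=1..N. v (pos w (Y l w)) (c (Y l w)) * 1) / real N"
    let ?d = "\<lambda>w. weighted_average {1..N} (\<lambda>l. v (pos w (Y l w)) (c (Y l w))) (\<lambda>l. h (c (Y l w))) - target propagated h"
    \<comment> \<open>Both sums are divided by \<open>N\<close> and both limits by
      \<open>bt\<close>, which leaves the quotients unchanged.\<close>
    have d: "?d w = ?a w / ?b w - (target mu (lift h) / bt) / (bl / bt)" for w
      using N bt by (simp add: weighted_average_def target_propagated[OF h] bl_def)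
    have ta: "tail_bound M (real N) (2 + 2 * B) (C1 / 4) (\<lambda>w. ?a w - target mu (lift h) / bt)"
      by (rule one[OF h])
    have tb: "tail_bound M (real N) (2 + 2 * B) (C1 / 4) (\<lambda>w. ?b w - bl / bt)"
      unfolding bl_def by (rule one[OF unit_function_const])
    have t: "tail_bound M (real N) ((2 + 2 * B) + (2 + 2 * B)) (C1 / 4 / 4 / (1 / (bl / bt))\<^sup>2)
       (\<lambda>w. 1 / (bl / bt) * (\<bar>?a w - target mu (lift h) / bt\<bar> + \<bar>?b w - bl / bt\<bar>))"
      using bl bt by (intro tail_bound_cmult tail_bound_add[OF M.finite_measure_axioms ta tb]) auto
    have am: "?a \<in> borel_measurable M" "?b \<in> borel_measurable M"
    proof -
      have "(\<lambda>w. (?a w - target mu (lift h) / bt) + target mu (lift h) / bt) \<in> borel_measurable M"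
        using ta by (intro borel_measurable_add) (auto simp: tail_bound_def)
      then show "?a \<in> borel_measurable M" by simp
      have "(\<lambda>w. (?b w - bl / bt) + bl / bt) \<in> borel_measurable M"
        using tb by (intro borel_measurable_add) (auto simp: tail_bound_def)
      then show "?b \<in> borel_measurable M" by simp
    qed
    have "tail_bound M (real N) ((2 + 2 * B) + (2 + 2 * B)) (C1 / 4 / 4 / (1 / (bl / bt))\<^sup>2) ?d"
    proof (rule tail_bound_mono[OF M.finite_measure_axioms t])
      show "?d \<in> borel_measurable M" unfolding d
        by (intro borel_measurable_diff borel_measurable_divide am borel_measurable_const)
      fix w assume w: "w \<in> space M"
      have cY: "c (Y l w) \<in> space L" "pos w (Y l w) \<in> space mu" if "l \<in> {1..N}" for l
        using measurable_space[OF Ym[OF that] w] measurable_space[OF c] measurable_space[OF pos, of "(w, Y l w)"] w R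
        by (auto simp: space_pair_measure)
      \<comment> \<open>Since \<open>0 \<le> h \<le> 1\<close>, the numerator is at most the weight
        average, so the ratio bound applies with \<open>K = 1\<close>.\<close>
      have "\<bar>?d w\<bar> \<le> (\<bar>?a w - target mu (lift h) / bt\<bar> + 1 * \<bar>?b w - bl / bt\<bar>) / (bl / bt)"
        unfolding d
      proof (rule abs_ratio_diff_le)
        show "0 \<le> ?a w"
          using cY v_range h by (intro divide_nonneg_nonneg sum_nonneg mult_nonneg_nonneg) (auto simp: unit_function_def)
        show "0 \<le> ?b w"
          using cY v_range h by (intro divide_nonneg_nonneg sum_nonneg mult_nonneg_nonneg) (auto simp: unit_function_def)
        have "?a w \<le> ?b w"
          using cY v_range h by (intro divide_right_mono sum_mono mult_left_mono) (auto simp: unit_function_def)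
        then show "?a w \<le> 1 * ?b w" by simp
      qed (use bl bt in auto)
      then show "\<bar>?d w\<bar> \<le> \<bar>1 / (bl / bt) * (\<bar>?a w - target mu (lift h) / bt\<bar> + \<bar>?b w - bl / bt\<bar>)\<bar>"
        using bl bt by (simp add: abs_mult mult.commute)
    qed
    moreover have "C1 / 4 / 4 / (1 / (bl / bt))\<^sup>2 = rate C"
      using bl bt by (simp add: rate_def C1_def bt_def bl_def power_divide field_simps)
    ultimately show "tail_bound M (real N) (4 + 4 * B) (rate C) ?d" by simp
  qed
qed

end

subsection \<open>Independent weighted samples\<close>

text \<open>Freezing: under independence the two arguments have a product law, so a tail bound valid
  for every frozen second argument integrates by Tonelli to the same bound on the diagonal.\<close>

lemma tail_bound_indep:
  assumes M: "prob_space M"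
    and R: "space R1 = space M" "space R2 = space M"
    and ind: "prob_space.indep_set M (sets R1) (sets R2)"
    and Z: "Z \<in> borel_measurable (R1 \<Otimes>\<^sub>M R2)"
    and tail: "\<And>w'. w' \<in> space M \<Longrightarrow> tail_bound M n B C (\<lambda>w. Z (w, w'))"
    and B: "0 \<le> B"
  shows "tail_bound M n B C (\<lambda>w. Z (w, w))"
proof -
  interpret M: prob_space M by fact
  have sub: "sets R1 \<subseteq> sets M" "sets R2 \<subseteq> sets M"
    using M.indep_setD_ev1[OF ind] M.indep_setD_ev2[OF ind] by auto
  have id1: "(\<lambda>w. w) \<in> M \<rightarrow>\<^sub>M R1" and id2: "(\<lambda>w. w) \<in> M \<rightarrow>\<^sub>M R2"
    using measurable_ident_subalgebra R sub by auto
  have idp: "(\<lambda>w. (w, w)) \<in> M \<rightarrow>\<^sub>M R1 \<Otimes>\<^sub>M R2" using id1 id2 by (rule measurable_Pair)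
  let ?P1 = "distr M R1 (\<lambda>w. w)" and ?P2 = "distr M R2 (\<lambda>w. w)"
  interpret P1: prob_space ?P1 by (rule M.prob_space_distr[OF id1])
  interpret P2: prob_space ?P2 by (rule M.prob_space_distr[OF id2])
  interpret P: pair_sigma_finite ?P1 ?P2 ..
  \<comment> \<open>Independence of the two sub-sigma-fields restated: the diagonal map carries
    \<open>M\<close> to the product of its restrictions.\<close>
  have eq: "?P1 \<Otimes>\<^sub>M ?P2 = distr M (R1 \<Otimes>\<^sub>M R2) (\<lambda>w. (w, w))"
  proof (rule pair_measure_eqI)
    fix a b assume "a \<in> sets ?P1" "b \<in> sets ?P2"
    then have a: "a \<in> sets R1" and b: "b \<in> sets R2" by simp_all
    have "a \<subseteq> space M" "b \<subseteq> space M" using sets.sets_into_space[OF a] sets.sets_into_space[OF b] R by auto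
    then have *: "a \<inter> space M = a" "b \<inter> space M = b"
      "(\<lambda>w. (w, w)) -` (a \<times> b) \<inter> space M = a \<inter> b" by auto
    show "emeasure ?P1 a * emeasure ?P2 b = emeasure (distr M (R1 \<Otimes>\<^sub>M R2) (\<lambda>w. (w, w))) (a \<times> b)"
      using a b M.indep_setD[OF ind a b]
      by (simp add: emeasure_distr[OF id1] emeasure_distr[OF id2] emeasure_distr[OF idp] *
          M.emeasure_eq_measure ennreal_mult[symmetric])
  qed (simp_all add: P1.sigma_finite_measure_axioms P2.sigma_finite_measure_axioms cong: sets_pair_measure_cong)
  show ?thesis
    unfolding tail_bound_def
  proof (intro conjI allI impI)
    show "(\<lambda>w. Z (w, w)) \<in> borel_measurable M" using measurable_compose[OF idp Z] by simp
    fix e :: real assume e: "e > 0"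
    let ?b = "B * exp (- (C * n * e\<^sup>2))"
    define A where "A = {x\<in>space (R1 \<Otimes>\<^sub>M R2). \<bar>Z x\<bar> > e}"
    have A: "A \<in> sets (R1 \<Otimes>\<^sub>M R2)" unfolding A_def using Z by measurable
    have A': "A \<in> sets (?P1 \<Otimes>\<^sub>M ?P2)" using A by (simp cong: sets_pair_measure_cong)
    have "emeasure M {w\<in>space M. \<bar>Z (w, w)\<bar> > e} = emeasure (distr M (R1 \<Otimes>\<^sub>M R2) (\<lambda>w. (w, w))) A"
      unfolding emeasure_distr[OF idp A] by (rule arg_cong[where f="emeasure M"]) (auto simp: A_def space_pair_measure R)
    also have "\<dots> = (\<integral>\<^sup>+w'. emeasure ?P1 ((\<lambda>w. (w, w')) -` A) \<partial>?P2)"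
      unfolding eq[symmetric] by (rule P.emeasure_pair_measure_alt2[OF A'])
    also have "\<dots> \<le> (\<integral>\<^sup>+w'. ennreal ?b \<partial>?P2)"
    proof (intro nn_integral_mono)
      fix w' assume "w' \<in> space ?P2"
      then have w': "w' \<in> space M" using R by simp
      have *: "(\<lambda>w. (w, w')) -` A \<in> sets R1" using A by (rule sets_Pair2)
      have "emeasure ?P1 ((\<lambda>w. (w, w')) -` A) = emeasure M {w\<in>space M. \<bar>Z (w, w')\<bar> > e}"
        unfolding emeasure_distr[OF id1 *]
        using w' by (intro arg_cong[where f="emeasure M"]) (auto simp: A_def space_pair_measure R)
      also have "\<dots> \<le> ennreal ?b"
        using tail_boundD[OF tail[OF w'] e] by (simp add: M.emeasure_eq_measure ennreal_leI)
      finally show "emeasure ?P1 ((\<lambda>w. (w, w')) -` A) \<le> ennreal ?b" .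
    qed
    also have "\<dots> = ennreal ?b" by (simp only: nn_integral_const P2.emeasure_space_1 mult_1_right)
    finally show "measure M {w\<in>space M. \<bar>Z (w, w)\<bar> > e} \<le> ?b"
      using B by (simp add: M.emeasure_eq_measure)
  qed
qed

lemma weighted_average_le_1:
  assumes "\<And>i. i \<in> J \<Longrightarrow> 0 \<le> W i" "\<And>i. i \<in> J \<Longrightarrow> X i \<le> 1"
  shows "weighted_average J W X \<le> 1"
proof -
  have "(\<Sum>i\<in>J. W i * X i) \<le> (\<Sum>i\<in>J. W i)"
    using assms by (intro sum_mono) (simp add: mult_left_le)
  moreover have "0 \<le> (\<Sum>i\<in>J. W i)" using assms by (intro sum_nonneg)
  ultimately show ?thesis unfolding weighted_average_def by (auto simp: divide_le_eq_1)
qed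

text \<open>Pair weights are products, so the double average is an iterated one. The identity
  survives vanishing weight sums, where both sides are 0.\<close>

lemma weighted_average_product:
  assumes "finite J" "finite J'"
  shows "weighted_average (J \<times> J') (\<lambda>(i, j). W i * V j) (\<lambda>(i, j). X i j) =
    weighted_average J W (\<lambda>i. weighted_average J' V (X i))"
proof -
  have "(\<Sum>(i, j)\<in>J \<times> J'. W i * V j) = (\<Sum>i\<in>J. W i) * (\<Sum>j\<in>J'. V j)"
    by (simp add: sum_product sum.cartesian_product)
  moreover have "(\<Sum>(i, j)\<in>J \<times> J'. W i * V j * X i j) = (\<Sum>i\<in>J. W i * (\<Sum>j\<in>J'. V j * X i j))"
    by (simp add: sum_distrib_left sum.cartesian_product mult.assoc)
  ultimately show ?thesis
    by (simp add: weighted_average_def case_prod_beta' sum_divide_distrib[symmetric] mult.commute)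
qed

text \<open>With the second sample frozen, averaging \<open>f\<close> over it gives a unit function
  \<open>F w'\<close> of the first variable, to which \<open>cW\<close> applies. The target of
  \<open>F w'\<close> is the second-sample average of \<open>g\<close>, the partial expectation of
  \<open>f\<close> under \<open>mu\<close>, and \<open>cV\<close> controls this average. The union
  bound contributes \<open>B + B'\<close> and \<open>C / 4\<close>.\<close>

lemma concentrates_product:
  assumes M: "prob_space M"
    and R: "space R1 = space M" "space R2 = space M"
    and ind: "prob_space.indep_set M (sets R1) (sets R2)"
    and fin: "finite J" "finite J'"
    and W: "\<And>i. i \<in> J \<Longrightarrow> W i \<in> borel_measurable R1" "\<And>i w. i \<in> J \<Longrightarrow> w \<in> space M \<Longrightarrow> 0 \<le> W i w"
    and X: "\<And>i. i \<in> J \<Longrightarrow> X i \<in> R1 \<rightarrow>\<^sub>M mu"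
    and V: "\<And>j. j \<in> J' \<Longrightarrow> V j \<in> borel_measurable R2" "\<And>j w. j \<in> J' \<Longrightarrow> w \<in> space M \<Longrightarrow> 0 \<le> V j w"
    and Y: "\<And>j. j \<in> J' \<Longrightarrow> Y j \<in> R2 \<rightarrow>\<^sub>M nu"
    and mu: "finite_measure mu" and nu: "finite_measure nu"
    and cW: "concentrates M n J W X mu B C" and cV: "concentrates M n J' V Y nu B' C"
    and B: "0 \<le> B" "0 \<le> B'"
  shows "concentrates M n (J \<times> J') (\<lambda>(i, j) w. W i w * V j w) (\<lambda>(i, j) w. (X i w, Y j w)) (mu \<Otimes>\<^sub>M nu) (B + B') (C / 4)"
  unfolding concentrates_def
proof (intro allI impI)
  interpret M: prob_space M by fact
  interpret mu: finite_measure mu by fact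
  interpret nu: finite_measure nu by fact
  interpret P: pair_sigma_finite mu nu ..
  fix f assume "unit_function (mu \<Otimes>\<^sub>M nu) f"
  then have f[measurable]: "f \<in> borel_measurable (mu \<Otimes>\<^sub>M nu)"
    and f01: "\<And>x y. x \<in> space mu \<Longrightarrow> y \<in> space nu \<Longrightarrow> 0 \<le> f (x, y) \<and> f (x, y) \<le> 1"
    by (auto simp: unit_function_def space_pair_measure)
  have fx: "(\<lambda>x. f (x, y)) \<in> borel_measurable mu" if "y \<in> space nu" for y
    using measurable_Pair1[OF f that] .
  have ifx: "integrable mu (\<lambda>x. f (x, y))" if "y \<in> space nu" for y
    using f01 that by (intro mu.integrable_const_bound[where B = 1] fx) auto
  define g where "g y = target mu (\<lambda>x. f (x, y))" for y
  have g: "unit_function nu g"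
    unfolding unit_function_def
  proof (intro conjI ballI)
    show "g \<in> borel_measurable nu"
      unfolding g_def target_def
      by (intro borel_measurable_divide borel_measurable_const mu.borel_measurable_lebesgue_integral) measurable
    fix y assume y: "y \<in> space nu"
    show "0 \<le> g y" unfolding g_def target_def using f01 y by (intro divide_nonneg_nonneg integral_nonneg) auto
    have "(\<integral>x. f (x, y) \<partial>mu) \<le> (\<integral>x. 1 \<partial>mu)"
      using f01 y by (intro integral_mono ifx) auto
    then show "g y \<le> 1" by (auto simp: g_def target_def divide_le_eq_1 less_le)
  qed
  have YM: "Y j w \<in> space nu" if "j \<in> J'" "w \<in> space M" for j w
    using measurable_space[OF Y[OF that(1)], of w] that R by simp
  have XM: "X i w \<in> space mu" if "i \<in> J" "w \<in> space M" for i w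
    using measurable_space[OF X[OF that(1)], of w] that R by simp
  define F where "F w' x = weighted_average J' (\<lambda>j. V j w') (\<lambda>j. f (x, Y j w'))" for w' x
  have F: "unit_function mu (F w')" if w': "w' \<in> space M" for w'
    unfolding unit_function_def
  proof (intro conjI ballI)
    show "F w' \<in> borel_measurable mu"
      unfolding F_def weighted_average_def using fx[OF YM[OF _ w']]
      by (intro borel_measurable_divide borel_measurable_sum borel_measurable_times borel_measurable_const) auto
    fix x assume x: "x \<in> space mu"
    show "0 \<le> F w' x" unfolding F_def using V(2) w' f01[OF x YM[OF _ w']] by (intro weighted_average_nonneg) auto
    show "F w' x \<le> 1" unfolding F_def using V(2) w' f01[OF x YM[OF _ w']] by (intro weighted_average_le_1) auto
  qed
  have tF: "target mu (F w') = weighted_average J' (\<lambda>j. V j w') (\<lambda>j. g (Y j w'))" if w': "w' \<in> space M" for w'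
  proof -
    have "(\<integral>x. F w' x \<partial>mu) = (\<Sum>j\<in>J'. V j w' * (\<integral>x. f (x, Y j w') \<partial>mu)) / (\<Sum>j\<in>J'. V j w')"
      unfolding F_def weighted_average_def using ifx[OF YM[OF _ w']] by (simp add: Bochner_Integration.integral_sum)
    then show ?thesis
      unfolding target_def g_def weighted_average_def by (simp add: sum_divide_distrib mult.commute)
  qed
  \<comment> \<open>The randomness of the two samples is kept apart, the first in
    \<open>fst p\<close> and the second in \<open>snd p\<close>, so that
    \<open>tail_bound_indep\<close> can freeze the latter.\<close>
  define Z1 where "Z1 p = weighted_average J (\<lambda>i. W i (fst p)) (\<lambda>i. F (snd p) (X i (fst p)))
      - weighted_average J' (\<lambda>j. V j (snd p)) (\<lambda>j. g (Y j (snd p)))" for p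
  have Z1m: "Z1 \<in> borel_measurable (R1 \<Otimes>\<^sub>M R2)"
  proof -
    have W1: "(\<lambda>p. W i (fst p)) \<in> borel_measurable (R1 \<Otimes>\<^sub>M R2)" if "i \<in> J" for i
      using measurable_compose[OF measurable_fst W(1)[OF that]] .
    have V1: "(\<lambda>p. V j (snd p)) \<in> borel_measurable (R1 \<Otimes>\<^sub>M R2)" if "j \<in> J'" for j
      using measurable_compose[OF measurable_snd V(1)[OF that]] .
    have X1: "(\<lambda>p. X i (fst p)) \<in> R1 \<Otimes>\<^sub>M R2 \<rightarrow>\<^sub>M mu" if "i \<in> J" for i
      using measurable_compose[OF measurable_fst X[OF that]] .
    have Y1: "(\<lambda>p. Y j (snd p)) \<in> R1 \<Otimes>\<^sub>M R2 \<rightarrow>\<^sub>M nu" if "j \<in> J'" for j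
      using measurable_compose[OF measurable_snd Y[OF that]] .
    have f1: "(\<lambda>p. f (X i (fst p), Y j (snd p))) \<in> borel_measurable (R1 \<Otimes>\<^sub>M R2)" if "i \<in> J" "j \<in> J'" for i j
      using measurable_compose[OF measurable_Pair[OF X1[OF that(1)] Y1[OF that(2)]] f] .
    have g1: "(\<lambda>p. g (Y j (snd p))) \<in> borel_measurable (R1 \<Otimes>\<^sub>M R2)" if "j \<in> J'" for j
      using measurable_compose[OF Y1[OF that]] g unfolding unit_function_def by blast
    show ?thesis
      unfolding Z1_def F_def weighted_average_def
      by (intro borel_measurable_diff borel_measurable_divide borel_measurable_sum borel_measurable_times W1 V1 f1 g1)
  qed
  have t1: "tail_bound M n B C (\<lambda>w. Z1 (w, w))"
  proof (rule tail_bound_indep[OF M R ind Z1m _ B(1)])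
    fix w' assume w': "w' \<in> space M"
    show "tail_bound M n B C (\<lambda>w. Z1 (w, w'))"
      using cW F[OF w'] unfolding concentrates_def Z1_def fst_conv snd_conv tF[OF w', symmetric] by blast
  qed
  have t2: "tail_bound M n B' C (\<lambda>w. weighted_average J' (\<lambda>j. V j w) (\<lambda>j. g (Y j w)) - target nu g)"
    using cV g unfolding concentrates_def by blast
  \<comment> \<open>Fubini, together with multiplicativity of the total mass.\<close>
  have tg: "target nu g = target (mu \<Otimes>\<^sub>M nu) f"
  proof -
    have fin: "emeasure (mu \<Otimes>\<^sub>M nu) (space (mu \<Otimes>\<^sub>M nu)) = ennreal (measure mu (space mu) * measure nu (space nu))"
      by (simp add: space_pair_measure nu.emeasure_pair_measure_Times mu.emeasure_eq_measure nu.emeasure_eq_measure ennreal_mult)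
    then interpret mn: finite_measure "mu \<Otimes>\<^sub>M nu" by (intro finite_measureI) simp
    have "integrable (mu \<Otimes>\<^sub>M nu) f"
      using f01 by (intro mn.integrable_const_bound[where B = 1]) (auto simp: space_pair_measure)
    then have "(\<integral>y. (\<integral>x. f (x, y) \<partial>mu) \<partial>nu) = (\<integral>p. f p \<partial>(mu \<Otimes>\<^sub>M nu))"
      using P.integral_snd[of "\<lambda>x y. f (x, y)"] by simp
    moreover have "measure (mu \<Otimes>\<^sub>M nu) (space (mu \<Otimes>\<^sub>M nu)) = measure mu (space mu) * measure nu (space nu)"
      using fin by (simp add: measure_def)
    ultimately show ?thesis
      unfolding target_def[of nu] target_def[of "mu \<Otimes>\<^sub>M nu"] g_def target_def[of mu] by simp
  qed
  have prod: "weighted_average (J \<times> J') (\<lambda>p. (case p of (i, j) \<Rightarrow> \<lambda>w. W i w * V j w) w) (\<lambda>p. f ((case p of (i, j) \<Rightarrow> \<lambda>w. (X i w, Y j w)) w))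
     = weighted_average J (\<lambda>i. W i w) (\<lambda>i. F w (X i w))" for w
    unfolding F_def using weighted_average_product[OF fin, of "\<lambda>i. W i w" "\<lambda>j. V j w" "\<lambda>i j. f (X i w, Y j w)"]
    by (simp add: case_prod_beta')
  have sum: "weighted_average J (\<lambda>i. W i w) (\<lambda>i. F w (X i w)) - target (mu \<Otimes>\<^sub>M nu) f
     = Z1 (w, w) + (weighted_average J' (\<lambda>j. V j w) (\<lambda>j. g (Y j w)) - target nu g)" for w
    by (simp add: Z1_def tg)
  show "tail_bound M n (B + B') (C / 4)
     (\<lambda>w. weighted_average (J \<times> J') (\<lambda>p. (case p of (i, j) \<Rightarrow> \<lambda>w. W i w * V j w) w) (\<lambda>p. f ((case p of (i, j) \<Rightarrow> \<lambda>w. (X i w, Y j w)) w)) - target (mu \<Otimes>\<^sub>M nu) f)"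
    unfolding prod sum
  proof (rule tail_bound_mono[OF M.finite_measure_axioms tail_bound_add[OF M.finite_measure_axioms t1 t2]])
    show "(\<lambda>w. Z1 (w, w) + (weighted_average J' (\<lambda>j. V j w) (\<lambda>j. g (Y j w)) - target nu g)) \<in> borel_measurable M"
      using t1 t2 by (intro borel_measurable_add) (auto simp: tail_bound_def)
  qed auto
qed

text \<open>With the trivial sigma-field as past and the constant density 1 relative to
  \<open>rho\<close>, plain independence becomes the conditional notion, so the initial sample falls
  under \<open>concentrates_propagated\<close>.\<close>

lemma iid_sample_cond_iid:
  assumes M: "prob_space M" and rho: "prob_space rho" and Y: "iid_sample M N rho Y" and N: "N \<ge> 1"
  shows "cond_iid M (sets (sigma (space M) {})) N rho (\<lambda>_ _. 1) Y"
  unfolding cond_iid_def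
proof (intro conjI ballI)
  interpret M: prob_space M by fact
  interpret rho: prob_space rho by fact
  have ind: "M.indep_vars (\<lambda>_. rho) Y {1..N}" and law: "\<And>l. l \<in> {1..N} \<Longrightarrow> distr M rho (Y l) = rho"
    using Y by (auto simp: iid_sample_def)
  show "AE w in M. 0 < (\<integral>\<^sup>+y. 1 \<partial>rho) \<and> (\<integral>\<^sup>+y. 1 \<partial>rho) < \<infinity>"
    by (simp add: rho.emeasure_space_1)
  show Ym: "Y l \<in> M \<rightarrow>\<^sub>M rho" if "l \<in> {1..N}" for l
    using ind that by (auto simp: M.indep_vars_def)
  fix A B assume A: "A \<in> sets (sigma (space M) {})" and "B \<in> {1..N} \<rightarrow> sets rho"
  then have B: "\<And>l. l \<in> {1..N} \<Longrightarrow> B l \<in> sets rho" by auto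
  have nd: "normalized_density rho (\<lambda>_. 1) = rho"
    unfolding normalized_density_def by (simp add: rho.emeasure_space_1 density_1)
  have "A = {} \<or> A = space M" using A by (auto simp: sigma_sets_empty_eq)
  then show "emeasure M {w\<in>A. \<forall>l\<in>{1..N}. Y l w \<in> B l} =
    (\<integral>\<^sup>+w\<in>A. (\<Prod>l=1..N. emeasure (normalized_density rho (\<lambda>_. 1)) (B l)) \<partial>M)"
  proof
    assume A: "A = space M"
    have "measure M (\<Inter>l\<in>{1..N}. Y l -` B l \<inter> space M) = (\<Prod>l\<in>{1..N}. measure M (Y l -` B l \<inter> space M))"
      using N by (intro M.indep_varsD[OF ind]) (auto intro: B)
    also have "(\<Inter>l\<in>{1..N}. Y l -` B l \<inter> space M) = {w\<in>A. \<forall>l\<in>{1..N}. Y l w \<in> B l}"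
      using N A by (auto intro!: bexI[of _ 1])
    also have "(\<Prod>l\<in>{1..N}. measure M (Y l -` B l \<inter> space M)) = (\<Prod>l\<in>{1..N}. measure rho (B l))"
    proof (intro prod.cong refl)
      fix l assume l: "l \<in> {1..N}"
      have "measure (distr M rho (Y l)) (B l) = measure M (Y l -` B l \<inter> space M)"
        using B[OF l] Ym[OF l] by (intro measure_distr) auto
      then show "measure M (Y l -` B l \<inter> space M) = measure rho (B l)" using law[OF l] by simp
    qed
    finally show ?thesis
      unfolding nd by (simp add: A M.emeasure_eq_measure rho.emeasure_eq_measure prod_ennreal M.prob_space)
  qed simp
qed

text \<open>
  An i.i.d. sample is the offspring of a single fictitious parent of weight one.
\<close>

lemma concentrates_iid_sample:
  assumes rho: "prob_space rho" and v[measurable]: "v \<in> borel_measurable rho"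
    and v_range: "\<And>x. x \<in> space rho \<Longrightarrow> 0 \<le> v x \<and> v x \<le> K" and K: "0 < K"
    and pos: "0 < (\<integral>\<^sup>+x. ennreal (v x) \<partial>rho)"
  obtains C where "0 < C"
    and "\<And>(M :: 'w measure) N Y. prob_space M \<Longrightarrow> N \<ge> 1 \<Longrightarrow> iid_sample M N rho Y \<Longrightarrow>
      concentrates M (real N) {1..N} (\<lambda>l w. v (Y l w)) Y (density rho (\<lambda>x. ennreal (v x))) 4 C"
proof -
  interpret rho: prob_space rho by fact
  \<comment> \<open>Reference measure \<open>rho\<close> and \<open>k = 1\<close> make
    \<open>rho\<close> itself the proposal, with multiplier 1; the parent space is a single
    point.\<close>
  interpret importance_kernel rho "count_space (UNIV :: unit set)" "\<lambda>_ _. 1" "\<lambda>_. v" K 1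
  proof
    show "(\<lambda>(e :: unit, x). v x) \<in> borel_measurable (count_space UNIV \<Otimes>\<^sub>M rho)" by measurable
    show "0 < (\<integral>\<^sup>+e. \<integral>\<^sup>+x. ennreal (v x * 1) \<partial>rho \<partial>count_space (UNIV :: unit set))"
      using pos by (simp add: nn_integral_count_space_finite)
  qed (use v_range K in \<open>auto simp: rho.emeasure_space_1\<close>)
  have propagated: "propagated = density rho (\<lambda>x. ennreal (v x))"
    unfolding propagated_def by (simp add: nn_integral_count_space_finite)
  show thesis
  proof (rule that[OF rate_pos[of 1]])
    fix M :: "'w measure" and N Y
    assume M: "prob_space M" and N: "N \<ge> 1" and Y: "iid_sample M N rho Y"
    let ?R = "sigma (space M) {}"
    \<comment> \<open>The dummy parent never deviates from its target, so prefactor 0 is admissible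
      with any rate; \<open>4 + 4 * 0\<close> becomes the initial constant.\<close>
    have triv: "concentrates M (real N) {()} (\<lambda>_ _. 1) (\<lambda>_ _. ()) (count_space UNIV) 0 1"
      unfolding concentrates_def tail_bound_def weighted_average_def target_def
      by (simp add: lebesgue_integral_count_space_finite UNIV_unit)
    have "concentrates M (real N) {1..N} (\<lambda>l w. v (Y l w)) (\<lambda>l w. Y l w) propagated (4 + 4 * 0) (rate 1)"
    proof (rule concentrates_propagated[where pos = "\<lambda>_ _. ()" and c = "\<lambda>x. x" and R = ?R and J = "{()}", OF M _ _ _ _ iid_sample_cond_iid[OF M rho Y N] _ _ _ _ _ _ _ N triv])
      show "sets ?R \<subseteq> sets M" by (auto simp: sigma_sets_empty_eq)
    qed (auto simp: rho.sigma_finite_measure_axioms)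
    then show "concentrates M (real N) {1..N} (\<lambda>l w. v (Y l w)) Y (density rho (\<lambda>x. ennreal (v x))) 4 (rate 1)"
      unfolding propagated by simp
  qed simp
qed

subsection \<open>Smoothing distributions as iterated integrals\<close>

lemma nn_integral_pos:
  fixes f :: "'b \<Rightarrow> ennreal"
  assumes f: "f \<in> borel_measurable M" "\<And>x. x \<in> space M \<Longrightarrow> 0 < f x" and M: "emeasure M (space M) \<noteq> 0"
  shows "0 < (\<integral>\<^sup>+x. f x \<partial>M)"
proof (rule ccontr)
  assume "\<not> 0 < (\<integral>\<^sup>+x. f x \<partial>M)"
  then have "AE x in M. f x = 0" using f by (simp add: nn_integral_0_iff_AE)
  then have "AE x in M. False" using AE_space by eventually_elim (use f(2) in fastforce)
  then obtain N where "space M \<subseteq> N" "emeasure M N = 0" "N \<in> sets M" by (rule AE_E) auto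
  then show False using M emeasure_eq_0[of N M "space M"] by simp
qed

locale hidden_markov = lam: sigma_finite_measure lam + chi: prob_space chi
  for lam chi :: "'a measure" +
  fixes q :: "'a \<Rightarrow> 'a \<Rightarrow> real" and g :: "nat \<Rightarrow> 'a \<Rightarrow> real" and T :: nat
  assumes q: "transition_density lam lam q"
    and g: "\<forall>t\<in>{0..T}. positive_function lam (g t)"
    and sets_chi: "sets chi = sets lam"
begin

lemma q_measurable[measurable]: "(\<lambda>(x, y). q x y) \<in> borel_measurable (lam \<Otimes>\<^sub>M lam)"
  using q by (simp add: transition_density_def)

lemma q_nonneg: "x \<in> space lam \<Longrightarrow> y \<in> space lam \<Longrightarrow> 0 \<le> q x y"
  using q by (auto simp: transition_density_def probability_density_def)

lemma q_mass: "x \<in> space lam \<Longrightarrow> (\<integral>\<^sup>+y. ennreal (q x y) \<partial>lam) = 1"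
  using q by (auto simp: transition_density_def probability_density_def)

lemma q_measurable2: "x \<in> space lam \<Longrightarrow> q x \<in> borel_measurable lam"
  using q by (auto simp: transition_density_def probability_density_def)

lemma g_measurable[measurable]: "t \<le> T \<Longrightarrow> g t \<in> borel_measurable lam"
  using g by (auto simp: positive_function_def)

lemma g_pos: "t \<le> T \<Longrightarrow> x \<in> space lam \<Longrightarrow> 0 < g t x"
  using g by (auto simp: positive_function_def)

lemma space_chi: "space chi = space lam"
  using sets_chi by (rule sets_eq_imp_space_eq)

lemma space_lam_nonempty: "space lam \<noteq> {}"
  using chi.not_empty by (simp add: space_chi)

text \<open>A transition density integrates to 1, impossible for a null reference measure. A
  starting point \<open>x\<close> exists because the space carries the probability
  \<open>chi\<close>.\<close>

lemma lam_nonzero: "emeasure lam (space lam) \<noteq> 0"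
proof
  assume 0: "emeasure lam (space lam) = 0"
  obtain x where x: "x \<in> space lam" using space_lam_nonempty by auto
  have "(\<integral>\<^sup>+y. ennreal (q x y) \<partial>lam) = 0"
    using 0 by (intro nn_integral_null_set[of "space lam", simplified, THEN trans[rotated]]) (auto intro: nn_integral_cong)
  then show False using q_mass[OF x] by simp
qed

text \<open>The unnormalised filtering distribution: path weights up to time \<open>t\<close>
  projected onto the last state, see \<open>path_integral_filter\<close>.\<close>

primrec filter_measure :: "nat \<Rightarrow> 'a measure" where
  "filter_measure 0 = density chi (\<lambda>x. ennreal (g 0 x))"
| "filter_measure (Suc t) = density lam (\<lambda>x. \<integral>\<^sup>+e. ennreal (q e x * g (Suc t) x) \<partial>filter_measure t)"

text \<open>The index counts remaining steps: \<open>future j\<close> is the backward function at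
  time \<open>T - j\<close>, collecting the factors \<open>q\<close> and \<open>g\<close> of the
  times \<open>T - j + 1\<close> to \<open>T\<close>.\<close>

primrec future :: "nat \<Rightarrow> 'a \<Rightarrow> ennreal" where
  "future 0 = (\<lambda>_. 1)"
| "future (Suc j) = (\<lambda>x. \<integral>\<^sup>+y. ennreal (q x y * g (T - j) y) * future j y \<partial>lam)"

lemma sets_filter_measure[simp, measurable_cong]: "sets (filter_measure t) = sets lam"
  by (cases t) (simp_all add: sets_chi)

lemma space_filter_measure[simp]: "space (filter_measure t) = space lam"
  by (rule sets_eq_imp_space_eq) simp

lemma future_measurable[measurable]: "future j \<in> borel_measurable lam"
proof (induction j)
  case (Suc j)
  note [measurable] = Suc.IH
  have [measurable]: "g (T - j) \<in> borel_measurable lam" by (rule g_measurable) simp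
  show ?case by simp
qed simp

text \<open>If the integral vanished, positivity of \<open>f\<close> would force \<open>q x\<close>
  to vanish almost everywhere, against its total mass 1.\<close>

lemma q_integral_pos:
  assumes f[measurable]: "f \<in> borel_measurable lam" and pos: "\<And>y. y \<in> space lam \<Longrightarrow> 0 < f y" and x: "x \<in> space lam"
  shows "0 < (\<integral>\<^sup>+y. ennreal (q x y) * f y \<partial>lam)"
proof (rule ccontr)
  have [measurable]: "q x \<in> borel_measurable lam" using x by (rule q_measurable2)
  assume "\<not> 0 < (\<integral>\<^sup>+y. ennreal (q x y) * f y \<partial>lam)"
  then have "AE y in lam. ennreal (q x y) * f y = 0" by (simp add: nn_integral_0_iff_AE)
  then have "AE y in lam. ennreal (q x y) = 0" using AE_space by eventually_elim (use pos in fastforce)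
  then have "(\<integral>\<^sup>+y. ennreal (q x y) \<partial>lam) = 0" by (simp add: nn_integral_0_iff_AE)
  then show False using q_mass[OF x] by simp
qed

lemma future_pos: "x \<in> space lam \<Longrightarrow> 0 < future j x"
proof (induction j arbitrary: x)
  case (Suc j)
  have [measurable]: "g (T - j) \<in> borel_measurable lam" by (rule g_measurable) simp
  have "0 < (\<integral>\<^sup>+y. ennreal (q x y) * (ennreal (g (T - j) y) * future j y) \<partial>lam)"
    using Suc g_pos[of "T - j"] by (intro q_integral_pos) (auto simp: ennreal_zero_less_mult_iff)
  also have "\<dots> = future (Suc j) x"
    using Suc.prems g_pos[of "T - j"] q_nonneg by (auto intro!: nn_integral_cong simp: ennreal_mult less_imp_le mult.assoc)
  finally show ?case .
qed simp

section \<open>Path integrals: removing coordinates from the end of a trajectory\<close>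

definition path_space :: "nat \<Rightarrow> (nat \<Rightarrow> 'a) measure" where
  "path_space t = (\<Pi>\<^sub>M u\<in>{0..t}. if u = 0 then chi else lam)"

definition path_weight :: "nat \<Rightarrow> (nat \<Rightarrow> 'a) \<Rightarrow> real" where
  "path_weight t x = g 0 (x 0) * (\<Prod>u=1..t. q (x (u - 1)) (x u) * g u (x u))"

sublocale paths: product_sigma_finite "\<lambda>u. if u = 0 then chi else lam"
  by (rule product_sigma_finite.intro) (simp add: lam.sigma_finite_measure_axioms chi.sigma_finite_measure_axioms)

lemma coordinate_measurable[measurable (raw)]: "u \<le> t \<Longrightarrow> (\<lambda>x. x u) \<in> path_space t \<rightarrow>\<^sub>M lam"
  using measurable_component_singleton[of u "{0..t}" "\<lambda>u. if u = 0 then chi else lam"]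
    measurable_cong_sets[OF refl sets_chi, of "path_space t"]
  by (cases "u = 0") (auto simp: path_space_def)

lemma path_weight_measurable: "t \<le> T \<Longrightarrow> path_weight t \<in> borel_measurable (path_space t)"
  unfolding path_weight_def
  by (intro borel_measurable_times borel_measurable_prod measurable_compose[OF coordinate_measurable g_measurable]
      measurable_compose[OF measurable_Pair[OF coordinate_measurable coordinate_measurable] q_measurable, simplified])
    auto

lemma path_coordinate: "x \<in> space (path_space t) \<Longrightarrow> u \<le> t \<Longrightarrow> x u \<in> space lam"
  using measurable_space[OF coordinate_measurable] by blast

lemma path_weight_nonneg: "t \<le> T \<Longrightarrow> x \<in> space (path_space t) \<Longrightarrow> 0 \<le> path_weight t x"
  unfolding path_weight_def
  by (intro mult_nonneg_nonneg prod_nonneg ballI)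
     (auto intro!: q_nonneg less_imp_le[OF g_pos] path_coordinate[of x t])

text \<open>Tonelli in the last coordinate, which occurs only in the last factor of
  \<open>path_weight\<close> and in \<open>H\<close>. Keeping \<open>F\<close> at an earlier time
  separate from \<open>H\<close> lets the step be iterated while the time \<open>s\<close> is
  preserved.\<close>

lemma path_integral_Suc:
  assumes t: "Suc t \<le> T" and s: "s \<le> t" and F: "F \<in> borel_measurable lam" and H: "H \<in> borel_measurable lam"
  shows "(\<integral>\<^sup>+x. ennreal (path_weight (Suc t) x) * F (x s) * H (x (Suc t)) \<partial>path_space (Suc t)) =
    (\<integral>\<^sup>+x. ennreal (path_weight t x) * F (x s) * (\<integral>\<^sup>+y. ennreal (q (x t) y * g (Suc t) y) * H y \<partial>lam) \<partial>path_space t)"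
proof -
  have ins: "{0..Suc t} = insert (Suc t) {0..t}" by auto
  have "(\<lambda>x. ennreal (path_weight (Suc t) x) * F (x s) * H (x (Suc t))) \<in> borel_measurable (path_space (Suc t))"
    using s t
    by (intro borel_measurable_times_ennreal measurable_compose[OF path_weight_measurable measurable_ennreal]
        measurable_compose[OF coordinate_measurable F] measurable_compose[OF coordinate_measurable H]) auto
  then have "(\<integral>\<^sup>+x. ennreal (path_weight (Suc t) x) * F (x s) * H (x (Suc t)) \<partial>path_space (Suc t)) =
    (\<integral>\<^sup>+x. (\<integral>\<^sup>+y. ennreal (path_weight (Suc t) (x(Suc t := y))) * F ((x(Suc t := y)) s) * H ((x(Suc t := y)) (Suc t))
       \<partial>(if Suc t = 0 then chi else lam)) \<partial>path_space t)"
    unfolding path_space_def ins by (intro paths.product_nn_integral_insert) auto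
  also have "\<dots> = (\<integral>\<^sup>+x. ennreal (path_weight t x) * F (x s) * (\<integral>\<^sup>+y. ennreal (q (x t) y * g (Suc t) y) * H y \<partial>lam) \<partial>path_space t)"
  proof (intro nn_integral_cong)
    fix x assume x: "x \<in> space (path_space t)"
    have xt: "x t \<in> space lam" using path_coordinate[OF x] by simp
    have pw: "path_weight (Suc t) (x(Suc t := y)) = path_weight t x * (q (x t) y * g (Suc t) y)" for y
    proof -
      have "{1..Suc t} = insert (Suc t) {1..t}" by auto
      moreover have "(\<Prod>u=1..t. q ((x(Suc t := y)) (u - 1)) ((x(Suc t := y)) u) * g u ((x(Suc t := y)) u)) =
          (\<Prod>u=1..t. q (x (u - 1)) (x u) * g u (x u))"
        by (intro prod.cong) auto
      ultimately show ?thesis by (simp add: path_weight_def)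
    qed
    have [measurable]: "q (x t) \<in> borel_measurable lam" "g (Suc t) \<in> borel_measurable lam"
      using xt t by (simp_all add: q_measurable2)
    have "(\<integral>\<^sup>+y. ennreal (path_weight (Suc t) (x(Suc t := y))) * F ((x(Suc t := y)) s) * H ((x(Suc t := y)) (Suc t)) \<partial>lam)
      = (\<integral>\<^sup>+y. (ennreal (path_weight t x) * F (x s)) * (ennreal (q (x t) y * g (Suc t) y) * H y) \<partial>lam)"
    proof (intro nn_integral_cong)
      fix y assume y: "y \<in> space lam"
      have "0 \<le> q (x t) y * g (Suc t) y"
        using q_nonneg[OF xt y] g_pos[OF t y] by simp
      then show "ennreal (path_weight (Suc t) (x(Suc t := y))) * F ((x(Suc t := y)) s) * H ((x(Suc t := y)) (Suc t)) =
        (ennreal (path_weight t x) * F (x s)) * (ennreal (q (x t) y * g (Suc t) y) * H y)"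
        unfolding pw ennreal_mult[OF path_weight_nonneg[OF Suc_leD[OF t] x] \<open>0 \<le> q (x t) y * g (Suc t) y\<close>]
        using s by (simp add: mult_ac)
    qed
    also have "\<dots> = ennreal (path_weight t x) * F (x s) * (\<integral>\<^sup>+y. ennreal (q (x t) y * g (Suc t) y) * H y \<partial>lam)"
      using H by (intro nn_integral_cmult) measurable
    finally show "(\<integral>\<^sup>+y. ennreal (path_weight (Suc t) (x(Suc t := y))) * F ((x(Suc t := y)) s) * H ((x(Suc t := y)) (Suc t))
        \<partial>(if Suc t = 0 then chi else lam)) =
      ennreal (path_weight t x) * F (x s) * (\<integral>\<^sup>+y. ennreal (q (x t) y * g (Suc t) y) * H y \<partial>lam)" by simp
  qed
  finally show ?thesis .
qed

lemma nn_integral_filter_measure_Suc: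
  assumes t: "Suc t \<le> T" and mu: "sigma_finite_measure (filter_measure t)" and H[measurable]: "H \<in> borel_measurable lam"
  shows "(\<integral>\<^sup>+x. H x \<partial>filter_measure (Suc t)) = (\<integral>\<^sup>+e. (\<integral>\<^sup>+y. ennreal (q e y * g (Suc t) y) * H y \<partial>lam) \<partial>filter_measure t)"
proof -
  interpret mu: sigma_finite_measure "filter_measure t" by fact
  interpret P: pair_sigma_finite "filter_measure t" lam ..
  have [measurable]: "g (Suc t) \<in> borel_measurable lam" using t by simp
  have "(\<integral>\<^sup>+x. H x \<partial>filter_measure (Suc t)) = (\<integral>\<^sup>+x. (\<integral>\<^sup>+e. ennreal (q e x * g (Suc t) x) \<partial>filter_measure t) * H x \<partial>lam)"
    unfolding filter_measure.simps by (rule nn_integral_density) measurable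
  also have "\<dots> = (\<integral>\<^sup>+x. (\<integral>\<^sup>+e. ennreal (q e x * g (Suc t) x) * H x \<partial>filter_measure t) \<partial>lam)"
  proof (intro nn_integral_cong nn_integral_multc[symmetric])
    fix x assume "x \<in> space lam"
    then show "(\<lambda>e. ennreal (q e x * g (Suc t) x)) \<in> borel_measurable (filter_measure t)" by measurable
  qed
  also have "\<dots> = (\<integral>\<^sup>+e. (\<integral>\<^sup>+y. ennreal (q e y * g (Suc t) y) * H y \<partial>lam) \<partial>filter_measure t)"
    by (rule P.Fubini') measurable
  finally show ?thesis .
qed

text \<open>Removing the last coordinate replaces \<open>H\<close> by its image under one kernel
  step, so the induction must run over all \<open>H\<close>. Sigma-finiteness of the earlier filter
  measures serves Tonelli.\<close>

lemma path_integral_filter: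
  assumes "t \<le> T" and "\<And>u. u < t \<Longrightarrow> sigma_finite_measure (filter_measure u)" and "H \<in> borel_measurable lam"
  shows "(\<integral>\<^sup>+x. ennreal (path_weight t x) * H (x t) \<partial>path_space t) = (\<integral>\<^sup>+x. H x \<partial>filter_measure t)"
  using assms
proof (induction t arbitrary: H)
  case 0
  have g0: "g 0 \<in> borel_measurable lam" by simp
  have m: "g 0 \<in> borel_measurable chi" "H \<in> borel_measurable chi"
    using g0 0 measurable_cong_sets[OF sets_chi refl] by blast+
  have "(\<integral>\<^sup>+x. ennreal (path_weight 0 x) * H (x 0) \<partial>path_space 0) =
      (\<integral>\<^sup>+x. (\<lambda>y. ennreal (g 0 y) * H y) (x 0) \<partial>(\<Pi>\<^sub>M u\<in>{0::nat}. if u = 0 then chi else lam))"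
    by (simp add: path_space_def path_weight_def)
  also have "\<dots> = (\<integral>\<^sup>+y. ennreal (g 0 y) * H y \<partial>chi)"
    using m by (subst paths.product_nn_integral_singleton) auto
  also have "\<dots> = (\<integral>\<^sup>+x. H x \<partial>filter_measure 0)"
    using m by (simp add: nn_integral_density)
  finally show ?case .
next
  case (Suc t)
  note [measurable] = Suc.prems(3)
  have [measurable]: "g (Suc t) \<in> borel_measurable lam" using Suc.prems by simp
  have "(\<integral>\<^sup>+x. ennreal (path_weight (Suc t) x) * H (x (Suc t)) \<partial>path_space (Suc t)) =
     (\<integral>\<^sup>+x. ennreal (path_weight (Suc t) x) * 1 * H (x (Suc t)) \<partial>path_space (Suc t))" by simp
  also have "\<dots> = (\<integral>\<^sup>+x. ennreal (path_weight t x) * 1 * (\<integral>\<^sup>+y. ennreal (q (x t) y * g (Suc t) y) * H y \<partial>lam) \<partial>path_space t)"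
    using Suc.prems by (intro path_integral_Suc[where F = "\<lambda>_. 1" and s = t]) auto
  also have "\<dots> = (\<integral>\<^sup>+x. ennreal (path_weight t x) * (\<lambda>e. \<integral>\<^sup>+y. ennreal (q e y * g (Suc t) y) * H y \<partial>lam) (x t) \<partial>path_space t)"
    by simp
  also have "\<dots> = (\<integral>\<^sup>+e. (\<integral>\<^sup>+y. ennreal (q e y * g (Suc t) y) * H y \<partial>lam) \<partial>filter_measure t)"
    using Suc.prems by (intro Suc.IH) auto
  also have "\<dots> = (\<integral>\<^sup>+x. H x \<partial>filter_measure (Suc t))"
    using Suc.prems by (intro nn_integral_filter_measure_Suc[symmetric]) auto
  finally show ?case .
qed

text \<open>Times after \<open>s\<close> are integrated out one by one; each step produces the next
  factor in the recursion of \<open>future\<close>.\<close>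

lemma path_integral_future:
  assumes F: "F \<in> borel_measurable lam"
  shows "s + j \<le> T \<Longrightarrow> (\<integral>\<^sup>+x. ennreal (path_weight T x) * F (x s) \<partial>path_space T) =
    (\<integral>\<^sup>+x. ennreal (path_weight (T - j) x) * F (x s) * future j (x (T - j)) \<partial>path_space (T - j))"
proof (induction j)
  case (Suc j)
  define t where "t = T - Suc j"
  have t: "T - j = Suc t" "Suc t \<le> T" "s \<le> t" using Suc.prems by (auto simp: t_def)
  have "(\<integral>\<^sup>+x. ennreal (path_weight T x) * F (x s) \<partial>path_space T) =
    (\<integral>\<^sup>+x. ennreal (path_weight (T - j) x) * F (x s) * future j (x (T - j)) \<partial>path_space (T - j))"
    using Suc by simp
  also have "\<dots> = (\<integral>\<^sup>+x. ennreal (path_weight t x) * F (x s) * (\<integral>\<^sup>+y. ennreal (q (x t) y * g (Suc t) y) * future j y \<partial>lam) \<partial>path_space t)"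
    unfolding t(1) by (rule path_integral_Suc[OF t(2,3) F future_measurable])
  finally show ?case using t by (simp add: t_def[symmetric])
qed simp

text \<open>The filter up to time \<open>s\<close>, reweighted by everything that follows;
  normalising it yields the marginal smoothing distribution.\<close>

definition smoothing_measure :: "nat \<Rightarrow> 'a measure" where
  "smoothing_measure s = density (filter_measure s) (future (T - s))"

lemma sets_smoothing_measure[simp, measurable_cong]: "sets (smoothing_measure s) = sets lam"
  by (simp add: smoothing_measure_def)

lemma space_smoothing_measure[simp]: "space (smoothing_measure s) = space lam"
  by (simp add: smoothing_measure_def)

text \<open>The image of the weighted path measure under the time-\<open>s\<close> coordinate is
  identified on sets by cutting the path at \<open>s\<close>. Bochner integrals then transfer by
  change of variables for every measurable function, with no splitting into positive and negative
  parts.\<close>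

lemma marginal_smoothing_eq_target:
  assumes s: "s \<le> T" and sf: "\<And>u. u < s \<Longrightarrow> sigma_finite_measure (filter_measure u)"
    and h: "h \<in> borel_measurable lam"
  shows "marginal_smoothing lam q g chi T s h = target (smoothing_measure s) h"
proof -
  let ?D = "density (path_space T) (\<lambda>x. ennreal (path_weight T x))"
  note pwm = path_weight_measurable[OF order_refl]
  have c: "(\<lambda>x. x s) \<in> path_space T \<rightarrow>\<^sub>M lam" using s by (rule coordinate_measurable)
  then have cD: "(\<lambda>x. x s) \<in> ?D \<rightarrow>\<^sub>M lam" by simp
  have law: "distr ?D lam (\<lambda>x. x s) = smoothing_measure s"
  proof (rule measure_eqI)
    fix A assume "A \<in> sets (distr ?D lam (\<lambda>x. x s))"
    then have A[measurable]: "A \<in> sets lam" by simp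
    have "emeasure (distr ?D lam (\<lambda>x. x s)) A = (\<integral>\<^sup>+x. indicator A x \<partial>distr ?D lam (\<lambda>x. x s))"
      by simp
    also have "\<dots> = (\<integral>\<^sup>+x. indicator A (x s) \<partial>?D)"
      by (rule nn_integral_distr[OF cD]) simp
    also have "\<dots> = (\<integral>\<^sup>+x. ennreal (path_weight T x) * indicator A (x s) \<partial>path_space T)"
      using pwm measurable_compose[OF c, of "indicator A" borel] by (intro nn_integral_density) auto
    also have "\<dots> = (\<integral>\<^sup>+x. ennreal (path_weight (T - (T - s)) x) * indicator A (x s) * future (T - s) (x (T - (T - s))) \<partial>path_space (T - (T - s)))"
      using s by (intro path_integral_future) auto
    also have "\<dots> = (\<integral>\<^sup>+x. ennreal (path_weight s x) * (\<lambda>y. indicator A y * future (T - s) y) (x s) \<partial>path_space s)"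
      using s by (simp add: mult.assoc)
    also have "\<dots> = (\<integral>\<^sup>+y. indicator A y * future (T - s) y \<partial>filter_measure s)"
      using s sf by (intro path_integral_filter) auto
    also have "\<dots> = emeasure (smoothing_measure s) A"
      unfolding smoothing_measure_def by (subst emeasure_density) (auto simp: mult.commute)
    finally show "emeasure (distr ?D lam (\<lambda>x. x s)) A = emeasure (smoothing_measure s) A" .
  qed simp
  have int: "path_integral lam q g chi T (\<lambda>x. f (x s)) = (\<integral>x. f x \<partial>smoothing_measure s)" if f: "f \<in> borel_measurable lam" for f
  proof -
    have fs: "(\<lambda>x. f (x s)) \<in> borel_measurable (path_space T)" using measurable_compose[OF c f] .
    have "(\<integral>x. f x \<partial>smoothing_measure s) = (\<integral>x. f (x s) \<partial>?D)"
      unfolding law[symmetric] by (rule integral_distr[OF cD f])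
    also have "\<dots> = (\<integral>x. path_weight T x *\<^sub>R f (x s) \<partial>path_space T)"
      using path_weight_nonneg[OF order_refl] by (intro integral_density fs pwm) auto
    finally show ?thesis by (simp add: path_integral_def path_weight_def path_space_def)
  qed
  show ?thesis
    unfolding marginal_smoothing_def int[OF h] target_def
    using int[of "\<lambda>_. 1"] by simp
qed

end

subsection \<open>Weights and particle events\<close>

lemma sup_norm_bound:
  assumes "sup_norm A f < \<infinity>"
  obtains K where "0 < K" "\<And>x. x \<in> A \<Longrightarrow> f x \<le> ennreal K"
proof
  \<comment> \<open>The \<open>+ 1\<close> keeps the bound positive when the supremum is 0.\<close>
  show "0 < enn2real (sup_norm A f) + 1" by (simp add: add_nonneg_pos)
  fix x assume "x \<in> A"
  then have "f x \<le> sup_norm A f" unfolding sup_norm_def by (rule SUP_upper)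
  also have "\<dots> = ennreal (enn2real (sup_norm A f))" using assms by (simp add: less_top[symmetric])
  also have "\<dots> \<le> ennreal (enn2real (sup_norm A f) + 1)" by (intro ennreal_leI) simp
  finally show "f x \<le> ennreal (enn2real (sup_norm A f) + 1)" .
qed

text \<open>
  Because of the convention \<open>c / 0 = \<infinity>\<close>, boundedness of the weight makes the target density
  vanish wherever the proposal does.
\<close>

lemma weight_times_proposal:
  assumes "0 \<le> a" "0 \<le> b" "ennreal a / ennreal b \<le> ennreal K"
  shows "enn2real (ennreal a / ennreal b) * b = a"
proof (cases "b = 0")
  case True
  have "a = 0"
  proof (rule ccontr)
    assume "a \<noteq> 0"
    then have "ennreal a / ennreal b = \<infinity>" using True assms(1) by (simp add: ennreal_divide_zero)
    then show False using assms(3) by (simp add: top_unique)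
  qed
  with True show ?thesis by simp
qed (use assms in \<open>simp add: divide_ennreal\<close>)

lemma concentrates_cong:
  assumes "\<And>i w. i \<in> J \<Longrightarrow> w \<in> space M \<Longrightarrow> W i w = W' i w"
  shows "concentrates M n J W X mu B C \<longleftrightarrow> concentrates M n J W' X mu B C"
proof -
  have "tail_bound M n B C (\<lambda>w. weighted_average J (\<lambda>i. W i w) (\<lambda>i. f (X i w)) - target mu f) \<longleftrightarrow>
    tail_bound M n B C (\<lambda>w. weighted_average J (\<lambda>i. W' i w) (\<lambda>i. f (X i w)) - target mu f)" for f
  proof -
    have eq: "weighted_average J (\<lambda>i. W i w) (\<lambda>i. f (X i w)) - target mu f =
        weighted_average J (\<lambda>i. W' i w) (\<lambda>i. f (X i w)) - target mu f" if "w \<in> space M" for w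
      using assms that by (simp add: weighted_average_def)
    then show ?thesis
      unfolding tail_bound_def by (simp cong: measurable_cong conj_cong)
  qed
  then show ?thesis by (simp add: concentrates_def)
qed

lemma concentrates_weaken:
  assumes "concentrates M n J W X mu B C" "B \<le> B'" "C' \<le> C" "0 \<le> B" "0 \<le> n"
  shows "concentrates M n J W X mu B' C'"
  using assms tail_bound_weaken unfolding concentrates_def by blast

lemma nn_integral_count_space_pair:
  assumes "finite J" "sigma_finite_measure L" "F \<in> borel_measurable (count_space J \<Otimes>\<^sub>M L)"
  shows "(\<integral>\<^sup>+y. F y \<partial>(count_space J \<Otimes>\<^sub>M L)) = (\<Sum>i\<in>J. \<integral>\<^sup>+x. F (i, x) \<partial>L)"
proof -
  interpret L: sigma_finite_measure L by fact
  have "(\<integral>\<^sup>+y. F y \<partial>(count_space J \<Otimes>\<^sub>M L)) = (\<integral>\<^sup>+i. (\<integral>\<^sup>+x. F (i, x) \<partial>L) \<partial>count_space J)"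
    by (rule L.nn_integral_fst[OF assms(3), symmetric])
  then show ?thesis using assms(1) by (simp add: nn_integral_count_space_finite)
qed

text \<open>A countable discrete component reduces joint measurability to its slices; applied twice,
  it handles the triples of the two-filter step.\<close>

lemma measurable_count_space_pair:
  assumes J: "countable J"
    and f: "\<And>i. i \<in> J \<Longrightarrow> (\<lambda>(w, x). f w (i, x)) \<in> R \<Otimes>\<^sub>M L \<rightarrow>\<^sub>M K"
  shows "(\<lambda>(w, y). f w y) \<in> R \<Otimes>\<^sub>M (count_space J \<Otimes>\<^sub>M L) \<rightarrow>\<^sub>M K"
proof -
  let ?S = "R \<Otimes>\<^sub>M (count_space J \<Otimes>\<^sub>M L)"
  have "(\<lambda>p. f (fst p) (i, snd (snd p))) \<in> ?S \<rightarrow>\<^sub>M K" if "i \<in> J" for i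
  proof -
    have "(\<lambda>p. (fst p, snd (snd p))) \<in> ?S \<rightarrow>\<^sub>M R \<Otimes>\<^sub>M L" by measurable
    from measurable_compose[OF this f[OF that]] show ?thesis by simp
  qed
  then have "(\<lambda>p. f (fst p) (fst (snd p), snd (snd p))) \<in> ?S \<rightarrow>\<^sub>M K"
    by (rule measurable_compose_countable'[where I = J and g = "\<lambda>p. fst (snd p)"]) (use J in measurable)
  then show ?thesis by (simp add: case_prod_beta')
qed

lemma sigma_finite_count_space_pair:
  assumes "countable J" "sigma_finite_measure L"
  shows "sigma_finite_measure (count_space J \<Otimes>\<^sub>M L)"
proof -
  interpret L: sigma_finite_measure L by fact
  interpret J: sigma_finite_measure "count_space J" using assms(1) by (rule sigma_finite_measure_count_space_countable)
  interpret pair_sigma_finite "count_space J" L ..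
  show ?thesis by unfold_locales
qed

text \<open>Resampling followed by mutation: a draw is an ancestor index with a new position, and
  integrating over the discrete index gives the mixture demanded by \<open>disint\<close>.\<close>

lemma (in importance_kernel) concentrates_propagated_mixture:
  fixes M :: "'w measure" and J :: "'i set"
  assumes M: "prob_space M"
    and R: "space R = space M" "sets R \<subseteq> sets M"
    and J: "finite J"
    and wt: "\<And>i. i \<in> J \<Longrightarrow> wt i \<in> borel_measurable R" "\<And>i w. i \<in> J \<Longrightarrow> w \<in> space M \<Longrightarrow> wt i w < \<infinity>"
    and X: "\<And>i. i \<in> J \<Longrightarrow> X i \<in> R \<rightarrow>\<^sub>M mu"
    and Y: "cond_iid M (sets R) N (count_space J \<Otimes>\<^sub>M L) (\<lambda>w (i, x). wt i w * ennreal (k (X i w) x)) (\<lambda>l w. (A l w, Y l w))"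
    and N: "N \<ge> 1"
    and conc: "concentrates M (real N) J (\<lambda>i w. enn2real (wt i w)) X mu B C" and B: "B \<ge> 0"
  shows "concentrates M (real N) {1..N} (\<lambda>l w. v (X (A l w) w) (Y l w)) Y propagated (4 + 4 * B) (rate C)"
proof -
  let ?S = "count_space J \<Otimes>\<^sub>M L"
  have kX: "(\<lambda>(w, x). k (X i w) x) \<in> borel_measurable (R \<Otimes>\<^sub>M L)" if "i \<in> J" for i
  proof -
    have "(\<lambda>p. (X i (fst p), snd p)) \<in> R \<Otimes>\<^sub>M L \<rightarrow>\<^sub>M mu \<Otimes>\<^sub>M L"
      using measurable_compose[OF measurable_fst X[OF that]] by (intro measurable_Pair) auto
    from measurable_compose[OF this k_measurable] show ?thesis by (simp add: case_prod_beta')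
  qed
  have "concentrates M (real N) {1..N} (\<lambda>l w. v (X (fst (A l w, Y l w)) w) (snd (A l w, Y l w))) (\<lambda>l w. snd (A l w, Y l w)) propagated (4 + 4 * B) (rate C)"
  proof (rule concentrates_propagated[where pos = "\<lambda>w y. X (fst y) w" and c = snd and R = R and S = ?S, OF M R _ _ Y J _ _ X _ _ _ N conc B])
    show "sigma_finite_measure ?S"
      using J L.sigma_finite_measure_axioms by (intro sigma_finite_count_space_pair countable_finite)
    show "(\<lambda>(w, y). case y of (i, x) \<Rightarrow> wt i w * ennreal (k (X i w) x)) \<in> borel_measurable (R \<Otimes>\<^sub>M ?S)"
    proof (rule measurable_count_space_pair)
      fix i assume i: "i \<in> J"
      show "(\<lambda>(w, x). case (i, x) of (i, x) \<Rightarrow> wt i w * ennreal (k (X i w) x)) \<in> borel_measurable (R \<Otimes>\<^sub>M L)"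
        using borel_measurable_times_ennreal[OF measurable_compose[OF measurable_fst wt(1)[OF i]]
          measurable_compose[OF kX[OF i] measurable_ennreal]]
        by (simp add: case_prod_beta')
    qed (use J in \<open>simp add: countable_finite\<close>)
    show "(\<lambda>(w, y). X (fst y) w) \<in> R \<Otimes>\<^sub>M ?S \<rightarrow>\<^sub>M mu"
    proof (rule measurable_count_space_pair)
      fix i assume i: "i \<in> J"
      show "(\<lambda>(w, x). X (fst (i, x)) w) \<in> R \<Otimes>\<^sub>M L \<rightarrow>\<^sub>M mu"
        using measurable_compose[OF measurable_fst X[OF i]] by (simp add: case_prod_beta')
    qed (use J in \<open>simp add: countable_finite\<close>)
    fix w and F :: "'e \<Rightarrow> 'x \<Rightarrow> ennreal" assume w: "w \<in> space M" and F: "(\<lambda>(e, x). F e x) \<in> borel_measurable (mu \<Otimes>\<^sub>M L)"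
    have Xw: "X i w \<in> space mu" if "i \<in> J" for i
      using measurable_space[OF X[OF that]] w R by simp
    have Fi: "F (X i w) \<in> borel_measurable L" "k (X i w) \<in> borel_measurable L" if "i \<in> J" for i
      using measurable_Pair2[OF F Xw[OF that]] measurable_Pair2[OF k_measurable Xw[OF that]] by simp_all
    have m: "(\<lambda>y. (case y of (i, x) \<Rightarrow> wt i w * ennreal (k (X i w) x)) * F (X (fst y) w) (snd y)) \<in> borel_measurable ?S"
    proof (rule measurable_pair_measure_countable1)
      show "countable J" using J by (rule countable_finite)
      fix i assume i: "i \<in> J"
      show "(\<lambda>x. (case (i, x) of (i, x) \<Rightarrow> wt i w * ennreal (k (X i w) x)) * F (X (fst (i, x)) w) (snd (i, x))) \<in> borel_measurable L"
        using Fi[OF i] by simp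
    qed
    have "(\<integral>\<^sup>+y. (case y of (i, x) \<Rightarrow> wt i w * ennreal (k (X i w) x)) * F (X (fst y) w) (snd y) \<partial>?S) =
      (\<Sum>i\<in>J. \<integral>\<^sup>+x. wt i w * (ennreal (k (X i w) x) * F (X i w) x) \<partial>L)"
      using nn_integral_count_space_pair[OF J L.sigma_finite_measure_axioms m] by (simp add: mult.assoc)
    also have "\<dots> = (\<Sum>i\<in>J. ennreal (enn2real (wt i w)) * (\<integral>\<^sup>+x. ennreal (k (X i w) x) * F (X i w) x \<partial>L))"
      using Fi wt(2)[OF _ w] by (intro sum.cong refl) (simp add: nn_integral_cmult)
    finally show "(\<integral>\<^sup>+y. (case y of (i, x) \<Rightarrow> wt i w * ennreal (k (X i w) x)) * F (X (fst y) w) (snd y) \<partial>?S) =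
      (\<Sum>i\<in>J. ennreal (enn2real (wt i w)) * (\<integral>\<^sup>+x. ennreal (k (X i w) x) * F (X i w) x \<partial>L))" .
  qed (use wt(1) in auto)
  then show ?thesis by (simp only: fst_conv snd_conv)
qed

section \<open>Sigma-fields generated by particles and ancestor indices\<close>

lemma particle_events_mono:
  assumes "U \<subseteq> U'" "V \<subseteq> V'"
  shows "particle_events M lam N xi I U V \<subseteq> particle_events M lam N xi I U' V'"
  unfolding particle_events_def
proof (rule Un_mono; rule subsetI; elim CollectE exE conjE)
  fix E u l B assume "E = {w\<in>space M. xi u l w \<in> B}" "u \<in> U" "l \<in> {1..N}" "B \<in> sets lam"
  then show "E \<in> {{w\<in>space M. xi u l w \<in> B} | u l B. u \<in> U' \<and> l \<in> {1..N} \<and> B \<in> sets lam}"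
    using assms(1) by (intro CollectI exI[of _ u] exI[of _ l] exI[of _ B]) auto
next
  fix E u l i assume "E = {w\<in>space M. I u l w = i}" "u \<in> V" "l \<in> {1..N}"
  then show "E \<in> {{w\<in>space M. I u l w = i} | u l i. u \<in> V' \<and> l \<in> {1..N}}"
    using assms(2) by (intro CollectI exI[of _ u] exI[of _ l] exI[of _ i]) auto
qed

lemma particle_events_sets:
  assumes "\<And>u l. u \<in> U \<Longrightarrow> l \<in> {1..N} \<Longrightarrow> xi u l \<in> M \<rightarrow>\<^sub>M lam"
    and "\<And>u l. u \<in> V \<Longrightarrow> l \<in> {1..N} \<Longrightarrow> I u l \<in> M \<rightarrow>\<^sub>M count_space {1..N}"
  shows "particle_events M lam N xi I U V \<subseteq> sets M"
proof
  fix E assume "E \<in> particle_events M lam N xi I U V"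
  then consider u l B where "E = {w\<in>space M. xi u l w \<in> B}" "u \<in> U" "l \<in> {1..N}" "B \<in> sets lam"
    | u l i where "E = {w\<in>space M. I u l w = i}" "u \<in> V" "l \<in> {1..N}"
    unfolding particle_events_def by blast
  then show "E \<in> sets M"
  proof cases
    case 1
    then show ?thesis using measurable_sets[OF assms(1), of u l B] by (simp add: vimage_def Int_def conj_commute)
  next
    case 2
    have I: "I u l \<in> M \<rightarrow>\<^sub>M count_space {1..N}" using assms(2) 2 by simp
    \<comment> \<open>An arbitrary \<open>i\<close> may lie outside the index range, in which case
      the event is empty.\<close>
    have "E = I u l -` ({i} \<inter> {1..N}) \<inter> space M"
      using measurable_space[OF I] 2 by auto
    then show ?thesis using measurable_sets[OF I, of "{i} \<inter> {1..N}"] by simp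
  qed
qed

text \<open>The generator \<open>G\<close> need only contain the relevant events, so the same fact
  serves the past of one filter and the joint past of both.\<close>

lemma particle_measurable:
  assumes G: "particle_events M lam N xi I U V \<subseteq> G" "G \<subseteq> sets M"
    and u: "u \<in> U" "l \<in> {1..N}" and xi: "xi u l \<in> M \<rightarrow>\<^sub>M lam"
  shows "xi u l \<in> sigma (space M) G \<rightarrow>\<^sub>M lam"
proof (rule measurableI)
  have G': "G \<subseteq> Pow (space M)" using G(2) sets.space_closed by blast
  show "xi u l w \<in> space lam" if "w \<in> space (sigma (space M) G)" for w
    using measurable_space[OF xi] that G' by simp
  fix B assume "B \<in> sets lam"
  then have "{w\<in>space M. xi u l w \<in> B} \<in> G" using G(1) u unfolding particle_events_def by blast
  then show "xi u l -` B \<inter> space (sigma (space M) G) \<in> sets (sigma (space M) G)"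
    using G' by (simp add: vimage_def Int_def conj_commute sigma_sets.Basic)
qed

lemma index_measurable:
  assumes G: "particle_events M lam N xi I U V \<subseteq> G" "G \<subseteq> sets M"
    and u: "u \<in> V" "l \<in> {1..N}" and I: "I u l \<in> M \<rightarrow>\<^sub>M count_space {1..N}"
  shows "I u l \<in> sigma (space M) G \<rightarrow>\<^sub>M count_space {1..N}"
proof -
  have G': "G \<subseteq> Pow (space M)" using G(2) sets.space_closed by blast
  have single: "{w\<in>space M. I u l w = i} \<in> sets (sigma (space M) G)" for i
  proof -
    have "{w\<in>space M. I u l w = i} \<in> G" using G(1) u unfolding particle_events_def by blast
    then show ?thesis using G' by (simp add: sigma_sets.Basic)
  qed
  show ?thesis
  proof (rule measurableI)
    show "I u l w \<in> space (count_space {1..N})" if "w \<in> space (sigma (space M) G)" for w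
      using measurable_space[OF I] that G' by simp
    fix A assume "A \<in> sets (count_space {1..N})"
    then have "finite A" by (auto intro: finite_subset)
    then have "(\<Union>i\<in>A. {w\<in>space M. I u l w = i}) \<in> sets (sigma (space M) G)"
      by (intro sets.finite_UN single) auto
    moreover have "I u l -` A \<inter> space (sigma (space M) G) = (\<Union>i\<in>A. {w\<in>space M. I u l w = i})"
      using G' by auto
    ultimately show "I u l -` A \<inter> space (sigma (space M) G) \<in> sets (sigma (space M) G)" by simp
  qed
qed

subsection \<open>Particle filters\<close>

lemma emeasure_density_space: "f \<in> borel_measurable M \<Longrightarrow> emeasure (density M f) (space M) = (\<integral>\<^sup>+x. f x \<partial>M)"
  by (auto simp: emeasure_density intro!: nn_integral_cong)

lemma transition_densityD:
  assumes "transition_density K L k"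
  shows "(\<lambda>(x, y). k x y) \<in> borel_measurable (K \<Otimes>\<^sub>M L)"
    and "\<And>x y. x \<in> space K \<Longrightarrow> y \<in> space L \<Longrightarrow> 0 \<le> k x y"
    and "\<And>x. x \<in> space K \<Longrightarrow> (\<integral>\<^sup>+y. ennreal (k x y) \<partial>L) = 1"
    and "\<And>x. x \<in> space K \<Longrightarrow> k x \<in> borel_measurable L"
  using assms by (auto simp: transition_density_def probability_density_def)

lemma nn_integral_cmult_transition_density:
  assumes "transition_density K L k" "x \<in> space K" "0 \<le> a"
  shows "(\<integral>\<^sup>+y. ennreal (a * k x y) \<partial>L) = ennreal a"
proof -
  have "(\<integral>\<^sup>+y. ennreal (a * k x y) \<partial>L) = (\<integral>\<^sup>+y. ennreal a * ennreal (k x y) \<partial>L)"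
    using assms transition_densityD(2)[OF assms(1,2)] by (intro nn_integral_cong) (simp add: ennreal_mult)
  also have "\<dots> = ennreal a"
    using transition_densityD(3,4)[OF assms(1,2)] by (subst nn_integral_cmult) auto
  finally show ?thesis .
qed

lemma density_cong_space:
  "(\<And>x. x \<in> space M \<Longrightarrow> f x = g x) \<Longrightarrow> density M f = density M g"
  unfolding density_def by (intro arg_cong2[where f = "measure_of (space M)"] refl ext nn_integral_cong) simp

lemma particle_events_reindex:
  "particle_events M lam N (\<lambda>n. xi (f n)) (\<lambda>n. I (f n)) U V = particle_events M lam N xi I (f ` U) (f ` V)"
    (is "?A = ?B")
proof
  show "?A \<subseteq> ?B"
    unfolding particle_events_def
    by (rule Un_mono; rule subsetI; elim CollectE exE conjE; intro CollectI exI conjI; (assumption | erule imageI))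
  show "?B \<subseteq> ?A"
    unfolding particle_events_def
    by (rule Un_mono; rule subsetI; elim CollectE exE conjE imageE; hypsubst; intro CollectI exI conjI; (assumption | rule refl))
qed

text \<open>In reversed time \<open>n = T - t\<close>, the backward past after \<open>s\<close>
  takes the forward form of a past before \<open>T - s\<close>. The index times start at 1 because
  the particles at time \<open>T\<close> have no ancestors.\<close>

lemma particle_events_reverse:
  fixes T :: nat
  assumes "s \<le> T"
  shows "particle_events M lam N (\<lambda>n. xi (T - n)) (\<lambda>n. I (T - n)) {0..<T - s} {1..<T - s} =
    particle_events M lam N xi I {s<..T} {s<..<T}"
proof -
  have "(\<lambda>n. T - n) ` {0..<T - s} = {s<..T}"
  proof (intro equalityI subsetI)
    fix x assume "x \<in> {s<..T}"
    then show "x \<in> (\<lambda>n. T - n) ` {0..<T - s}" by (intro image_eqI[of _ _ "T - x"]) auto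
  qed auto
  moreover have "(\<lambda>n. T - n) ` {1..<T - s} = {s<..<T}"
  proof (intro equalityI subsetI)
    fix x assume "x \<in> {s<..<T}"
    then show "x \<in> (\<lambda>n. T - n) ` {1..<T - s}" by (intro image_eqI[of _ _ "T - x"]) auto
  qed auto
  ultimately show ?thesis
    using particle_events_reindex[of M lam N xi "\<lambda>n. T - n" I] by simp
qed

text \<open>Common abstraction of the forward filter and the time-reversed backward filter:
  \<open>k (Suc n)\<close> includes the adjustment multiplier and \<open>mu n\<close> is the
  unnormalised limit. \<open>mass_Suc\<close> may presuppose that \<open>mu n\<close> is finite and
  nonzero, because both are established only along the induction; the backward instance uses the
  finiteness for Tonelli.\<close>

locale particle_model = L: sigma_finite_measure L + rho: prob_space rho
  for L rho :: "'a measure" +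
  fixes v0 :: "'a \<Rightarrow> ennreal" and k :: "nat \<Rightarrow> 'a \<Rightarrow> 'a \<Rightarrow> real" and v :: "nat \<Rightarrow> 'a \<Rightarrow> 'a \<Rightarrow> ennreal"
    and mu :: "nat \<Rightarrow> 'a measure" and T :: nat
  assumes sets_rho: "sets rho = sets L"
    and v0_measurable[measurable]: "v0 \<in> borel_measurable L"
    and v0_bound: "\<exists>K>0. \<forall>x\<in>space L. v0 x \<le> ennreal K"
    and v_measurable: "\<And>n. n < T \<Longrightarrow> (\<lambda>(e, x). v (Suc n) e x) \<in> borel_measurable (L \<Otimes>\<^sub>M L)"
    and v_bound: "\<And>n. n < T \<Longrightarrow> \<exists>K>0. \<forall>e\<in>space L. \<forall>x\<in>space L. v (Suc n) e x \<le> ennreal K"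
    and k_measurable: "\<And>n. n < T \<Longrightarrow> (\<lambda>(e, x). k (Suc n) e x) \<in> borel_measurable (L \<Otimes>\<^sub>M L)"
    and k_nonneg: "\<And>n e x. n < T \<Longrightarrow> e \<in> space L \<Longrightarrow> x \<in> space L \<Longrightarrow> 0 \<le> k (Suc n) e x"
    and k_mass: "\<And>n. n < T \<Longrightarrow> \<exists>K>0. \<forall>e\<in>space L. (\<integral>\<^sup>+x. ennreal (k (Suc n) e x) \<partial>L) \<le> ennreal K"
    and mu_0: "mu 0 = density rho v0"
    and mu_Suc: "\<And>n. n < T \<Longrightarrow>
      mu (Suc n) = density L (\<lambda>x. \<integral>\<^sup>+e. ennreal (enn2real (v (Suc n) e x) * k (Suc n) e x) \<partial>mu n)"
    and mass_0: "emeasure (mu 0) (space L) \<noteq> 0"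
    and mass_Suc: "\<And>n. n < T \<Longrightarrow> finite_measure (mu n) \<Longrightarrow> emeasure (mu n) (space L) \<noteq> 0 \<Longrightarrow>
      0 < (\<integral>\<^sup>+e. \<integral>\<^sup>+x. ennreal (enn2real (v (Suc n) e x) * k (Suc n) e x) \<partial>L \<partial>mu n)"
begin

definition particle_filter ::
  "nat \<Rightarrow> 'w measure \<Rightarrow> (nat \<Rightarrow> nat \<Rightarrow> 'w \<Rightarrow> 'a) \<Rightarrow> (nat \<Rightarrow> nat \<Rightarrow> 'w \<Rightarrow> nat) \<Rightarrow> (nat \<Rightarrow> nat \<Rightarrow> 'w \<Rightarrow> ennreal) \<Rightarrow> bool" where
  "particle_filter N M xi I wt \<longleftrightarrow>
     iid_sample M N rho (xi 0) \<and>
     (\<forall>l\<in>{1..N}. \<forall>w\<in>space M. wt 0 l w = v0 (xi 0 l w)) \<and>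
     (\<forall>n<T.
        cond_iid M (sigma_sets (space M) (particle_events M L N xi I {0..<Suc n} {1..<Suc n})) N
          (count_space {1..N} \<Otimes>\<^sub>M L)
          (\<lambda>w (i, x). wt n i w * ennreal (k (Suc n) (xi n i w) x))
          (\<lambda>l w. (I (Suc n) l w, xi (Suc n) l w)) \<and>
        (\<forall>l\<in>{1..N}. \<forall>w\<in>space M.
           wt (Suc n) l w = v (Suc n) (xi n (I (Suc n) l w) w) (xi (Suc n) l w)))"

lemma measurable_rho: "f \<in> L \<rightarrow>\<^sub>M K \<Longrightarrow> f \<in> rho \<rightarrow>\<^sub>M K"
  using measurable_cong_sets[OF sets_rho refl] by blast

lemma space_rho: "space rho = space L"
  using sets_rho by (rule sets_eq_imp_space_eq)

lemma sets_mu: "n \<le> T \<Longrightarrow> sets (mu n) = sets L"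
  by (cases n) (simp_all add: mu_0 mu_Suc sets_rho)

lemma space_mu: "n \<le> T \<Longrightarrow> space (mu n) = space L"
  using sets_mu by (rule sets_eq_imp_space_eq)

context
  fixes M :: "'w measure" and N xi I wt
  assumes M: "prob_space M" and filter: "particle_filter N M xi I wt"
begin

lemma filter_0: "iid_sample M N rho (xi 0)" "l \<in> {1..N} \<Longrightarrow> w \<in> space M \<Longrightarrow> wt 0 l w = v0 (xi 0 l w)"
  using filter unfolding particle_filter_def by blast+

lemma filter_Suc:
  assumes "n < T"
  shows "cond_iid M (sigma_sets (space M) (particle_events M L N xi I {0..<Suc n} {1..<Suc n})) N
          (count_space {1..N} \<Otimes>\<^sub>M L)
          (\<lambda>w (i, x). wt n i w * ennreal (k (Suc n) (xi n i w) x))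
          (\<lambda>l w. (I (Suc n) l w, xi (Suc n) l w))"
    and "l \<in> {1..N} \<Longrightarrow> w \<in> space M \<Longrightarrow> wt (Suc n) l w = v (Suc n) (xi n (I (Suc n) l w) w) (xi (Suc n) l w)"
  using filter assms unfolding particle_filter_def by blast+

lemma pair_measurable:
  "n < T \<Longrightarrow> l \<in> {1..N} \<Longrightarrow> (\<lambda>w. (I (Suc n) l w, xi (Suc n) l w)) \<in> M \<rightarrow>\<^sub>M count_space {1..N} \<Otimes>\<^sub>M L"
  using filter_Suc(1)[of n] unfolding cond_iid_def by blast

lemma index_measurable_M: "n < T \<Longrightarrow> l \<in> {1..N} \<Longrightarrow> I (Suc n) l \<in> M \<rightarrow>\<^sub>M count_space {1..N}"
  using measurable_compose[OF pair_measurable measurable_fst] by simp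

lemma particle_measurable_M:
  assumes "n \<le> T" "l \<in> {1..N}"
  shows "xi n l \<in> M \<rightarrow>\<^sub>M L"
proof (cases n)
  case 0
  interpret M: prob_space M by (rule M)
  have "xi 0 l \<in> M \<rightarrow>\<^sub>M rho"
    using filter_0(1) assms by (auto simp: iid_sample_def M.indep_vars_def)
  then show ?thesis unfolding 0 using measurable_cong_sets[OF refl sets_rho] by blast
next
  case (Suc m)
  then show ?thesis using measurable_compose[OF pair_measurable[of m] measurable_snd] assms by simp
qed

lemma events_subset:
  assumes "s \<le> Suc T"
  shows "particle_events M L N xi I {0..<s} {1..<s} \<subseteq> sets M"
proof (rule particle_events_sets)
  fix u l assume "u \<in> {1..<s}" "l \<in> {1..N}"
  then show "I u l \<in> M \<rightarrow>\<^sub>M count_space {1..N}"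
    using index_measurable_M[of "u - 1" l] assms by (cases u) auto
qed (use assms in \<open>auto intro!: particle_measurable_M\<close>)

text \<open>Weights are functions of particles and indices whose events lie in \<open>G\<close>; the
  random ancestor is handled by splitting over its finitely many values.\<close>

lemma weight_measurable:
  assumes G: "particle_events M L N xi I {0..<s} {1..<s} \<subseteq> G" "G \<subseteq> sets M"
    and n: "n < s" "n \<le> T" and l: "l \<in> {1..N}"
  shows "xi n l \<in> sigma (space M) G \<rightarrow>\<^sub>M L" and "wt n l \<in> borel_measurable (sigma (space M) G)"
proof -
  let ?R = "sigma (space M) G"
  have spR: "space ?R = space M" using G(2) sets.space_closed by (intro space_measure_of) blast
  have xi: "xi u l \<in> ?R \<rightarrow>\<^sub>M L" if "u \<le> n" "l \<in> {1..N}" for u l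
    using that n by (intro particle_measurable[OF G] particle_measurable_M) auto
  show "xi n l \<in> ?R \<rightarrow>\<^sub>M L" using l by (intro xi) auto
  show "wt n l \<in> borel_measurable ?R"
  proof (cases n)
    case 0
    have "(\<lambda>w. v0 (xi 0 l w)) \<in> borel_measurable ?R"
      using measurable_compose[OF xi v0_measurable] l by simp
    then show ?thesis unfolding 0 by (subst measurable_cong) (use filter_0(2) l spR in auto)
  next
    case (Suc m)
    then have m: "m < T" using n by simp
    have I: "I (Suc m) l \<in> ?R \<rightarrow>\<^sub>M count_space {1..N}"
      using n l Suc by (intro index_measurable[OF G] index_measurable_M) auto
    have "(\<lambda>w. v (Suc m) (xi m (I (Suc m) l w) w) (xi (Suc m) l w)) \<in> borel_measurable ?R"
    proof (rule measurable_compose_countable'[OF _ I])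
      fix i assume i: "i \<in> {1..N}"
      have "(\<lambda>w. (xi m i w, xi (Suc m) l w)) \<in> ?R \<rightarrow>\<^sub>M L \<Otimes>\<^sub>M L"
        using i l Suc by (intro measurable_Pair xi) auto
      from measurable_compose[OF this v_measurable[OF m]]
      show "(\<lambda>w. v (Suc m) (xi m i w) (xi (Suc m) l w)) \<in> borel_measurable ?R" by simp
    qed simp
    then show ?thesis unfolding Suc by (subst measurable_cong) (use filter_Suc(2)[OF m l] spR in auto)
  qed
qed

lemma weight_finite:
  assumes n: "n \<le> T" and l: "l \<in> {1..N}" and w: "w \<in> space M"
  shows "wt n l w < \<infinity>"
proof (cases n)
  case 0
  have "xi 0 l w \<in> space L" using measurable_space[OF particle_measurable_M[OF _ l] w] by simp
  then show ?thesis
    using v0_bound filter_0(2)[OF l w] unfolding 0 by (auto intro: le_less_trans)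
next
  case (Suc m)
  then have m: "m < T" using n by simp
  have I: "I (Suc m) l w \<in> {1..N}"
    using measurable_space[OF index_measurable_M[OF m l] w] by simp
  have "xi m (I (Suc m) l w) w \<in> space L" "xi (Suc m) l w \<in> space L"
    using measurable_space[OF particle_measurable_M[OF _ I] w] measurable_space[OF particle_measurable_M[OF _ l] w] m by auto
  moreover obtain K where "\<forall>e\<in>space L. \<forall>x\<in>space L. v (Suc m) e x \<le> ennreal K"
    using v_bound[OF m] by blast
  ultimately have "wt (Suc m) l w \<le> ennreal K"
    using filter_Suc(2)[OF m l w] by simp
  then show ?thesis unfolding Suc by (auto intro: le_less_trans)
qed

end

text \<open>Finiteness and nonvanishing of \<open>mu n\<close> travel with the deviation bound
  because the next importance sampling step requires them. \<open>B\<close> and \<open>C\<close> are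
  quantified before the probability space and the filter, so they depend on the model alone.\<close>

lemma particle_filter_concentrates:
  "n \<le> T \<Longrightarrow> finite_measure (mu n) \<and> emeasure (mu n) (space L) \<noteq> 0 \<and>
    (\<exists>B C. 0 \<le> B \<and> 0 < C \<and> (\<forall>(M :: 'w measure) N xi I wt. prob_space M \<longrightarrow> 1 \<le> N \<longrightarrow>
       particle_filter N M xi I wt \<longrightarrow>
       concentrates M (real N) {1..N} (\<lambda>l w. enn2real (wt n l w)) (xi n) (mu n) B C))"
proof (induction n)
  case 0
  let ?v = "\<lambda>x. enn2real (v0 x)"
  obtain K where K: "0 < K" "\<And>x. x \<in> space L \<Longrightarrow> v0 x \<le> ennreal K"
    using v0_bound by blast
  have v: "ennreal (?v x) = v0 x" if "x \<in> space L" for x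
    using K(2)[OF that] by (subst ennreal_enn2real) (auto simp: le_less_trans)
  have vm: "?v \<in> borel_measurable rho" "v0 \<in> borel_measurable rho"
    by (intro borel_measurable_enn2real measurable_rho v0_measurable)+
  have dens: "density rho (\<lambda>x. ennreal (?v x)) = mu 0"
    unfolding mu_0 using v vm by (intro density_cong AE_I2) (auto simp: space_rho)
  have mass: "emeasure (mu 0) (space L) = (\<integral>\<^sup>+x. ennreal (?v x) \<partial>rho)"
    unfolding dens[symmetric] space_rho[symmetric] using vm by (intro emeasure_density_space) auto
  have pos: "0 < (\<integral>\<^sup>+x. ennreal (?v x) \<partial>rho)"
    using mass_0 unfolding mass by (simp add: zero_less_iff_neq_zero)
  have range: "0 \<le> ?v x \<and> ?v x \<le> K" if "x \<in> space rho" for x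
    using K that by (auto simp: space_rho intro!: enn2real_leI)
  obtain C where C: "0 < C"
    "\<And>(M :: 'w measure) N Y. prob_space M \<Longrightarrow> N \<ge> 1 \<Longrightarrow> iid_sample M N rho Y \<Longrightarrow>
      concentrates M (real N) {1..N} (\<lambda>l w. ?v (Y l w)) Y (mu 0) 4 C"
    using concentrates_iid_sample[OF rho.prob_space_axioms vm(1) range K(1) pos] unfolding dens by metis
  have "(\<integral>\<^sup>+x. ennreal (?v x) \<partial>rho) \<le> (\<integral>\<^sup>+x. ennreal K \<partial>rho)"
    using range by (intro nn_integral_mono ennreal_leI) auto
  also have "\<dots> = ennreal K"
    by (simp only: nn_integral_const rho.emeasure_space_1 mult_1_right)
  finally have "emeasure (mu 0) (space (mu 0)) \<noteq> \<infinity>"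
    unfolding space_mu[OF le0] mass by (auto simp: top_unique)
  then have "finite_measure (mu 0)" by (rule finite_measureI)
  moreover have "concentrates M (real N) {1..N} (\<lambda>l w. enn2real (wt 0 l w)) (xi 0) (mu 0) 4 C"
    if M: "prob_space M" and N: "1 \<le> N" and pf: "particle_filter N M xi I wt" for M :: "'w measure" and N xi I wt
    using C(2)[OF M N filter_0(1)[OF M pf]] filter_0(2)[OF M pf]
    by (subst concentrates_cong[where W' = "\<lambda>l w. ?v (xi 0 l w)"]) auto
  ultimately show ?case using C(1) mass_0 by (intro conjI exI[of _ 4] exI[of _ C]) auto
next
  case (Suc n)
  have n: "n < T" "n \<le> T" using Suc.prems by auto
  obtain B C where BC: "0 \<le> B" "0 < C" and conc: "\<And>(M :: 'w measure) N xi I wt. prob_space M \<Longrightarrow> 1 \<le> N \<Longrightarrow>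
       particle_filter N M xi I wt \<Longrightarrow>
       concentrates M (real N) {1..N} (\<lambda>l w. enn2real (wt n l w)) (xi n) (mu n) B C"
    using Suc.IH[OF n(2)] by blast
  interpret mu: finite_measure "mu n" using Suc.IH[OF n(2)] by blast
  have [measurable_cong]: "sets (mu n) = sets L" and sp: "space (mu n) = space L"
    using n by (simp_all add: sets_mu space_mu)
  note v_measurable[OF n(1), measurable] k_measurable[OF n(1), measurable]
  obtain Kv where Kv: "0 < Kv" "\<And>e x. e \<in> space L \<Longrightarrow> x \<in> space L \<Longrightarrow> v (Suc n) e x \<le> ennreal Kv"
    using v_bound[OF n(1)] by blast
  obtain Kt where Kt: "0 < Kt" "\<And>e. e \<in> space L \<Longrightarrow> (\<integral>\<^sup>+x. ennreal (k (Suc n) e x) \<partial>L) \<le> ennreal Kt"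
    using k_mass[OF n(1)] by blast
  interpret K: importance_kernel L "mu n" "k (Suc n)" "\<lambda>e x. enn2real (v (Suc n) e x)" Kv Kt
  proof
    show "(\<lambda>(e, x). k (Suc n) e x) \<in> borel_measurable (mu n \<Otimes>\<^sub>M L)" by measurable
    show "(\<lambda>(e, x). enn2real (v (Suc n) e x)) \<in> borel_measurable (mu n \<Otimes>\<^sub>M L)" by measurable
    show "0 < (\<integral>\<^sup>+e. \<integral>\<^sup>+x. ennreal (enn2real (v (Suc n) e x) * k (Suc n) e x) \<partial>L \<partial>mu n)"
      using Suc.IH[OF n(2)] by (intro mass_Suc n(1)) blast+
  qed (use Kv Kt k_nonneg[OF n(1)] sp in \<open>auto intro!: enn2real_leI\<close>)
  have propagated: "K.propagated = mu (Suc n)"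
    unfolding K.propagated_def mu_Suc[OF n(1)] ..
  \<comment> \<open>Each step maps \<open>B\<close> to \<open>4 + 4 * B\<close> and \<open>C\<close>
    to \<open>K.rate C\<close>, starting from prefactor 4.\<close>
  have "concentrates M (real N) {1..N} (\<lambda>l w. enn2real (wt (Suc n) l w)) (xi (Suc n)) (mu (Suc n)) (4 + 4 * B) (K.rate C)"
    if M: "prob_space M" and N: "1 \<le> N" and pf: "particle_filter N M xi I wt" for M :: "'w measure" and N xi I wt
  proof -
    let ?G = "particle_events M L N xi I {0..<Suc n} {1..<Suc n}"
    let ?R = "sigma (space M) ?G"
    have G: "?G \<subseteq> sets M" using Suc.prems by (intro events_subset[OF M pf]) simp
    have G': "?G \<subseteq> Pow (space M)" using G sets.space_closed by blast
    have R: "space ?R = space M" "sets ?R = sigma_sets (space M) ?G" using G' by auto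
    have "concentrates M (real N) {1..N} (\<lambda>l w. enn2real (v (Suc n) (xi n (I (Suc n) l w) w) (xi (Suc n) l w))) (xi (Suc n))
        K.propagated (4 + 4 * B) (K.rate C)"
    proof (rule K.concentrates_propagated_mixture[OF M, where R = ?R and J = "{1..N}" and wt = "wt n"])
      show "sets ?R \<subseteq> sets M" unfolding R(2) using G by (rule sets.sigma_sets_subset)
      fix i assume i: "i \<in> {1..N}"
      show "wt n i \<in> borel_measurable ?R"
        using n i by (intro weight_measurable(2)[OF M pf order_refl G]) auto
      show "wt n i w < \<infinity>" if "w \<in> space M" for w
        by (rule weight_finite[OF M pf n(2) i that])
      have "xi n i \<in> ?R \<rightarrow>\<^sub>M L"
        using n i by (intro weight_measurable(1)[OF M pf order_refl G]) auto
      then show "xi n i \<in> ?R \<rightarrow>\<^sub>M mu n" by (simp cong: measurable_cong_sets)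
    next
      show "cond_iid M (sets ?R) N (count_space {1..N} \<Otimes>\<^sub>M L)
         (\<lambda>w (i, x). wt n i w * ennreal (k (Suc n) (xi n i w) x)) (\<lambda>l w. (I (Suc n) l w, xi (Suc n) l w))"
        unfolding R(2) by (rule filter_Suc(1)[OF M pf n(1)])
    qed (use R(1) N BC(1) conc[OF M N pf] in auto)
    then show ?thesis
      unfolding propagated using filter_Suc(2)[OF M pf n(1)]
      by (subst concentrates_cong[where W' = "\<lambda>l w. enn2real (v (Suc n) (xi n (I (Suc n) l w) w) (xi (Suc n) l w))"]) auto
  qed
  moreover have "finite_measure (mu (Suc n))" "0 < measure (mu (Suc n)) (space (mu (Suc n)))"
    using K.finite_measure_propagated K.measure_propagated_pos unfolding propagated by blast+
  moreover from this have "emeasure (mu (Suc n)) (space L) \<noteq> 0"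
    unfolding space_mu[OF Suc.prems, symmetric] by (auto simp: measure_def)
  ultimately show ?case
    using BC K.rate_pos[of C] by (intro conjI exI[of _ "4 + 4 * B"] exI[of _ "K.rate C"]) auto
qed

end

section \<open>The two filters of the model as instances of the generic particle filter\<close>

locale two_filter_model = hidden_markov lam chi q g T
  for lam chi :: "'a measure" and q g T +
  fixes rho0 :: "'a measure" and D :: "'a \<Rightarrow> ennreal"
    and gamma th thb :: "nat \<Rightarrow> 'a \<Rightarrow> real"
    and p r tht :: "nat \<Rightarrow> 'a \<Rightarrow> 'a \<Rightarrow> real"
    and rt :: "nat \<Rightarrow> 'a \<times> 'a \<Rightarrow> 'a \<Rightarrow> real"
    and rhoT :: "'a \<Rightarrow> real"
  assumes gamma: "\<forall>t\<in>{0..T}. positive_function lam (gamma t)"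
    and rho0: "prob_space rho0" "sets rho0 = sets lam" "D \<in> borel_measurable rho0" "density rho0 D = chi"
    and forward: "\<forall>t\<in>{1..T}. nonneg_function lam (th t)"
      "\<forall>t\<in>{1..T}. transition_density lam lam (p t)"
    and backward: "probability_density lam rhoT"
      "\<forall>t\<in>{0..<T}. nonneg_function lam (thb t)"
      "\<forall>t\<in>{0..<T}. transition_density lam lam (r t)"
    and two_filter: "\<forall>t\<in>{1..<T}. nonneg_function (lam \<Otimes>\<^sub>M lam) (\<lambda>(x, x'). tht t x x')"
      "\<forall>t\<in>{1..<T}. transition_density (lam \<Otimes>\<^sub>M lam) lam (rt t)"
    and forward_bounds: "sup_norm (space lam) (fwd_weight_init D g) < \<infinity>"
      "\<forall>t\<in>{1..T}. sup_norm (space lam \<times> space lam) (\<lambda>(x, x'). fwd_weight q g th p t x x') < \<infinity>"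
      "\<forall>t\<in>{1..T}. sup_norm (space lam) (\<lambda>x. ennreal (th t x)) < \<infinity>"
    and backward_bounds: "\<forall>t\<in>{0..<T}. sup_norm (space lam) (\<lambda>x. ennreal (thb t x / gamma (t + 1) x)) < \<infinity>"
      "sup_norm (space lam) (bwd_weight_init g gamma rhoT T) < \<infinity>"
      "\<forall>t\<in>{0..<T}. sup_norm (space lam \<times> space lam)
                     (\<lambda>(x, x'). bwd_weight q g gamma thb r t x x') < \<infinity>"
    and two_filter_bounds: "\<forall>t\<in>{1..<T}. sup_norm (space lam \<times> space lam)
                     (\<lambda>(x, x'). ennreal (tht t x x' / gamma (t + 1) x')) < \<infinity>"
      "\<forall>t\<in>{1..<T}. sup_norm (space lam \<times> space lam \<times> space lam)
                     (\<lambda>(x, x', x''). two_filter_weight q g tht rt t x x' x'') < \<infinity>"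
begin

lemma gamma_measurable[measurable]: "t \<le> T \<Longrightarrow> gamma t \<in> borel_measurable lam"
  using gamma by (auto simp: positive_function_def)

lemma gamma_pos: "t \<le> T \<Longrightarrow> x \<in> space lam \<Longrightarrow> 0 < gamma t x"
  using gamma by (auto simp: positive_function_def)

lemma bounded_weight_ex:
  assumes "sup_norm (A \<times> B) (\<lambda>(x, y). f x y) < \<infinity>"
  shows "\<exists>K>0. \<forall>x\<in>A. \<forall>y\<in>B. f x y \<le> ennreal K"
  using assms by (rule sup_norm_bound) auto

text \<open>Multiplier and proposal cancel, so the kernel driving the limit recursion is the model
  transition \<open>q * g\<close>, whatever the proposal.\<close>

lemma fwd_weight_times_proposal:
  assumes t: "t \<in> {1..T}" and x: "e \<in> space lam" "x \<in> space lam"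
  shows "enn2real (fwd_weight q g th p t e x) * (th t e * p t e x) = q e x * g t x"
proof -
  obtain K where "fwd_weight q g th p t e x \<le> ennreal K"
    using bounded_weight_ex[OF forward_bounds(2)[rule_format, OF t]] x by blast
  moreover have "0 \<le> th t e" "0 \<le> p t e x" "0 \<le> q e x" "0 < g t x"
    using forward(1) t x q_nonneg g_pos transition_densityD(2)[OF forward(2)[rule_format, OF t]] by (auto simp: nonneg_function_def)
  ultimately show ?thesis
    unfolding fwd_weight_def by (intro weight_times_proposal) auto
qed

text \<open>Once the proposals cancel, the required recursion is the definition of
  \<open>filter_measure\<close>. At time 0 the density \<open>D\<close> turns the sampling law
  \<open>rho0\<close> into \<open>chi\<close>.\<close>

sublocale fwd: particle_model lam rho0 "fwd_weight_init D g" "\<lambda>t e x. th t e * p t e x" "fwd_weight q g th p" filter_measure T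
proof (rule particle_model.intro[OF lam.sigma_finite_measure_axioms rho0(1)], unfold_locales)
  show "sets rho0 = sets lam" by (rule rho0(2))
  have D[measurable]: "D \<in> borel_measurable lam"
    using rho0(3) measurable_cong_sets[OF rho0(2) refl] by blast
  have g0: "(\<lambda>x. ennreal (g 0 x)) \<in> borel_measurable lam" by simp
  then have g0': "(\<lambda>x. ennreal (g 0 x)) \<in> borel_measurable rho0" "(\<lambda>x. ennreal (g 0 x)) \<in> borel_measurable chi"
    using measurable_cong_sets[OF rho0(2) refl] measurable_cong_sets[OF sets_chi refl] by blast+
  show "fwd_weight_init D g \<in> borel_measurable lam"
    unfolding fwd_weight_init_def by measurable
  show "\<exists>K>0. \<forall>x\<in>space lam. fwd_weight_init D g x \<le> ennreal K"
    using forward_bounds(1) by (rule sup_norm_bound) auto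
  show "filter_measure 0 = density rho0 (fwd_weight_init D g)"
    using density_density_eq[OF rho0(3) g0'(1)] unfolding fwd_weight_init_def[abs_def] filter_measure.simps rho0(4) by simp
  have "0 < (\<integral>\<^sup>+x. ennreal (g 0 x) \<partial>chi)"
    using g_pos[of 0] g0'(2) chi.emeasure_space_1 by (intro nn_integral_pos) (auto simp: space_chi)
  then show "emeasure (filter_measure 0) (space lam) \<noteq> 0"
    using emeasure_density_space[OF g0'(2)] by (simp add: space_chi)
  fix n assume "n < T"
  then have t: "Suc n \<in> {1..T}" "Suc n \<le> T" by auto
  note pd = transition_densityD[OF forward(2)[rule_format, OF t(1)]]
  have [measurable]: "th (Suc n) \<in> borel_measurable lam" and th0: "\<And>x. x \<in> space lam \<Longrightarrow> 0 \<le> th (Suc n) x"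
    using forward(1) t by (auto simp: nonneg_function_def)
  have [measurable]: "g (Suc n) \<in> borel_measurable lam" using t by simp
  note pd(1)[measurable]
  show "(\<lambda>(e, x). fwd_weight q g th p (Suc n) e x) \<in> borel_measurable (lam \<Otimes>\<^sub>M lam)"
    unfolding fwd_weight_def by measurable
  show "(\<lambda>(e, x). th (Suc n) e * p (Suc n) e x) \<in> borel_measurable (lam \<Otimes>\<^sub>M lam)" by measurable
  show "\<exists>K>0. \<forall>e\<in>space lam. \<forall>x\<in>space lam. fwd_weight q g th p (Suc n) e x \<le> ennreal K"
    by (rule bounded_weight_ex[OF forward_bounds(2)[rule_format, OF t(1)]])
  show "0 \<le> th (Suc n) e * p (Suc n) e x" if "e \<in> space lam" "x \<in> space lam" for e x
    using th0 pd(2) that by simp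
  obtain K where "0 < K" "\<And>x. x \<in> space lam \<Longrightarrow> ennreal (th (Suc n) x) \<le> ennreal K"
    using forward_bounds(3)[rule_format, OF t(1)] by (rule sup_norm_bound) blast
  then show "\<exists>K>0. \<forall>e\<in>space lam. (\<integral>\<^sup>+x. ennreal (th (Suc n) e * p (Suc n) e x) \<partial>lam) \<le> ennreal K"
    using nn_integral_cmult_transition_density[OF forward(2)[rule_format, OF t(1)]] th0 by auto
  show "filter_measure (Suc n) = density lam (\<lambda>x. \<integral>\<^sup>+e. ennreal (enn2real (fwd_weight q g th p (Suc n) e x) *
      (th (Suc n) e * p (Suc n) e x)) \<partial>filter_measure n)"
    unfolding filter_measure.simps
    by (intro density_cong_space nn_integral_cong) (simp add: fwd_weight_times_proposal[OF t(1)])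
  assume mu: "emeasure (filter_measure n) (space lam) \<noteq> 0"
  have "0 < (\<integral>\<^sup>+e. \<integral>\<^sup>+x. ennreal (q e x * g (Suc n) x) \<partial>lam \<partial>filter_measure n)"
  proof (rule nn_integral_pos)
    show "(\<lambda>e. \<integral>\<^sup>+x. ennreal (q e x * g (Suc n) x) \<partial>lam) \<in> borel_measurable (filter_measure n)" by measurable
    show "emeasure (filter_measure n) (space (filter_measure n)) \<noteq> 0" using mu by simp
    fix e assume "e \<in> space (filter_measure n)"
    then have e: "e \<in> space lam" by simp
    have "0 < (\<integral>\<^sup>+x. ennreal (q e x) * ennreal (g (Suc n) x) \<partial>lam)"
      using g_pos[OF t(2)] e by (intro q_integral_pos) auto
    also have "\<dots> = (\<integral>\<^sup>+x. ennreal (q e x * g (Suc n) x) \<partial>lam)"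
      using q_nonneg e g_pos[OF t(2)] by (intro nn_integral_cong) (simp add: ennreal_mult less_imp_le)
    finally show "0 < (\<integral>\<^sup>+x. ennreal (q e x * g (Suc n) x) \<partial>lam)" .
  qed
  also have "\<dots> = (\<integral>\<^sup>+e. \<integral>\<^sup>+x. ennreal (enn2real (fwd_weight q g th p (Suc n) e x) *
      (th (Suc n) e * p (Suc n) e x)) \<partial>lam \<partial>filter_measure n)"
    by (intro nn_integral_cong) (simp add: fwd_weight_times_proposal[OF t(1)])
  finally show "0 < \<dots>" .
qed

lemma forward_filter_particle_filter:
  assumes "forward_filter lam q g rho0 D th p T N M xi I wt"
  shows "fwd.particle_filter N M xi I wt"
  unfolding fwd.particle_filter_def
proof (intro conjI allI impI)
  fix n assume "n < T"
  then have n: "Suc n \<in> {1..T}" by simp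
  have "\<forall>s\<in>{1..T}.
      cond_iid M (sigma_sets (space M) (particle_events M lam N xi I {0..<s} {1..<s})) N
        (count_space {1..N} \<Otimes>\<^sub>M lam)
        (\<lambda>w (i, x). wt (s - 1) i w * ennreal (th s (xi (s - 1) i w) * p s (xi (s - 1) i w) x))
        (\<lambda>l w. (I s l w, xi s l w)) \<and>
      (\<forall>l\<in>{1..N}. \<forall>w\<in>space M. wt s l w = fwd_weight q g th p s (xi (s - 1) (I s l w) w) (xi s l w))"
    using assms unfolding forward_filter_def by blast
  from bspec[OF this n]
  show "cond_iid M (sigma_sets (space M) (particle_events M lam N xi I {0..<Suc n} {1..<Suc n})) N
      (count_space {1..N} \<Otimes>\<^sub>M lam)
      (\<lambda>w (i, x). wt n i w * ennreal (th (Suc n) (xi n i w) * p (Suc n) (xi n i w) x))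
      (\<lambda>l w. (I (Suc n) l w, xi (Suc n) l w))"
    "\<forall>l\<in>{1..N}. \<forall>w\<in>space M. wt (Suc n) l w = fwd_weight q g th p (Suc n) (xi n (I (Suc n) l w) w) (xi (Suc n) l w)"
    unfolding diff_Suc_1 by blast+
qed (use assms in \<open>simp_all add: forward_filter_def\<close>)

text \<open>The limit of the backward filter: the artificial density \<open>gamma t\<close> times
  the contribution of the times \<open>t\<close> to \<open>T\<close> started from the given
  state.\<close>

definition backward_measure :: "nat \<Rightarrow> 'a measure" where
  "backward_measure t = density lam (\<lambda>x. ennreal (gamma t x * g t x) * future (T - t) x)"

lemma sets_backward_measure[simp, measurable_cong]: "sets (backward_measure t) = sets lam"
  by (simp add: backward_measure_def)

lemma space_backward_measure[simp]: "space (backward_measure t) = space lam"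
  by (simp add: backward_measure_def)

text \<open>Division by \<open>gamma (Suc t)\<close> removes the artificial density; what remains is
  one step of \<open>future\<close>, with \<open>Suc (T - Suc t) = T - t\<close>.\<close>

lemma nn_integral_backward_measure:
  assumes t: "t < T" and x: "x \<in> space lam"
  shows "(\<integral>\<^sup>+e. ennreal (q x e / gamma (Suc t) e) \<partial>backward_measure (Suc t)) = future (T - t) x"
proof -
  have [measurable]: "g (Suc t) \<in> borel_measurable lam" "gamma (Suc t) \<in> borel_measurable lam" "q x \<in> borel_measurable lam"
    using t x by (simp_all add: q_measurable2)
  have "(\<integral>\<^sup>+e. ennreal (q x e / gamma (Suc t) e) \<partial>backward_measure (Suc t)) =
      (\<integral>\<^sup>+e. (ennreal (gamma (Suc t) e * g (Suc t) e) * future (T - Suc t) e) * ennreal (q x e / gamma (Suc t) e) \<partial>lam)"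
    unfolding backward_measure_def by (rule nn_integral_density) measurable
  also have "\<dots> = (\<integral>\<^sup>+e. ennreal (q x e * g (Suc t) e) * future (T - Suc t) e \<partial>lam)"
  proof (intro nn_integral_cong)
    fix e assume e: "e \<in> space lam"
    have p: "0 < gamma (Suc t) e" "0 < g (Suc t) e" "0 \<le> q x e"
      using t e x gamma_pos g_pos q_nonneg by auto
    have "(ennreal (gamma (Suc t) e * g (Suc t) e) * future (T - Suc t) e) * ennreal (q x e / gamma (Suc t) e) =
        ennreal (gamma (Suc t) e * g (Suc t) e) * ennreal (q x e / gamma (Suc t) e) * future (T - Suc t) e"
      by (simp add: mult_ac)
    also have "ennreal (gamma (Suc t) e * g (Suc t) e) * ennreal (q x e / gamma (Suc t) e) = ennreal (q x e * g (Suc t) e)"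
      using p by (simp add: ennreal_mult[symmetric] field_simps)
    finally show "(ennreal (gamma (Suc t) e * g (Suc t) e) * future (T - Suc t) e) * ennreal (q x e / gamma (Suc t) e) =
      ennreal (q x e * g (Suc t) e) * future (T - Suc t) e" .
  qed
  also have "\<dots> = future (Suc (T - Suc t)) x" using t by simp
  finally show ?thesis using t by (simp add: Suc_diff_Suc del: future.simps)
qed

text \<open>The proposal cancels as in the forward case. The remaining divisor
  \<open>gamma (Suc t) e\<close> comes from the sampling density and not from the weight.\<close>

lemma bwd_weight_times_proposal:
  assumes t: "t < T" and x: "e \<in> space lam" "x \<in> space lam"
  shows "enn2real (bwd_weight q g gamma thb r t x e) * (thb t e / gamma (Suc t) e * r t e x) =
    (gamma t x * g t x) * (q x e / gamma (Suc t) e)"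
proof -
  obtain K where "bwd_weight q g gamma thb r t x e \<le> ennreal K"
    using bounded_weight_ex[OF backward_bounds(3)[rule_format, of t]] x t by auto
  moreover have "0 \<le> thb t e" "0 \<le> r t e x" "0 \<le> q x e" "0 < g t x" "0 < gamma t x"
    using backward t x q_nonneg g_pos[of t] gamma_pos[of t] transition_densityD(2)[of lam lam "r t"]
    by (auto simp: nonneg_function_def)
  ultimately have "enn2real (bwd_weight q g gamma thb r t x e) * (thb t e * r t e x) = gamma t x * g t x * q x e"
    unfolding bwd_weight_def by (intro weight_times_proposal) auto
  then show ?thesis by simp
qed

text \<open>The right-hand side is the density of \<open>backward_measure t\<close>, so this is the
  limit recursion required of the reversed filter.\<close>

lemma nn_integral_bwd_weight:
  assumes t: "t < T" and x: "x \<in> space lam"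
  shows "(\<integral>\<^sup>+e. ennreal (enn2real (bwd_weight q g gamma thb r t x e) * (thb t e / gamma (Suc t) e * r t e x)) \<partial>backward_measure (Suc t)) =
    ennreal (gamma t x * g t x) * future (T - t) x"
proof -
  have [measurable]: "gamma (Suc t) \<in> borel_measurable lam" "q x \<in> borel_measurable lam"
    using x t by (simp_all add: q_measurable2)
  have "(\<integral>\<^sup>+e. ennreal (enn2real (bwd_weight q g gamma thb r t x e) * (thb t e / gamma (Suc t) e * r t e x)) \<partial>backward_measure (Suc t)) =
    (\<integral>\<^sup>+e. ennreal (gamma t x * g t x) * ennreal (q x e / gamma (Suc t) e) \<partial>backward_measure (Suc t))"
  proof (intro nn_integral_cong)
    fix e assume "e \<in> space (backward_measure (Suc t))"
    then have e: "e \<in> space lam" by simp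
    have "0 \<le> gamma t x * g t x" "0 \<le> q x e / gamma (Suc t) e"
      using q_nonneg g_pos[of t x] gamma_pos[of t x] gamma_pos[of "Suc t" e] t x e by (auto simp: less_imp_le)
    then show "ennreal (enn2real (bwd_weight q g gamma thb r t x e) * (thb t e / gamma (Suc t) e * r t e x)) =
        ennreal (gamma t x * g t x) * ennreal (q x e / gamma (Suc t) e)"
      by (simp only: bwd_weight_times_proposal[OF t e x] ennreal_mult)
  qed
  also have "\<dots> = ennreal (gamma t x * g t x) * (\<integral>\<^sup>+e. ennreal (q x e / gamma (Suc t) e) \<partial>backward_measure (Suc t))"
    by (rule nn_integral_cmult) measurable
  finally show ?thesis using nn_integral_backward_measure[OF t x] by simp
qed

lemma backward_measure_mass:
  assumes "t \<le> T"
  shows "0 < (\<integral>\<^sup>+x. ennreal (gamma t x * g t x) * future (T - t) x \<partial>lam)"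
  using g_pos[OF assms] gamma_pos[OF assms] future_pos assms lam_nonzero
  by (intro nn_integral_pos) (auto simp: ennreal_zero_less_mult_iff)

text \<open>
  The backward filter is a particle filter in the reversed time \<open>n = T - t\<close>.
\<close>

sublocale bwd: particle_model lam "density lam (\<lambda>x. ennreal (rhoT x))" "bwd_weight_init g gamma rhoT T"
  "\<lambda>n e x. thb (T - n) e / gamma (Suc (T - n)) e * r (T - n) e x"
  "\<lambda>n e x. bwd_weight q g gamma thb r (T - n) x e" "\<lambda>n. backward_measure (T - n)" T
proof -
  let ?rho = "density lam (\<lambda>x. ennreal (rhoT x))"
  have [measurable]: "rhoT \<in> borel_measurable lam" and r0: "\<And>x. x \<in> space lam \<Longrightarrow> 0 \<le> rhoT x"
    and r1: "(\<integral>\<^sup>+x. ennreal (rhoT x) \<partial>lam) = 1"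
    using backward(1) by (auto simp: probability_density_def)
  have [measurable]: "g T \<in> borel_measurable lam" "gamma T \<in> borel_measurable lam" by simp_all
  have v0m[measurable]: "bwd_weight_init g gamma rhoT T \<in> borel_measurable lam"
    unfolding bwd_weight_init_def by measurable
  obtain K where K: "0 < K" "\<And>x. x \<in> space lam \<Longrightarrow> bwd_weight_init g gamma rhoT T x \<le> ennreal K"
    using backward_bounds(2) by (rule sup_norm_bound) blast
  have rho: "prob_space ?rho"
    by (rule prob_spaceI) (use r1 emeasure_density_space[of "\<lambda>x. ennreal (rhoT x)" lam] in simp)
  show "particle_model lam ?rho (bwd_weight_init g gamma rhoT T)
    (\<lambda>n e x. thb (T - n) e / gamma (Suc (T - n)) e * r (T - n) e x)
    (\<lambda>n e x. bwd_weight q g gamma thb r (T - n) x e) (\<lambda>n. backward_measure (T - n)) T"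
  proof (rule particle_model.intro[OF lam.sigma_finite_measure_axioms rho], unfold_locales)
    show "\<exists>K>0. \<forall>x\<in>space lam. bwd_weight_init g gamma rhoT T x \<le> ennreal K" using K by blast
    \<comment> \<open>A bounded weight cannot meet a zero of \<open>rhoT\<close>, so multiplying
      back by \<open>rhoT\<close> recovers \<open>g T * gamma T\<close> at every point.\<close>
    have v: "ennreal (gamma T x * g T x) = ennreal (rhoT x) * bwd_weight_init g gamma rhoT T x" if x: "x \<in> space lam" for x
    proof -
      let ?v = "bwd_weight_init g gamma rhoT T x"
      have "enn2real ?v * rhoT x = g T x * gamma T x"
        unfolding bwd_weight_init_def
        using K(2)[OF x] r0[OF x] g_pos[of T x] gamma_pos[of T x] x
        by (intro weight_times_proposal[where K = K]) (auto simp: bwd_weight_init_def)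
      moreover have "ennreal (enn2real ?v) = ?v"
        using K(2)[OF x] by (intro ennreal_enn2real) (auto simp: le_less_trans)
      ultimately show ?thesis using r0[OF x] by (metis ennreal_mult enn2real_nonneg mult.commute)
    qed
    then show "backward_measure (T - 0) = density ?rho (bwd_weight_init g gamma rhoT T)"
      unfolding backward_measure_def
      by (subst density_density_eq) (auto intro!: density_cong AE_I2)
    show "emeasure (backward_measure (T - 0)) (space lam) \<noteq> 0"
      using backward_measure_mass[of T] unfolding backward_measure_def
      by (subst emeasure_density_space) auto
    fix n assume n: "n < T"
    \<comment> \<open>Reversed time \<open>n\<close> is the time \<open>T - n = Suc t\<close>, and
      the step goes from there down to \<open>t\<close>.\<close>
    define t where "t = T - Suc n"
    have t: "T - n = Suc t" "t < T" "t \<le> T" "Suc t \<le> T" "t \<in> {0..<T}" using n by (auto simp: t_def)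
    note rd = transition_densityD[OF backward(3)[rule_format, OF t(5)]]
    have [measurable]: "thb t \<in> borel_measurable lam" and th0: "\<And>x. x \<in> space lam \<Longrightarrow> 0 \<le> thb t x / gamma (Suc t) x"
      using backward(2) t gamma_pos[OF t(4)] by (auto simp: nonneg_function_def less_imp_le)
    have [measurable]: "g t \<in> borel_measurable lam" "gamma t \<in> borel_measurable lam" "gamma (Suc t) \<in> borel_measurable lam"
      using t by simp_all
    note rd(1)[measurable]
    have vm: "(\<lambda>(e, x). bwd_weight q g gamma thb r t x e) \<in> borel_measurable (lam \<Otimes>\<^sub>M lam)"
      unfolding bwd_weight_def by measurable
    have km: "(\<lambda>(e, x). thb t e / gamma (Suc t) e * r t e x) \<in> borel_measurable (lam \<Otimes>\<^sub>M lam)" by measurable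
    show "(\<lambda>(e, x). bwd_weight q g gamma thb r (T - Suc n) x e) \<in> borel_measurable (lam \<Otimes>\<^sub>M lam)"
      using vm by (simp only: t_def)
    show "(\<lambda>(e, x). thb (T - Suc n) e / gamma (Suc (T - Suc n)) e * r (T - Suc n) e x) \<in> borel_measurable (lam \<Otimes>\<^sub>M lam)"
      using km by (simp only: t_def)
    show "\<exists>K>0. \<forall>e\<in>space lam. \<forall>x\<in>space lam. bwd_weight q g gamma thb r (T - Suc n) x e \<le> ennreal K"
      unfolding t_def[symmetric] using bounded_weight_ex[OF backward_bounds(3)[rule_format, OF t(5)]] by blast
    show "0 \<le> thb (T - Suc n) e / gamma (Suc (T - Suc n)) e * r (T - Suc n) e x" if "e \<in> space lam" "x \<in> space lam" for e x
      unfolding t_def[symmetric] by (rule mult_nonneg_nonneg[OF th0[OF that(1)] rd(2)[OF that]])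
    obtain K where "0 < K" "\<And>x. x \<in> space lam \<Longrightarrow> ennreal (thb t x / gamma (t + 1) x) \<le> ennreal K"
      using backward_bounds(1)[rule_format, OF t(5)] by (rule sup_norm_bound) blast
    then show "\<exists>K>0. \<forall>e\<in>space lam. (\<integral>\<^sup>+x. ennreal (thb (T - Suc n) e / gamma (Suc (T - Suc n)) e * r (T - Suc n) e x) \<partial>lam) \<le> ennreal K"
      unfolding t_def[symmetric]
      using nn_integral_cmult_transition_density[OF backward(3)[rule_format, OF t(5)] _ th0] by auto
    let ?w = "\<lambda>e x. ennreal (enn2real (bwd_weight q g gamma thb r t x e) * (thb t e / gamma (Suc t) e * r t e x))"
    have "backward_measure t = density lam (\<lambda>x. \<integral>\<^sup>+e. ?w e x \<partial>backward_measure (Suc t))"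
      unfolding backward_measure_def[of t] by (intro density_cong_space nn_integral_bwd_weight[OF t(2), symmetric])
    then show "backward_measure (T - Suc n) = density lam (\<lambda>x. \<integral>\<^sup>+e. ennreal (enn2real (bwd_weight q g gamma thb r (T - Suc n) x e) *
        (thb (T - Suc n) e / gamma (Suc (T - Suc n)) e * r (T - Suc n) e x)) \<partial>backward_measure (T - n))"
      by (simp only: t_def[symmetric] t(1))
    assume "finite_measure (backward_measure (T - n))"
    then interpret mu: finite_measure "backward_measure (Suc t)" by (simp only: t(1))
    interpret P: pair_sigma_finite "backward_measure (Suc t)" lam ..
    \<comment> \<open>Positivity is read off in the child variable, where the inner integral is
      known in closed form; Tonelli then restores the order required by the locale.\<close>
    have "0 < (\<integral>\<^sup>+x. ennreal (gamma t x * g t x) * future (T - t) x \<partial>lam)"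
      by (rule backward_measure_mass[OF t(3)])
    also have "\<dots> = (\<integral>\<^sup>+x. \<integral>\<^sup>+e. ?w e x \<partial>backward_measure (Suc t) \<partial>lam)"
      by (intro nn_integral_cong nn_integral_bwd_weight[OF t(2), symmetric])
    also have "\<dots> = (\<integral>\<^sup>+e. \<integral>\<^sup>+x. ?w e x \<partial>lam \<partial>backward_measure (Suc t))"
    proof (rule P.Fubini')
      show "(\<lambda>(e, x). ?w e x) \<in> borel_measurable (backward_measure (Suc t) \<Otimes>\<^sub>M lam)"
        using borel_measurable_times[OF borel_measurable_enn2real[OF vm[unfolded case_prod_beta']] km[unfolded case_prod_beta']]
        by (simp add: case_prod_beta' cong: measurable_cong_sets sets_pair_measure_cong)
    qed
    finally show "0 < (\<integral>\<^sup>+e. \<integral>\<^sup>+x. ennreal (enn2real (bwd_weight q g gamma thb r (T - Suc n) x e) *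
        (thb (T - Suc n) e / gamma (Suc (T - Suc n)) e * r (T - Suc n) e x)) \<partial>lam \<partial>backward_measure (T - n))"
      by (simp only: t_def[symmetric] t(1))
  qed (use sets_density v0m in auto)
qed

lemma backward_filter_particle_filter:
  assumes "backward_filter lam q g gamma rhoT thb r T N M xib Ib wtb"
  shows "bwd.particle_filter N M (\<lambda>n. xib (T - n)) (\<lambda>n. Ib (T - n)) (\<lambda>n. wtb (T - n))"
  unfolding bwd.particle_filter_def
proof (intro conjI allI impI)
  fix n assume "n < T"
  then have t: "T - Suc n \<in> {0..<T}" "T - Suc n + 1 = T - n" "T - n = Suc (T - Suc n)"
    and ev: "particle_events M lam N (\<lambda>n. xib (T - n)) (\<lambda>n. Ib (T - n)) {0..<Suc n} {1..<Suc n} =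
      particle_events M lam N xib Ib {T - Suc n<..T} {T - Suc n<..<T}"
    using particle_events_reverse[of "T - Suc n" T M lam N xib Ib] by auto
  have "\<forall>t\<in>{0..<T}.
        cond_iid M (sigma_sets (space M) (particle_events M lam N xib Ib {t<..T} {t<..<T})) N
          (count_space {1..N} \<Otimes>\<^sub>M lam)
          (\<lambda>w (j, x). wtb (t + 1) j w *
             ennreal (thb t (xib (t + 1) j w) / gamma (t + 1) (xib (t + 1) j w) * r t (xib (t + 1) j w) x))
          (\<lambda>i w. (Ib t i w, xib t i w)) \<and>
        (\<forall>i\<in>{1..N}. \<forall>w\<in>space M.
           wtb t i w = bwd_weight q g gamma thb r t (xib t i w) (xib (t + 1) (Ib t i w) w))"
    using assms unfolding backward_filter_def by blast
  from bspec[OF this t(1)]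
  show "cond_iid M (sigma_sets (space M) (particle_events M lam N (\<lambda>n. xib (T - n)) (\<lambda>n. Ib (T - n)) {0..<Suc n} {1..<Suc n})) N
      (count_space {1..N} \<Otimes>\<^sub>M lam)
      (\<lambda>w (i, x). wtb (T - n) i w * ennreal (thb (T - Suc n) (xib (T - n) i w) /
        gamma (Suc (T - Suc n)) (xib (T - n) i w) * r (T - Suc n) (xib (T - n) i w) x))
      (\<lambda>l w. (Ib (T - Suc n) l w, xib (T - Suc n) l w))"
    "\<forall>l\<in>{1..N}. \<forall>w\<in>space M. wtb (T - Suc n) l w =
      bwd_weight q g gamma thb r (T - Suc n) (xib (T - Suc n) l w) (xib (T - n) (Ib (T - Suc n) l w) w)"
    unfolding ev t(2) t(3)[symmetric] by blast+
qed (use assms in \<open>simp_all add: backward_filter_def\<close>)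

end

subsection \<open>The two-filter algorithm\<close>

lemma indep_set_mono:
  assumes "prob_space M" "prob_space.indep_set M A B" "A' \<subseteq> A" "B' \<subseteq> B"
  shows "prob_space.indep_set M A' B'"
proof -
  interpret prob_space M by fact
  show ?thesis using assms(2-4) unfolding indep_sets2_eq by blast
qed

context two_filter_model
begin

text \<open>For fixed \<open>x\<close> the integrand splits into a forward and a backward factor.
  The first integrates to the density of \<open>filter_measure s\<close>; the second gives
  \<open>future (T - s) x\<close>, since \<open>1 / gamma\<close> cancels the artificial density.
  Their product is the smoothing density.\<close>

lemma two_filter_measures:
  assumes s: "s \<in> {1..<T}" and x: "x \<in> space lam"
    and mu: "finite_measure (filter_measure (s - 1))" and nu: "finite_measure (backward_measure (Suc s))"
  shows "(\<integral>\<^sup>+e. ennreal (q (fst e) x * q x (snd e) * g s x / gamma (Suc s) (snd e)) \<partial>(filter_measure (s - 1) \<Otimes>\<^sub>M backward_measure (Suc s))) =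
    (\<integral>\<^sup>+e. ennreal (q e x * g s x) \<partial>filter_measure (s - 1)) * future (T - s) x"
proof -
  let ?mu = "filter_measure (s - 1)" and ?nu = "backward_measure (Suc s)"
  interpret mu: finite_measure ?mu by fact
  interpret nu: finite_measure ?nu by fact
  have [measurable]: "gamma (Suc s) \<in> borel_measurable lam" using s by simp
  have [measurable]: "q x \<in> borel_measurable lam" using x by (rule q_measurable2)
  have [measurable]: "(\<lambda>e. q e x) \<in> borel_measurable lam" using measurable_Pair1[OF q_measurable x] by simp
  have "(\<integral>\<^sup>+e. ennreal (q (fst e) x * q x (snd e) * g s x / gamma (Suc s) (snd e)) \<partial>(?mu \<Otimes>\<^sub>M ?nu)) =
    (\<integral>\<^sup>+e. \<integral>\<^sup>+e'. ennreal (q e x * q x e' * g s x / gamma (Suc s) e') \<partial>?nu \<partial>?mu)"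
    by (subst nu.nn_integral_fst[symmetric]) auto
  also have "\<dots> = (\<integral>\<^sup>+e. ennreal (q e x * g s x) * future (T - s) x \<partial>?mu)"
  proof (intro nn_integral_cong)
    fix e assume "e \<in> space ?mu"
    then have e: "e \<in> space lam" by simp
    have "(\<integral>\<^sup>+e'. ennreal (q e x * q x e' * g s x / gamma (Suc s) e') \<partial>?nu) =
      (\<integral>\<^sup>+e'. ennreal (q e x * g s x) * ennreal (q x e' / gamma (Suc s) e') \<partial>?nu)"
    proof (intro nn_integral_cong)
      fix e' assume "e' \<in> space ?nu"
      then have e': "e' \<in> space lam" by simp
      have "0 \<le> q e x * g s x" "0 \<le> q x e' / gamma (Suc s) e'"
        using q_nonneg g_pos[of s x] gamma_pos[of "Suc s" e'] s x e e' by (auto simp: less_imp_le)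
      then have "ennreal (q e x * g s x) * ennreal (q x e' / gamma (Suc s) e') = ennreal ((q e x * g s x) * (q x e' / gamma (Suc s) e'))"
        by (simp only: ennreal_mult)
      also have "(q e x * g s x) * (q x e' / gamma (Suc s) e') = q e x * q x e' * g s x / gamma (Suc s) e'"
        by simp
      finally show "ennreal (q e x * q x e' * g s x / gamma (Suc s) e') = ennreal (q e x * g s x) * ennreal (q x e' / gamma (Suc s) e')" ..
    qed
    also have "\<dots> = ennreal (q e x * g s x) * (\<integral>\<^sup>+e'. ennreal (q x e' / gamma (Suc s) e') \<partial>?nu)"
      by (rule nn_integral_cmult) measurable
    also have "(\<integral>\<^sup>+e'. ennreal (q x e' / gamma (Suc s) e') \<partial>?nu) = future (T - s) x"
      using s x by (intro nn_integral_backward_measure) auto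
    finally show "(\<integral>\<^sup>+e'. ennreal (q e x * q x e' * g s x / gamma (Suc s) e') \<partial>?nu) = ennreal (q e x * g s x) * future (T - s) x" .
  qed
  also have "\<dots> = (\<integral>\<^sup>+e. ennreal (q e x * g s x) \<partial>?mu) * future (T - s) x"
    by (rule nn_integral_multc) measurable
  finally show ?thesis .
qed

definition two_filter_run where
  "two_filter_run s N M xi I wt xib Ib wtb xit It Jt wtt \<longleftrightarrow>
     prob_space M \<and> 1 \<le> N \<and>
     forward_filter lam q g rho0 D th p T N M xi I wt \<and>
     backward_filter lam q g gamma rhoT thb r T N M xib Ib wtb \<and>
     independent_filters lam T N M xi I xib Ib \<and>
     two_filter_sample lam q g gamma tht rt T s N M xi I wt xib Ib wtb xit It Jt wtt"

text \<open>One more importance sampling step, with pairs from the times \<open>s - 1\<close> and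
  \<open>s + 1\<close> as parents. Given the joint past the draws are i.i.d., so independence of the
  filters enters only through the parental double average. The step maps the product of the two
  limits to \<open>smoothing_measure s\<close>.\<close>

lemma smoothing_concentrates:
  assumes s: "s \<in> {1..<T}"
  shows "0 < measure (smoothing_measure s) (space lam) \<and>
    (\<exists>B C. 0 \<le> B \<and> 0 < C \<and> (\<forall>(M :: 'w measure) N xi I wt xib Ib wtb xit It Jt wtt.
       two_filter_run s N M xi I wt xib Ib wtb xit It Jt wtt \<longrightarrow>
       (\<forall>l\<in>{1..N}. xit l \<in> M \<rightarrow>\<^sub>M lam \<and> (\<forall>w\<in>space M. wtt l w < \<infinity>)) \<and>
       concentrates M (real N) {1..N} (\<lambda>l w. enn2real (wtt l w)) xit (smoothing_measure s) B C))"
proof -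
  let ?mu = "filter_measure (s - 1)" and ?nu = "backward_measure (Suc s)"
  let ?E = "?mu \<Otimes>\<^sub>M ?nu"
  \<comment> \<open>Reversed time \<open>T - Suc s\<close> of the backward filter is the time
    \<open>Suc s\<close>.\<close>
  have sT: "s - 1 \<le> T" "Suc s \<le> T" "s \<le> T" "T - (T - Suc s) = Suc s" "Suc (s - 1) = s" using s by auto
  obtain Bf Cf where BCf: "0 \<le> Bf" "0 < Cf" and concf: "\<And>(M :: 'w measure) N xi I wt. prob_space M \<Longrightarrow> 1 \<le> N \<Longrightarrow>
       fwd.particle_filter N M xi I wt \<Longrightarrow>
       concentrates M (real N) {1..N} (\<lambda>l w. enn2real (wt (s - 1) l w)) (xi (s - 1)) ?mu Bf Cf"
    using fwd.particle_filter_concentrates[OF sT(1), where 'w = 'w] by blast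
  obtain Bb Cb where BCb: "0 \<le> Bb" "0 < Cb" and concb: "\<And>(M :: 'w measure) N xi I wt. prob_space M \<Longrightarrow> 1 \<le> N \<Longrightarrow>
       bwd.particle_filter N M xi I wt \<Longrightarrow>
       concentrates M (real N) {1..N} (\<lambda>l w. enn2real (wt (T - Suc s) l w)) (xi (T - Suc s)) ?nu Bb Cb"
    using bwd.particle_filter_concentrates[of "T - Suc s", where 'w = 'w] unfolding sT(4) by auto
  have fmu: "finite_measure ?mu" using fwd.particle_filter_concentrates[OF sT(1)] by blast
  have fnu: "finite_measure ?nu" using bwd.particle_filter_concentrates[of "T - Suc s"] unfolding sT(4) by auto
  interpret mu: finite_measure ?mu by (rule fmu)
  interpret nu: finite_measure ?nu by (rule fnu)
  have "emeasure ?E (space ?E) \<noteq> \<infinity>"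
    by (simp add: space_pair_measure nu.emeasure_pair_measure_Times mu.emeasure_eq_measure nu.emeasure_eq_measure ennreal_mult_eq_top_iff del: One_nat_def)
  then interpret E: finite_measure ?E by (rule finite_measureI)
  have spE: "space ?E = space lam \<times> space lam" by (simp add: space_pair_measure)
  note rtd = transition_densityD[OF two_filter(2)[rule_format, OF s]]
  have tht_m: "(\<lambda>(x, x'). tht s x x') \<in> borel_measurable (lam \<Otimes>\<^sub>M lam)"
    and tht0: "\<And>x x'. x \<in> space lam \<Longrightarrow> x' \<in> space lam \<Longrightarrow> 0 \<le> tht s x x'"
    using two_filter(1) s by (auto simp: nonneg_function_def space_pair_measure)
  have [measurable]: "g s \<in> borel_measurable lam" "gamma (Suc s) \<in> borel_measurable lam"
    using sT by simp_all
  note rtd(1)[measurable] tht_m[measurable]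
  obtain Kv where Kv: "0 < Kv" "\<And>x. x \<in> space lam \<times> space lam \<times> space lam \<Longrightarrow>
      (case x of (x, x', x'') \<Rightarrow> two_filter_weight q g tht rt s x x' x'') \<le> ennreal Kv"
    using two_filter_bounds(2)[rule_format, OF s] by (rule sup_norm_bound) blast
  obtain Kt where Kt: "0 < Kt" "\<And>x. x \<in> space lam \<times> space lam \<Longrightarrow> (case x of (x, x') \<Rightarrow> ennreal (tht s x x' / gamma (s + 1) x')) \<le> ennreal Kt"
    using two_filter_bounds(1)[rule_format, OF s] by (rule sup_norm_bound) blast
  \<comment> \<open>\<open>gamma\<close> belongs to the sampling density of the pair and not to the
    weight, so it remains as a divisor in \<open>v * k\<close>.\<close>
  define k where "k e x = tht s (fst e) (snd e) / gamma (Suc s) (snd e) * rt s e x" for e x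
  define v where "v e x = enn2real (two_filter_weight q g tht rt s (fst e) (snd e) x)" for e x
  have vk: "v e x * k e x = q (fst e) x * q x (snd e) * g s x / gamma (Suc s) (snd e)"
    if "e \<in> space ?E" "x \<in> space lam" for e x
  proof -
    have "e \<in> space lam \<times> space lam" using that(1) unfolding spE .
    then obtain e1 e2 where e: "e = (e1, e2)" "e1 \<in> space lam" "e2 \<in> space lam" by blast
    have "v e x * (tht s e1 e2 * rt s (e1, e2) x) = q e1 x * q x e2 * g s x"
      unfolding v_def two_filter_weight_def e fst_conv snd_conv
    proof (rule weight_times_proposal)
      show "0 \<le> q e1 x * q x e2 * g s x" using q_nonneg g_pos[of s x] sT that e by simp
      show "0 \<le> tht s e1 e2 * rt s (e1, e2) x" using tht0 rtd(2)[of "(e1, e2)" x] that e by (simp add: space_pair_measure)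
      show "ennreal (q e1 x * q x e2 * g s x) / ennreal (tht s e1 e2 * rt s (e1, e2) x) \<le> ennreal Kv"
        using Kv(2)[of "(e1, e2, x)"] that e by (simp add: two_filter_weight_def)
    qed
    then show ?thesis by (simp add: k_def e)
  qed
  have vk': "(\<integral>\<^sup>+e. ennreal (v e x * k e x) \<partial>?E) = (\<integral>\<^sup>+e. ennreal (q e x * g s x) \<partial>?mu) * future (T - s) x"
    if x: "x \<in> space lam" for x
  proof -
    have "(\<integral>\<^sup>+e. ennreal (v e x * k e x) \<partial>?E) = (\<integral>\<^sup>+e. ennreal (q (fst e) x * q x (snd e) * g s x / gamma (Suc s) (snd e)) \<partial>?E)"
      using x by (intro nn_integral_cong) (simp add: vk)
    then show ?thesis using two_filter_measures[OF s x fmu fnu] by simp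
  qed
  have smoothing: "smoothing_measure s = density lam (\<lambda>x. (\<integral>\<^sup>+e. ennreal (q e x * g s x) \<partial>?mu) * future (T - s) x)"
  proof -
    have "filter_measure s = density lam (\<lambda>x. \<integral>\<^sup>+e. ennreal (q e x * g s x) \<partial>?mu)"
      using filter_measure.simps(2)[of "s - 1"] unfolding sT(5) .
    then show ?thesis unfolding smoothing_measure_def by (simp add: density_density_eq del: One_nat_def)
  qed
  have km: "(\<lambda>(e, x). k e x) \<in> borel_measurable (?E \<Otimes>\<^sub>M lam)"
    unfolding k_def by measurable
  have vm: "(\<lambda>(e, x). v e x) \<in> borel_measurable (?E \<Otimes>\<^sub>M lam)"
    unfolding v_def two_filter_weight_def by measurable
  interpret P: pair_sigma_finite ?E lam ..
  interpret K: importance_kernel lam ?E k v Kv Kt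
  proof
    show "0 < (\<integral>\<^sup>+e. \<integral>\<^sup>+x. ennreal (v e x * k e x) \<partial>lam \<partial>?E)"
    proof -
      note km[measurable] vm[measurable]
      \<comment> \<open>Positivity is inherited from the smoothing measure: \<open>future\<close> is
        positive and \<open>filter_measure s\<close> is nonzero.\<close>
      have "0 < (\<integral>\<^sup>+x. future (T - s) x \<partial>filter_measure s)"
        using future_pos fwd.particle_filter_concentrates[OF sT(3)] by (intro nn_integral_pos) auto
      also have "\<dots> = emeasure (smoothing_measure s) (space lam)"
        unfolding smoothing_measure_def
        using emeasure_density_space[of "future (T - s)" "filter_measure s"] by simp
      also have "\<dots> = (\<integral>\<^sup>+x. (\<integral>\<^sup>+e. ennreal (q e x * g s x) \<partial>?mu) * future (T - s) x \<partial>lam)"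
        unfolding smoothing by (rule emeasure_density_space) measurable
      also have "\<dots> = (\<integral>\<^sup>+x. \<integral>\<^sup>+e. ennreal (v e x * k e x) \<partial>?E \<partial>lam)"
        by (intro nn_integral_cong) (simp add: vk' del: One_nat_def)
      also have "\<dots> = (\<integral>\<^sup>+e. \<integral>\<^sup>+x. ennreal (v e x * k e x) \<partial>lam \<partial>?E)"
        by (rule P.Fubini') measurable
      finally show ?thesis .
    qed
    fix e assume eE: "e \<in> space ?E"
    then have "e \<in> space lam \<times> space lam" unfolding spE .
    then obtain e1 e2 where e: "e = (e1, e2)" "e1 \<in> space lam" "e2 \<in> space lam" by blast
    then have e': "e \<in> space (lam \<Otimes>\<^sub>M lam)" by (simp add: space_pair_measure)
    have q0: "0 \<le> tht s (fst e) (snd e) / gamma (Suc s) (snd e)"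
      using tht0 gamma_pos[OF sT(2)] e by (auto simp: less_imp_le)
    show "(\<integral>\<^sup>+x. ennreal (k e x) \<partial>lam) \<le> ennreal Kt"
      unfolding k_def using Kt(2)[of "(e1, e2)"] e
        nn_integral_cmult_transition_density[OF two_filter(2)[rule_format, OF s] e' q0] by simp
    fix x assume x: "x \<in> space lam"
    show "0 \<le> k e x" unfolding k_def by (rule mult_nonneg_nonneg[OF q0 rtd(2)[OF e' x]])
    show "0 \<le> v e x \<and> v e x \<le> Kv"
      unfolding v_def using Kv(1) Kv(2)[of "(e1, e2, x)"] e x by (auto intro: enn2real_leI)
  qed (use Kv Kt km vm in auto)
  have propagated: "K.propagated = smoothing_measure s"
    unfolding K.propagated_def smoothing
  proof (intro density_cong AE_I2 vk')
    show "(\<lambda>x. \<integral>\<^sup>+e. ennreal (v e x * k e x) \<partial>?E) \<in> borel_measurable lam"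
      using K.k_measurable K.v_measurable by measurable
  qed measurable
  \<comment> \<open>Constants of the parental double average from
    \<open>concentrates_product\<close>; the minimum gives both filters a common rate.\<close>
  define B where "B = Bf + Bb"
  define C where "C = min Cf Cb / 4"
  have BC: "0 \<le> B" "0 < C" using BCf BCb by (auto simp: B_def C_def)
  have "(\<forall>l\<in>{1..N}. xit l \<in> M \<rightarrow>\<^sub>M lam \<and> (\<forall>w\<in>space M. wtt l w < \<infinity>)) \<and>
      concentrates M (real N) {1..N} (\<lambda>l w. enn2real (wtt l w)) xit (smoothing_measure s) (4 + 4 * B) (K.rate C)"
    if run: "two_filter_run s N M xi I wt xib Ib wtb xit It Jt wtt"
    for M :: "'w measure" and N xi I wt xib Ib wtb xit It Jt wtt
  proof -
    from run have M: "prob_space M" and N: "1 \<le> N"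
      and ff: "forward_filter lam q g rho0 D th p T N M xi I wt"
      and bf: "backward_filter lam q g gamma rhoT thb r T N M xib Ib wtb"
      and ind: "independent_filters lam T N M xi I xib Ib"
      and tf: "two_filter_sample lam q g gamma tht rt T s N M xi I wt xib Ib wtb xit It Jt wtt"
      unfolding two_filter_run_def by blast+
    note pf = forward_filter_particle_filter[OF ff] and pb = backward_filter_particle_filter[OF bf]
    let ?Gf = "particle_events M lam N xi I {0..<s} {1..<s}"
    let ?Gb = "particle_events M lam N xib Ib {s<..T} {s<..<T}"
    have rev: "particle_events M lam N (\<lambda>n. xib (T - n)) (\<lambda>n. Ib (T - n)) {0..<T - s} {1..<T - s} = ?Gb"
      by (rule particle_events_reverse[OF sT(3)])
    let ?R = "sigma (space M) (?Gf \<union> ?Gb)" and ?R1 = "sigma (space M) ?Gf" and ?R2 = "sigma (space M) ?Gb"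
    have G: "?Gf \<subseteq> sets M" "?Gb \<subseteq> sets M" "?Gf \<union> ?Gb \<subseteq> sets M"
      using fwd.events_subset[OF M pf, of s] bwd.events_subset[OF M pb, of "T - s"] sT unfolding rev by auto
    have G': "?Gf \<subseteq> Pow (space M)" "?Gb \<subseteq> Pow (space M)" "?Gf \<union> ?Gb \<subseteq> Pow (space M)" using G sets.space_closed[of M] by blast+
    have R: "space ?R = space M" "sets ?R = sigma_sets (space M) (?Gf \<union> ?Gb)"
      "space ?R1 = space M" "sets ?R1 = sigma_sets (space M) ?Gf"
      "space ?R2 = space M" "sets ?R2 = sigma_sets (space M) ?Gb" using G' by auto
    have RM: "sets ?R \<subseteq> sets M" unfolding R(2) using G(3) by (rule sets.sigma_sets_subset)
    \<comment> \<open>Each past is generated by part of a complete particle system, so the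
      independence of the systems passes to the pasts.\<close>
    have indR: "prob_space.indep_set M (sets ?R1) (sets ?R2)"
      unfolding R
    proof (rule indep_set_mono[OF M ind[unfolded independent_filters_def]])
      show "sigma_sets (space M) ?Gf \<subseteq> sigma_sets (space M) (particle_events M lam N xi I {0..T} {1..T})"
        by (intro sigma_sets_mono' particle_events_mono) (use s in auto)
      show "sigma_sets (space M) ?Gb \<subseteq> sigma_sets (space M) (particle_events M lam N xib Ib {0..T} {0..<T})"
        by (intro sigma_sets_mono' particle_events_mono) auto
    qed
    let ?J = "{1..N}"
    let ?W = "\<lambda>(i, j) w. enn2real (wt (s - 1) i w) * enn2real (wtb (Suc s) j w)"
    let ?X = "\<lambda>(i, j) w. (xi (s - 1) i w, xib (Suc s) j w)"
    have wm: "wt (s - 1) i \<in> borel_measurable (sigma (space M) G)" "xi (s - 1) i \<in> sigma (space M) G \<rightarrow>\<^sub>M lam"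
      if "?Gf \<subseteq> G" "G \<subseteq> sets M" "i \<in> ?J" for G i
      using s that by (auto intro!: fwd.weight_measurable[OF M pf that(1,2)])
    have wbm: "wtb (Suc s) i \<in> borel_measurable (sigma (space M) G)" "xib (Suc s) i \<in> sigma (space M) G \<rightarrow>\<^sub>M lam"
      if "?Gb \<subseteq> G" "G \<subseteq> sets M" "i \<in> ?J" for G i
      using bwd.weight_measurable[OF M pb that(1)[folded rev] that(2) _ _ that(3), of "T - Suc s"] s
      unfolding sT(4) by auto
    have wfin: "wt (s - 1) i w < \<infinity>" "wtb (Suc s) i w < \<infinity>" if "i \<in> ?J" "w \<in> space M" for i w
      using fwd.weight_finite[OF M pf sT(1) that] bwd.weight_finite[OF M pb _ that, of "T - Suc s"]
      unfolding sT(4) by auto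
    have concE: "concentrates M (real N) (?J \<times> ?J) ?W ?X ?E B C"
      unfolding B_def C_def
    proof (rule concentrates_product[OF M R(3,5) indR])
      show "concentrates M (real N) ?J (\<lambda>i w. enn2real (wt (s - 1) i w)) (xi (s - 1)) ?mu Bf (min Cf Cb)"
        using BCf by (intro concentrates_weaken[OF concf[OF M N pf]]) auto
      show "concentrates M (real N) ?J (\<lambda>i w. enn2real (wtb (Suc s) i w)) (xib (Suc s)) ?nu Bb (min Cf Cb)"
        using BCb by (intro concentrates_weaken[OF concb[OF M N pb, unfolded sT(4)]]) auto
      show "xi (s - 1) i \<in> ?R1 \<rightarrow>\<^sub>M ?mu" if "i \<in> ?J" for i
        using wm(2)[OF order_refl G(1) that] by (simp cong: measurable_cong_sets)
      show "xib (Suc s) i \<in> ?R2 \<rightarrow>\<^sub>M ?nu" if "i \<in> ?J" for i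
        using wbm(2)[OF order_refl G(2) that] by (simp cong: measurable_cong_sets)
    qed (use wm(1)[OF order_refl G(1)] wbm(1)[OF order_refl G(2)] BCf BCb fmu fnu in auto)
    let ?S2 = "count_space ?J \<Otimes>\<^sub>M lam"
    let ?S = "count_space ?J \<Otimes>\<^sub>M ?S2"
    have S2: "sigma_finite_measure ?S2"
      by (intro sigma_finite_count_space_pair lam.sigma_finite_measure_axioms) simp
    have S: "sigma_finite_measure ?S"
      by (intro sigma_finite_count_space_pair S2) simp
    let ?f = "\<lambda>w (i, j, x). wt (s - 1) i w * wtb (Suc s) j w * ennreal (k (xi (s - 1) i w, xib (Suc s) j w) x)"
    let ?Y = "\<lambda>l w. (It l w, Jt l w, xit l w)"
    have Y: "cond_iid M (sets ?R) N ?S ?f ?Y"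
      using tf unfolding two_filter_sample_def R(2) k_def fst_conv snd_conv Suc_eq_plus1 by blast
    have Ym: "?Y l \<in> M \<rightarrow>\<^sub>M ?S" if "l \<in> ?J" for l
      using Y that by (auto simp: cond_iid_def)
    have XE: "(\<lambda>w. (xi (s - 1) i w, xib (Suc s) j w)) \<in> ?R \<rightarrow>\<^sub>M ?E" if "i \<in> ?J" "j \<in> ?J" for i j
    proof -
      have "xi (s - 1) i \<in> ?R \<rightarrow>\<^sub>M ?mu" "xib (Suc s) j \<in> ?R \<rightarrow>\<^sub>M ?nu"
        using wm(2)[OF _ G(3) that(1)] wbm(2)[OF _ G(3) that(2)] by (auto cong: measurable_cong_sets)
      then show ?thesis by (rule measurable_Pair)
    qed
    have "concentrates M (real N) {1..N}
       (\<lambda>l w. v (case ?Y l w of (i, j, x) \<Rightarrow> (xi (s - 1) i w, xib (Suc s) j w)) (snd (snd (?Y l w))))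
       (\<lambda>l w. snd (snd (?Y l w))) K.propagated (4 + 4 * B) (K.rate C)"
    \<comment> \<open>The drawn triple consists of two indices and a position: \<open>pos\<close>
      looks up the pair of parents, \<open>c\<close> keeps the position.\<close>
    proof (rule K.concentrates_propagated[where pos = "\<lambda>w y. case y of (i, j, x) \<Rightarrow> (xi (s - 1) i w, xib (Suc s) j w)"
          and c = "\<lambda>y. snd (snd y)" and f = ?f, OF M R(1) RM S _ Y _ _ _ _ _ _ _ N concE BC(1)])
      show "(\<lambda>(w, y). ?f w y) \<in> borel_measurable (?R \<Otimes>\<^sub>M ?S)"
      proof (intro measurable_count_space_pair)
        fix i j assume ij: "i \<in> ?J" "j \<in> ?J"
        have "(\<lambda>p. ((xi (s - 1) i (fst p), xib (Suc s) j (fst p)), snd p)) \<in> ?R \<Otimes>\<^sub>M lam \<rightarrow>\<^sub>M ?E \<Otimes>\<^sub>M lam"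
          by (rule measurable_Pair[OF measurable_compose[OF measurable_fst XE[OF ij]] measurable_snd])
        from measurable_compose[OF measurable_compose[OF this km] measurable_ennreal]
        have 1: "(\<lambda>p. ennreal (k (xi (s - 1) i (fst p), xib (Suc s) j (fst p)) (snd p))) \<in> borel_measurable (?R \<Otimes>\<^sub>M lam)" by simp
        have 2: "(\<lambda>p. wt (s - 1) i (fst p)) \<in> borel_measurable (?R \<Otimes>\<^sub>M lam)" "(\<lambda>p. wtb (Suc s) j (fst p)) \<in> borel_measurable (?R \<Otimes>\<^sub>M lam)"
          using measurable_compose[OF measurable_fst wm(1)[OF _ G(3) ij(1)]] measurable_compose[OF measurable_fst wbm(1)[OF _ G(3) ij(2)]] by auto
        show "(\<lambda>(w, x). case (i, j, x) of (i, j, x) \<Rightarrow> wt (s - 1) i w * wtb (Suc s) j w * ennreal (k (xi (s - 1) i w, xib (Suc s) j w) x)) \<in> borel_measurable (?R \<Otimes>\<^sub>M lam)"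
          using borel_measurable_times_ennreal[OF borel_measurable_times_ennreal[OF 2] 1] by (simp add: case_prod_beta')
      qed simp_all
      show "?W i \<in> borel_measurable ?R" if "i \<in> ?J \<times> ?J" for i
        using wm(1)[OF _ G(3)] wbm(1)[OF _ G(3)] that by (auto intro!: borel_measurable_times borel_measurable_enn2real)
      show "?X i \<in> ?R \<rightarrow>\<^sub>M ?E" if "i \<in> ?J \<times> ?J" for i
        using XE that by auto
      show "(\<lambda>(w, y). case y of (i, j, x) \<Rightarrow> (xi (s - 1) i w, xib (Suc s) j w)) \<in> ?R \<Otimes>\<^sub>M ?S \<rightarrow>\<^sub>M ?E"
      proof (intro measurable_count_space_pair)
        fix i j assume ij: "i \<in> ?J" "j \<in> ?J"
        show "(\<lambda>(w, x). case (i, j, x) of (i, j, x) \<Rightarrow> (xi (s - 1) i w, xib (Suc s) j w)) \<in> ?R \<Otimes>\<^sub>M lam \<rightarrow>\<^sub>M ?E"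
          using measurable_compose[OF measurable_fst XE[OF ij]] by (simp add: case_prod_beta')
      qed simp_all
      show "(\<lambda>y. snd (snd y)) \<in> ?S \<rightarrow>\<^sub>M lam" by measurable
      fix w and F :: "'a \<times> 'a \<Rightarrow> 'a \<Rightarrow> ennreal"
      assume w: "w \<in> space M" and F: "(\<lambda>(e, x). F e x) \<in> borel_measurable (?E \<Otimes>\<^sub>M lam)"
      let ?e = "\<lambda>i j. (xi (s - 1) i w, xib (Suc s) j w)"
      have Xw: "?e i j \<in> space ?E" if "i \<in> ?J" "j \<in> ?J" for i j
        using measurable_space[OF XE[OF that], of w] w R by simp
      have Fi: "F (?e i j) \<in> borel_measurable lam" "k (?e i j) \<in> borel_measurable lam" if "i \<in> ?J" "j \<in> ?J" for i j
        using measurable_Pair2[OF F Xw[OF that]] measurable_Pair2[OF km Xw[OF that]] by simp_all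
      let ?h = "\<lambda>y. ?f w y * F (case y of (i, j, x) \<Rightarrow> ?e i j) (snd (snd y))"
      have m2: "(\<lambda>y. ?h (i, y)) \<in> borel_measurable ?S2" if i: "i \<in> ?J" for i
      proof (rule measurable_pair_measure_countable1)
        fix j assume j: "j \<in> ?J"
        show "(\<lambda>x. ?h (i, j, x)) \<in> borel_measurable lam" using Fi[OF i j] by simp
      qed simp
      have m: "?h \<in> borel_measurable ?S"
        by (rule measurable_pair_measure_countable1) (use m2 in auto)
      have "(\<integral>\<^sup>+y. ?h y \<partial>?S) = (\<Sum>i\<in>?J. \<integral>\<^sup>+y. ?h (i, y) \<partial>?S2)"
        by (rule nn_integral_count_space_pair[OF _ S2 m]) simp
      also have "\<dots> = (\<Sum>i\<in>?J. \<Sum>j\<in>?J. \<integral>\<^sup>+x. ?h (i, j, x) \<partial>lam)"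
        by (intro sum.cong refl nn_integral_count_space_pair[OF _ lam.sigma_finite_measure_axioms m2]) auto
      also have "\<dots> = (\<Sum>i\<in>?J. \<Sum>j\<in>?J. ennreal (?W (i, j) w) * (\<integral>\<^sup>+x. ennreal (k (?e i j) x) * F (?e i j) x \<partial>lam))"
      proof (intro sum.cong refl)
        fix i j assume ij: "i \<in> ?J" "j \<in> ?J"
        have "ennreal (?W (i, j) w) = wt (s - 1) i w * wtb (Suc s) j w"
          using wfin(1)[OF ij(1) w] wfin(2)[OF ij(2) w] by (simp add: ennreal_mult)
        then show "(\<integral>\<^sup>+x. ?h (i, j, x) \<partial>lam) = ennreal (?W (i, j) w) * (\<integral>\<^sup>+x. ennreal (k (?e i j) x) * F (?e i j) x \<partial>lam)"
          using Fi[OF ij] by (simp add: nn_integral_cmult[symmetric] mult.assoc)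
      qed
      also have "\<dots> = (\<Sum>i\<in>?J \<times> ?J. ennreal (?W i w) * (\<integral>\<^sup>+x. ennreal (k (?X i w) x) * F (?X i w) x \<partial>lam))"
        by (simp add: sum.cartesian_product case_prod_beta')
      finally show "(\<integral>\<^sup>+y. ?h y \<partial>?S) = (\<Sum>i\<in>?J \<times> ?J. ennreal (?W i w) * (\<integral>\<^sup>+x. ennreal (k (?X i w) x) * F (?X i w) x \<partial>lam))" .
    qed auto
    then have conc: "concentrates M (real N) {1..N} (\<lambda>l w. v (xi (s - 1) (It l w) w, xib (Suc s) (Jt l w) w) (xit l w))
       xit (smoothing_measure s) (4 + 4 * B) (K.rate C)"
      unfolding propagated by simp
    have wtt: "wtt l w = two_filter_weight q g tht rt s (xi (s - 1) (It l w) w) (xib (Suc s) (Jt l w) w) (xit l w)"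
      if "l \<in> ?J" "w \<in> space M" for l w
      using tf that unfolding two_filter_sample_def by auto
    have "concentrates M (real N) {1..N} (\<lambda>l w. enn2real (wtt l w)) xit (smoothing_measure s) (4 + 4 * B) (K.rate C)"
      using conc wtt
      by (subst concentrates_cong[where W' = "\<lambda>l w. v (xi (s - 1) (It l w) w, xib (Suc s) (Jt l w) w) (xit l w)"]) (auto simp: v_def)
    moreover have xit: "xit l \<in> M \<rightarrow>\<^sub>M lam" if "l \<in> ?J" for l
      using measurable_compose[OF Ym[OF that], of "\<lambda>y. snd (snd y)" lam] by simp
    moreover have "wtt l w < \<infinity>" if l: "l \<in> ?J" and w: "w \<in> space M" for l w
    proof -
      have IJ: "It l w \<in> ?J" "Jt l w \<in> ?J" using measurable_space[OF Ym[OF l] w] by (auto simp: space_pair_measure)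
      have "xi (s - 1) (It l w) w \<in> space lam" "xib (Suc s) (Jt l w) w \<in> space lam" "xit l w \<in> space lam"
        using measurable_space[OF fwd.particle_measurable_M[OF M pf sT(1) IJ(1)] w]
          measurable_space[OF bwd.particle_measurable_M[OF M pb _ IJ(2), of "T - Suc s"] w]
          measurable_space[OF xit[OF l] w] unfolding sT(4) by auto
      then have "wtt l w \<le> ennreal Kv"
        using Kv(2)[of "(xi (s - 1) (It l w) w, xib (Suc s) (Jt l w) w, xit l w)"] wtt[OF l w] by simp
      then show ?thesis by (auto intro: le_less_trans)
    qed
    ultimately show ?thesis by blast
  qed
  moreover have "0 < measure (smoothing_measure s) (space lam)"
    using K.measure_propagated_pos unfolding propagated by simp
  ultimately show ?thesis
    using BC K.rate_pos[of C] by (intro conjI exI[of _ "4 + 4 * B"] exI[of _ "K.rate C"]) auto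
qed

end

section \<open>From unit-range test functions to bounded functions and their oscillation\<close>

lemma weighted_mean_eq_weighted_average:
  assumes fin: "\<And>l. l \<in> {1..N} \<Longrightarrow> wt l w < \<infinity>" and pos: "0 < (\<Sum>l=1..N. wt l w)"
  shows "weighted_mean N wt xi h w = weighted_average {1..N} (\<lambda>l. enn2real (wt l w)) (\<lambda>l. h (xi l w))"
    and "0 < (\<Sum>l=1..N. enn2real (wt l w))"
proof -
  have W: "wt l w = ennreal (enn2real (wt l w))" if "l \<in> {1..N}" for l using fin[OF that] by simp
  have sum: "(\<Sum>l=1..N. wt l w) = ennreal (\<Sum>l=1..N. enn2real (wt l w))"
    using W by (subst sum_ennreal[symmetric]) (auto intro: sum.cong)
  show P: "0 < (\<Sum>l=1..N. enn2real (wt l w))" using pos unfolding sum by simp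
  \<comment> \<open>Finite weights with a positive sum make the \<open>ennreal\<close> quotient
    agree with the real one.\<close>
  have "enn2real (wt l w / (\<Sum>l=1..N. wt l w)) = enn2real (wt l w) / (\<Sum>l=1..N. enn2real (wt l w))" if "l \<in> {1..N}" for l
    unfolding sum by (subst W[OF that], subst divide_ennreal) (use P in auto)
  then show "weighted_mean N wt xi h w = weighted_average {1..N} (\<lambda>l. enn2real (wt l w)) (\<lambda>l. h (xi l w))"
    by (simp add: weighted_mean_def weighted_average_def sum_divide_distrib)
qed

text \<open>The constant \<open>a\<close> survives the averaging only because the total weight is
  nonzero.\<close>

lemma weighted_average_affine:
  assumes "(\<Sum>i\<in>J. W i) \<noteq> 0"
  shows "weighted_average J W (\<lambda>i. a + c * X i) = a + c * weighted_average J W X"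
  using assms by (simp add: weighted_average_def distrib_left sum.distrib sum_distrib_right[symmetric]
      add_divide_distrib mult.left_commute[of _ c] sum_distrib_left[symmetric])

lemma abs_diff_le_osc:
  assumes "bounded (h ` A)" "x \<in> A" "y \<in> A"
  shows "\<bar>h x - h y\<bar> \<le> osc A h"
proof -
  obtain b where b: "\<And>x. x \<in> A \<Longrightarrow> \<bar>h x\<bar> \<le> b" using assms(1) by (auto simp: bounded_iff)
  have "bdd_above ((\<lambda>(z, z'). \<bar>h z - h z'\<bar>) ` (A \<times> A))"
  proof (rule bdd_aboveI2[where M = "b + b"])
    fix p assume "p \<in> A \<times> A"
    then show "(case p of (z, z') \<Rightarrow> \<bar>h z - h z'\<bar>) \<le> b + b"
      using b[of "fst p"] b[of "snd p"] by (auto simp: case_prod_beta abs_le_iff)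
  qed
  from cSUP_upper[OF _ this, of "(x, y)"] assms show ?thesis by (simp add: osc_def)
qed

text \<open>Affine maps pass through \<open>weighted_mean\<close> and \<open>target\<close>, so
  \<open>h\<close> can be replaced by \<open>(h - inf h) / osc\<close>, a unit function, and the
  threshold by \<open>eps / osc\<close>. For \<open>weighted_mean\<close> this needs positive total
  weight, so the deviations are related almost surely.\<close>

lemma weighted_mean_tail:
  assumes M: "prob_space M" and mu: "0 < measure mu (space mu)"
    and xi: "\<And>l. l \<in> {1..N} \<Longrightarrow> xi l \<in> M \<rightarrow>\<^sub>M mu"
    and fin: "\<And>l w. l \<in> {1..N} \<Longrightarrow> w \<in> space M \<Longrightarrow> wt l w < \<infinity>"
    and pos: "AE w in M. 0 < (\<Sum>l=1..N. wt l w)"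
    and conc: "concentrates M (real N) {1..N} (\<lambda>l w. enn2real (wt l w)) xi mu B C"
    and h: "h \<in> borel_measurable mu" "bounded (h ` space mu)" and e: "0 < eps"
  shows "measure M {w\<in>space M. \<bar>weighted_mean N wt xi h w - target mu h\<bar> > eps}
    \<le> (if osc (space mu) h = 0 then 0 else B * exp (- (C * real N * eps\<^sup>2 / (osc (space mu) h)\<^sup>2)))"
proof -
  interpret M: prob_space M by fact
  define osc_h where "osc_h = osc (space mu) h"
  have ne: "space mu \<noteq> {}" using mu by auto
  \<comment> \<open>\<open>measure\<close> of a space of infinite mass is 0, so a positive value
    forces finiteness.\<close>
  have fm: "finite_measure mu"
    using mu by (intro finite_measureI) (auto simp: measure_def enn2real_eq_0_iff)
  interpret mu: finite_measure mu by (rule fm)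
  define a where "a = (INF x\<in>space mu. h x)"
  have bb: "bdd_below (h ` space mu)" using h(2) by (rule bounded_imp_bdd_below)
  have ha: "0 \<le> h x - a \<and> h x - a \<le> osc_h" if x: "x \<in> space mu" for x
  proof
    show "0 \<le> h x - a" unfolding a_def using cINF_lower[OF bb x] by simp
    have "h x - osc_h \<le> a"
      unfolding a_def
    proof (rule cINF_greatest[OF ne])
      fix y assume "y \<in> space mu"
      then show "h x - osc_h \<le> h y" using abs_diff_le_osc[OF h(2) x, of y] by (simp add: osc_h_def)
    qed
    then show "h x - a \<le> osc_h" by simp
  qed
  obtain x0 where "x0 \<in> space mu" using ne by auto
  then have o0: "0 \<le> osc_h" using ha[of x0] by linarith
  \<comment> \<open>If \<open>osc_h = 0\<close>, real division makes \<open>f\<close> zero while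
    \<open>h\<close> equals \<open>a\<close> on the space, so the affine identity \<open>hf\<close>
    still holds.\<close>
  define f where "f x = (h x - a) / osc_h" for x
  have hf: "h x = a + osc_h * f x" if "x \<in> space mu" for x
    using ha[OF that] by (cases "osc_h = 0") (auto simp: f_def)
  have "f \<in> borel_measurable mu"
    unfolding f_def[abs_def] using h(1) by measurable
  then have f: "unit_function mu f"
    using ha o0 by (auto simp: unit_function_def f_def divide_le_eq_1)
  have fi: "integrable mu f"
    using f by (intro mu.integrable_const_bound[where B = 1]) (auto simp: unit_function_def)
  have th: "target mu h = a + osc_h * target mu f"
  proof -
    have "(\<integral>x. h x \<partial>mu) = (\<integral>x. a + osc_h * f x \<partial>mu)" by (intro Bochner_Integration.integral_cong) (auto simp: hf)
    then show ?thesis using fi mu by (simp add: target_def add_divide_distrib)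
  qed
  have dev: "AE w in M. weighted_mean N wt xi h w - target mu h =
      osc_h * (weighted_average {1..N} (\<lambda>l. enn2real (wt l w)) (\<lambda>l. f (xi l w)) - target mu f)"
    using pos AE_space
  proof eventually_elim
    case (elim w)
    have "weighted_mean N wt xi h w = weighted_average {1..N} (\<lambda>l. enn2real (wt l w)) (\<lambda>l. h (xi l w))"
      using fin elim by (intro weighted_mean_eq_weighted_average) auto
    also have "\<dots> = weighted_average {1..N} (\<lambda>l. enn2real (wt l w)) (\<lambda>l. a + osc_h * f (xi l w))"
      using hf measurable_space[OF xi elim(2)] by (simp add: weighted_average_def)
    also have "\<dots> = a + osc_h * weighted_average {1..N} (\<lambda>l. enn2real (wt l w)) (\<lambda>l. f (xi l w))"
      using weighted_mean_eq_weighted_average(2)[of N wt w] fin elim by (intro weighted_average_affine) auto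
    finally show ?case by (simp add: th right_diff_distrib)
  qed
  show ?thesis
  proof (cases "osc_h = 0")
    case True
    \<comment> \<open>The sample average and the target both return the constant value of
      \<open>h\<close>.\<close>
    have "AE w in M. \<not> \<bar>weighted_mean N wt xi h w - target mu h\<bar> > eps"
      using dev by eventually_elim (use True e in simp)
    then have "emeasure M {w\<in>space M. \<bar>weighted_mean N wt xi h w - target mu h\<bar> > eps} = 0"
      by (rule emeasure_eq_0_AE)
    then show ?thesis using True by (simp add: measure_def osc_h_def)
  next
    case False
    with o0 have op: "0 < osc_h" by simp
    let ?Z = "\<lambda>w. weighted_average {1..N} (\<lambda>l. enn2real (wt l w)) (\<lambda>l. f (xi l w)) - target mu f"
    have t: "tail_bound M (real N) B C ?Z" using conc f unfolding concentrates_def by blast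
    have [measurable]: "?Z \<in> borel_measurable M" using t by (simp add: tail_bound_def)
    have "measure M {w\<in>space M. \<bar>weighted_mean N wt xi h w - target mu h\<bar> > eps} \<le> measure M {w\<in>space M. \<bar>?Z w\<bar> > eps / osc_h}"
    proof (rule M.finite_measure_mono_AE)
      show "AE w in M. w \<in> {w\<in>space M. \<bar>weighted_mean N wt xi h w - target mu h\<bar> > eps} \<longrightarrow> w \<in> {w\<in>space M. \<bar>?Z w\<bar> > eps / osc_h}"
        using dev
      proof eventually_elim
        case (elim w)
        have "\<bar>weighted_mean N wt xi h w - target mu h\<bar> = osc_h * \<bar>?Z w\<bar>"
          unfolding elim abs_mult using op by simp
        then show ?case using op by (simp add: pos_divide_less_eq mult.commute)
      qed
    qed measurable
    also have "\<dots> \<le> B * exp (- (C * real N * (eps / osc_h)\<^sup>2))"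
      using e op by (intro tail_boundD[OF t]) simp
    finally show ?thesis using False by (simp add: osc_h_def power_divide)
  qed
qed

theorem theorem2:
  fixes lam chi rho0 :: "'a measure"
    and q :: "'a \<Rightarrow> 'a \<Rightarrow> real"
    and g gamma th thb :: "nat \<Rightarrow> 'a \<Rightarrow> real"
    and p r tht :: "nat \<Rightarrow> 'a \<Rightarrow> 'a \<Rightarrow> real"
    and rt :: "nat \<Rightarrow> 'a \<times> 'a \<Rightarrow> 'a \<Rightarrow> real"
    and D :: "'a \<Rightarrow> ennreal"
    and rhoT :: "'a \<Rightarrow> real"
    and T :: nat
  assumes lam: "sigma_finite_measure lam" "countably_generated lam"
    and q: "transition_density lam lam q"
    and g: "\<forall>t\<in>{0..T}. positive_function lam (g t)"
    and chi: "prob_space chi" "sets chi = sets lam"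
    and gamma: "\<forall>t\<in>{0..T}. positive_function lam (gamma t)"
      "\<forall>t\<in>{0..T}. artificial_mass lam q g gamma T t < \<infinity>"
    and rho0: "prob_space rho0" "sets rho0 = sets lam"
      "absolutely_continuous rho0 chi" "D \<in> borel_measurable rho0" "density rho0 D = chi"
    and forward: "\<forall>t\<in>{1..T}. nonneg_function lam (th t)"
      "\<forall>t\<in>{1..T}. transition_density lam lam (p t)"
    and backward: "probability_density lam rhoT"
      "\<forall>t\<in>{0..<T}. nonneg_function lam (thb t)"
      "\<forall>t\<in>{0..<T}. transition_density lam lam (r t)"
    and two_filter: "\<forall>t\<in>{1..<T}. nonneg_function (lam \<Otimes>\<^sub>M lam) (\<lambda>(x, x'). tht t x x')"
      "\<forall>t\<in>{1..<T}. transition_density (lam \<Otimes>\<^sub>M lam) lam (rt t)"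
    and bound1: "sup_norm (space lam \<times> space lam) (\<lambda>(x, x'). ennreal (q x x')) < \<infinity>"
      "\<forall>t\<in>{0..T}. sup_norm (space lam) (\<lambda>x. ennreal (g t x)) < \<infinity>"
    and bound2: "sup_norm (space lam) (fwd_weight_init D g) < \<infinity>"
      "\<forall>t\<in>{1..T}. sup_norm (space lam \<times> space lam) (\<lambda>(x, x'). fwd_weight q g th p t x x') < \<infinity>"
      "\<forall>t\<in>{1..T}. sup_norm (space lam) (\<lambda>x. ennreal (th t x)) < \<infinity>"
      "\<forall>t\<in>{1..T}. sup_norm (space lam \<times> space lam) (\<lambda>(x, x'). ennreal (p t x x')) < \<infinity>"
    and bound3: "\<forall>t\<in>{0..<T}. sup_norm (space lam) (\<lambda>x. ennreal (thb t x / gamma (t + 1) x)) < \<infinity>"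
      "\<forall>t\<in>{0..<T}. sup_norm (space lam \<times> space lam) (\<lambda>(x', x). ennreal (r t x' x)) < \<infinity>"
      "sup_norm (space lam) (bwd_weight_init g gamma rhoT T) < \<infinity>"
      "\<forall>t\<in>{0..<T}. sup_norm (space lam \<times> space lam)
                     (\<lambda>(x, x'). bwd_weight q g gamma thb r t x x') < \<infinity>"
      "\<forall>t\<in>{1..<T}. sup_norm (space lam \<times> space lam)
                     (\<lambda>(x, x'). ennreal (tht t x x' / gamma (t + 1) x')) < \<infinity>"
      "\<forall>t\<in>{1..<T}. sup_norm (space lam \<times> space lam)
                     (\<lambda>(x, x'). ennreal (q x x' / gamma (t + 1) x')) < \<infinity>"
      "\<forall>t\<in>{1..<T}. sup_norm (space lam \<times> space lam \<times> space lam)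
                     (\<lambda>(x, x', x''). two_filter_weight q g tht rt t x x' x'') < \<infinity>"
      "\<forall>t\<in>{1..<T}. sup_norm (space lam \<times> space lam \<times> space lam)
                     (\<lambda>(x, x', x''). ennreal (rt t (x, x') x'')) < \<infinity>"
  shows "\<forall>s\<in>{1..<T}. \<exists>B C :: real. 0 < B \<and> 0 < C \<and>
    (\<forall>(N :: nat) (eps :: real) (h :: 'a \<Rightarrow> real) (M :: 'w measure)
        xi I wt xib Ib wtb xit It Jt wtt.
      1 \<le> N \<longrightarrow> 0 < eps \<longrightarrow> h \<in> borel_measurable lam \<longrightarrow> bounded (h ` space lam) \<longrightarrow>
      prob_space M \<longrightarrow>
      forward_filter lam q g rho0 D th p T N M xi I wt \<longrightarrow>
      backward_filter lam q g gamma rhoT thb r T N M xib Ib wtb \<longrightarrow>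
      independent_filters lam T N M xi I xib Ib \<longrightarrow>
      two_filter_sample lam q g gamma tht rt T s N M xi I wt xib Ib wtb xit It Jt wtt \<longrightarrow>
      measure M {w\<in>space M.
          \<bar>weighted_mean N wtt xit h w - marginal_smoothing lam q g chi T s h\<bar> > eps}
        \<le> (if osc (space lam) h = 0 then 0
            else B * exp (- (C * real N * eps\<^sup>2 / (osc (space lam) h)\<^sup>2))))"
proof
  fix s assume s: "s \<in> {1..<T}"
  interpret lam: sigma_finite_measure lam by (rule lam(1))
  interpret chi: prob_space chi by (rule chi(1))
  interpret hidden_markov lam chi q g T
    by unfold_locales (fact q, fact g, fact chi(2))
  interpret two_filter_model lam chi q g T rho0 D gamma th thb p r tht rt rhoT
    by (intro two_filter_model.intro two_filter_model_axioms.intro hidden_markov_axioms)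
       (fact gamma(1) rho0 forward backward two_filter bound2 bound3)+
  have mass: "0 < measure (smoothing_measure s) (space (smoothing_measure s))"
    using smoothing_concentrates[OF s] unfolding space_smoothing_measure by blast
  obtain B C where BC: "0 \<le> B" "0 < C"
    and conc: "\<And>(M :: 'w measure) N xi I wt xib Ib wtb xit It Jt wtt.
       two_filter_run s N M xi I wt xib Ib wtb xit It Jt wtt \<Longrightarrow>
       (\<forall>l\<in>{1..N}. xit l \<in> M \<rightarrow>\<^sub>M lam \<and> (\<forall>w\<in>space M. wtt l w < \<infinity>)) \<and>
       concentrates M (real N) {1..N} (\<lambda>l w. enn2real (wtt l w)) xit (smoothing_measure s) B C"
    using smoothing_concentrates[OF s, where 'w = 'w] by blast
  \<comment> \<open>The analysis of the forward filter makes the earlier filter measures finite,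
    which supplies the sigma-finiteness for cutting paths at \<open>s\<close>.\<close>
  have sm: "marginal_smoothing lam q g chi T s h = target (smoothing_measure s) h"
    if "h \<in> borel_measurable lam" for h
  proof (rule marginal_smoothing_eq_target[OF _ _ that])
    show "s \<le> T" using s by simp
    fix u assume "u < s"
    then have "finite_measure (filter_measure u)" using fwd.particle_filter_concentrates[of u] s by auto
    then show "sigma_finite_measure (filter_measure u)" by (rule finite_measure.sigma_finite_measure)
  qed
  show "\<exists>B C :: real. 0 < B \<and> 0 < C \<and>
    (\<forall>(N :: nat) (eps :: real) (h :: 'a \<Rightarrow> real) (M :: 'w measure)
        xi I wt xib Ib wtb xit It Jt wtt.
      1 \<le> N \<longrightarrow> 0 < eps \<longrightarrow> h \<in> borel_measurable lam \<longrightarrow> bounded (h ` space lam) \<longrightarrow>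
      prob_space M \<longrightarrow>
      forward_filter lam q g rho0 D th p T N M xi I wt \<longrightarrow>
      backward_filter lam q g gamma rhoT thb r T N M xib Ib wtb \<longrightarrow>
      independent_filters lam T N M xi I xib Ib \<longrightarrow>
      two_filter_sample lam q g gamma tht rt T s N M xi I wt xib Ib wtb xit It Jt wtt \<longrightarrow>
      measure M {w\<in>space M.
          \<bar>weighted_mean N wtt xit h w - marginal_smoothing lam q g chi T s h\<bar> > eps}
        \<le> (if osc (space lam) h = 0 then 0
            else B * exp (- (C * real N * eps\<^sup>2 / (osc (space lam) h)\<^sup>2))))"
  \<comment> \<open>\<open>B\<close> is only known to be nonnegative; adding 1 makes the constant
    strictly positive and merely weakens the bound.\<close>
  proof (rule exI[of _ "B + 1"], rule exI[of _ C], intro conjI allI impI)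
    fix N :: nat and eps :: real and h :: "'a \<Rightarrow> real" and M :: "'w measure" and xi I wt xib Ib wtb xit It Jt wtt
    assume eps: "0 < eps" and h: "h \<in> borel_measurable lam" "bounded (h ` space lam)" and M: "prob_space M"
      and tf: "two_filter_sample lam q g gamma tht rt T s N M xi I wt xib Ib wtb xit It Jt wtt"
      and *: "1 \<le> N" "forward_filter lam q g rho0 D th p T N M xi I wt"
        "backward_filter lam q g gamma rhoT thb r T N M xib Ib wtb" "independent_filters lam T N M xi I xib Ib"
    have c: "(\<forall>l\<in>{1..N}. xit l \<in> M \<rightarrow>\<^sub>M lam \<and> (\<forall>w\<in>space M. wtt l w < \<infinity>)) \<and>
       concentrates M (real N) {1..N} (\<lambda>l w. enn2real (wtt l w)) xit (smoothing_measure s) B C"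
      by (rule conc) (unfold two_filter_run_def, use M tf * in blast)
    show "measure M {w\<in>space M. \<bar>weighted_mean N wtt xit h w - marginal_smoothing lam q g chi T s h\<bar> > eps}
        \<le> (if osc (space lam) h = 0 then 0
            else (B + 1) * exp (- (C * real N * eps\<^sup>2 / (osc (space lam) h)\<^sup>2)))"
      unfolding sm[OF h(1)] space_smoothing_measure[of s, symmetric]
    proof (rule weighted_mean_tail[OF M mass])
      show "xit l \<in> M \<rightarrow>\<^sub>M smoothing_measure s" if "l \<in> {1..N}" for l
        using c that by (simp cong: measurable_cong_sets)
      show "AE w in M. 0 < (\<Sum>l=1..N. wtt l w)"
        using tf unfolding two_filter_sample_def by blast
      show "concentrates M (real N) {1..N} (\<lambda>l w. enn2real (wtt l w)) xit (smoothing_measure s) (B + 1) C"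
        by (rule concentrates_weaken[OF conjunct2[OF c]]) (use BC in auto)
      show "h \<in> borel_measurable (smoothing_measure s)" using h by (simp cong: measurable_cong_sets)
    qed (use c h eps in auto)
  qed (use BC in auto)
qed

end
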